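(* Let $m\ge1$ be an integer. Let $y$ be the exact solution of the first-kind Volterra integral equation $\int_0^t k(t,s)y(s)\,ds=g(t)$, $t\in I=[0,T]$, where $g(0)=0$ and $|k(t,t)|\ge k_0>0$ for all $t\in I$, and let $y_h\in S_{m-1}^{(-1)}(I_h)$ be the perturbed discontinuous Galerkin solution defined by $$\int_{t_n}^{t_{n+1}}\Bigl(\int_0^sk(s,\tau)y_h(\tau)\,d\tau\Bigr)\phi(s)\,ds=\int_{t_n}^{t_{n+1}}g(s)\phi(s)\,ds+\int_{t_n}^{t_{n+1}}\delta(s)\phi(s)\,ds$$ for all $\phi\in S_{m-1}^{(-1)}(I_h)$ and $0\le n\le N-1$, with $\delta=O(h^{m_1})$. (1) Suppose that $m$ is odd, $g\in C^{m+4}(I)$, $k\in C^{m+4}(D)$, and the exact solution satisfies $y^{(m)}(0)=0$. Then, for all uniform meshes $I_h$ with sufficiently small $h$, $$|y(t_n+s_rh)-y_h(t_n+s_rh)|\le Ch^{\min\{m+1,\,m_1-2\}}$$ for all $0\le n\le N-1$ and $0\le r\le m-1$, where the points $\{s_r\}_{r=0}^{m-1}$ satisfy $P_{m+1}'(s_r)=0$. (2) Suppose that $m$ is even, $g\in C^{m+3}(I)$ and $k\in C^{m+3}(D)$. Then, for all uniform meshes $I_h$ with sufficiently small $h$, $$|y(t_n+s_rh)-y_h(t_n+s_rh)|\le Ch^{\min\{m,\,m_1-2\}}$$ for all $0\le n\le N-1$ and $1\le r\le m-1$, where the points $\{s_r\}_{r=1}^{m-1}$ satisfy $P_m'(s_r)=0$.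 Here $C$ denotes constants independent of $h$.
   Context: $I=[0,T]$, $D=\{(t,s):0\le s\le t\le T\}$; all functions are real-valued. For an integer $N\ge2$, the uniform mesh is $I_h=\{t_n=nh:0\le n\le N\}$ with $h=T/N$, and $\sigma_n=(t_n,t_{n+1}]$. $S_{m-1}^{(-1)}(I_h)$ is the space of functions $v$ such that $v|_{\sigma_n}$ is a real polynomial of degree at most $m-1$ for each $0\le n\le N-1$ (no continuity at mesh points). $P_j$ is the shifted Legendre polynomial of degree $j$ on $[0,1]$; the zeros of $P_j'$ lie in $(0,1)$. The perturbation $\delta$ is a function on $I$ that may depend on $h$; $\delta=O(h^{m_1})$ means that $\sup_{t\in I}|\delta(t)|\le C' h^{m_1}$ with $C'$ independent of $h$, where $m_1$ is fixed. *)

theory Defs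
  imports "HOL-Analysis.Analysis" "HOL-Computational_Algebra.Polynomial"
begin

(* C^n up to the boundary: all derivatives are taken within S (one-sided on a closed interval).
   On the sets used here (a nondegenerate closed interval, a closed triangle) these
   derivatives are unique; f' x is the gradient of f at x. *)
primrec Ck_on :: "nat \<Rightarrow> 'a set \<Rightarrow> ('a::euclidean_space \<Rightarrow> real) \<Rightarrow> bool" where
  "Ck_on 0 S f \<longleftrightarrow> continuous_on S f"
| "Ck_on (Suc n) S f \<longleftrightarrow>
     (\<exists>f'. (\<forall>x\<in>S. (f has_derivative (\<lambda>v. f' x \<bullet> v)) (at x within S)) \<and>
           (\<forall>b\<in>Basis. Ck_on n S (\<lambda>x. f' x \<bullet> b)))"

definition deriv_within :: "nat \<Rightarrow> real set \<Rightarrow> (real \<Rightarrow> real) \<Rightarrow> real \<Rightarrow> real" where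
  "deriv_within n S f = ((\<lambda>u t. vector_derivative u (at t within S)) ^^ n) f"

definition volterra_domain :: "real \<Rightarrow> (real \<times> real) set" where
  "volterra_domain T = {(t, s). 0 \<le> s \<and> s \<le> t \<and> t \<le> T}"

(* Rodrigues' formula P_n(x) = (1/n!) (d/dx)^n (x^2 - x)^n on [0,1]; thus P_n(1) = 1. *)
definition shifted_legendre :: "nat \<Rightarrow> real poly" where
  "shifted_legendre n = smult (1 / fact n) ((pderiv ^^ n) ([:0, -1, 1:] ^ n))"

definition mesh_width :: "real \<Rightarrow> nat \<Rightarrow> real" where
  "mesh_width T N = T / real N"

definition mesh_pt :: "real \<Rightarrow> nat \<Rightarrow> nat \<Rightarrow> real" where
  "mesh_pt T N n = real n * mesh_width T N"

(* dg_space d T N is S_d^(-1)(I_h): piecewise degree at most d on the half-open cells.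
   The value at t = 0 lies in no cell and is unconstrained. *)
definition dg_space :: "nat \<Rightarrow> real \<Rightarrow> nat \<Rightarrow> (real \<Rightarrow> real) set" where
  "dg_space d T N =
     {v. \<forall>n<N. \<exists>p::real poly. degree p \<le> d \<and>
           (\<forall>t\<in>{mesh_pt T N n<..mesh_pt T N (Suc n)}. v t = poly p t)}"

definition volterra :: "(real \<Rightarrow> real \<Rightarrow> real) \<Rightarrow> (real \<Rightarrow> real) \<Rightarrow> real \<Rightarrow> real" where
  "volterra k y t = integral {0..t} (\<lambda>s. k t s * y s)"

(* Continuity makes the point values of y meaningful; the equation alone
   determines y only almost everywhere. *)
definition exact_solution ::
  "real \<Rightarrow> (real \<Rightarrow> real \<Rightarrow> real) \<Rightarrow> (real \<Rightarrow> real) \<Rightarrow> (real \<Rightarrow> real) \<Rightarrow> bool" where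
  "exact_solution T k g y \<longleftrightarrow>
     continuous_on {0..T} y \<and> (\<forall>t\<in>{0..T}. volterra k y t = g t)"

definition perturbed_dg_solution ::
  "nat \<Rightarrow> real \<Rightarrow> nat \<Rightarrow> (real \<Rightarrow> real \<Rightarrow> real) \<Rightarrow> (real \<Rightarrow> real) \<Rightarrow> (real \<Rightarrow> real) \<Rightarrow> (real \<Rightarrow> real) \<Rightarrow> bool" where
  "perturbed_dg_solution m T N k g \<delta> yh \<longleftrightarrow>
     yh \<in> dg_space (m - 1) T N \<and>
     (\<forall>\<phi>\<in>dg_space (m - 1) T N. \<forall>n<N.
        integral {mesh_pt T N n..mesh_pt T N (Suc n)} (\<lambda>s. volterra k yh s * \<phi> s) =
        integral {mesh_pt T N n..mesh_pt T N (Suc n)} (\<lambda>s. g s * \<phi> s) +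
        integral {mesh_pt T N n..mesh_pt T N (Suc n)} (\<lambda>s. \<delta> s * \<phi> s))"

end

theory Submission imports Defs begin

text \<open>
  Let \<open>e\<close> be the error \<open>y - y\<^sub>h\<close> and \<open>E\<close> its primitive vanishing at \<open>0\<close>. Integration by parts turns the Volterra
  operator applied to \<open>e\<close> into \<open>\<kappa>(t) E(t) - \<integral>\<^sub>0\<^sup>t q(t,s) E(s) ds\<close> with \<open>\<kappa>(t) = k(t,t)\<close> and \<open>q\<close> the
  \<open>s\<close>-derivative of \<open>k\<close>. On the \<open>n\<close>-th cell \<open>E\<close> is, up to a Taylor remainder, a combination of
  \<open>P\<^sub>0, \<dots>, P\<^sub>m\<^sub>+\<^sub>1\<close>. The coefficient of \<open>P\<^sub>m\<^sub>+\<^sub>1\<close> is a multiple of \<open>h ^ (m + 1)\<close> times the \<open>m\<close>-th derivative of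
  \<open>y\<close>; those of \<open>P\<^sub>0, \<dots>, P\<^sub>m\<^sub>-\<^sub>1\<close> are seen by the Galerkin equations; the coefficient \<open>d\<^sub>n\<close> of \<open>P\<^sub>m\<close> is not, but
  the continuity of \<open>E\<close> gives \<open>d\<^sub>n\<^sub>+\<^sub>1 \<approx> (-1)\<^sup>m d\<^sub>n\<close>. In the memory term \<open>P\<^sub>m\<close> and \<open>P\<^sub>m\<^sub>+\<^sub>1\<close> are orthogonal to
  constants and so gain a factor \<open>h\<close>, which is what makes a discrete Gronwall argument close.

  If \<open>m\<close> is even, the \<open>d\<^sub>n\<close> accumulate, but their contribution to \<open>e\<close> vanishes at the zeros of \<open>P\<^sub>m'\<close>. If \<open>m\<close>
  is odd, the \<open>d\<^sub>n\<close> alternate; subtracting the Galerkin equations of neighbouring cells shows that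
  \<open>d\<^sub>n\<^sub>+\<^sub>2 - d\<^sub>n\<close> is of higher order, so that \<open>d\<^sub>n\<close> stays as scaled_coefficient_le as \<open>d\<^sub>0\<close>, which is scaled_coefficient_le because the \<open>m\<close>-th
  derivative of \<open>y\<close> vanishes at \<open>0\<close>. The leading part of \<open>e\<close> is then a multiple of \<open>P\<^sub>m\<^sub>+\<^sub>1'\<close>.
\<close>

section \<open>Shifted Legendre polynomials\<close>

text \<open>The bookkeeping counts powers of \<open>h\<close>. A coefficient of \<open>E\<close> in
  the cell coordinate is divided by \<open>h\<close> to give a value of \<open>e\<close>. Across a
  mesh point the coefficients of \<open>P (m + 1)\<close> add when \<open>m\<close> is even and
  subtract when \<open>m\<close> is odd, so the defect per cell is
  \<open>\<Delta> + h ^ (m + 1)\<close> or \<open>\<Delta> + h ^ (m + 2)\<close>. The coefficients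
  below \<open>m\<close> inherit this order, while \<open>d\<close> collects about
  \<open>1 / h\<close> such defects and is one power worse. For even \<open>m\<close> the term with
  \<open>d\<close> drops out and a single division by \<open>h\<close> remains. For odd
  \<open>m\<close> it survives and has to be improved: the first bound becomes an a priori bound,
  and a second pass over the differences of neighbouring cells lowers the defect to
  \<open>\<Delta> + h ^ (m + 3)\<close>. Accumulation and differentiation then cost one division by
  \<open>h\<close> each, which is the origin of the exponent \<open>m1 - 2\<close>. The second pass
  is also the reason why mixed and second differences of the data are estimated.\<close>

abbreviation (input) "P \<equiv> shifted_legendre"

text \<open>A functional on polynomials rather than on functions, so that orthogonality can be
  derived by algebra in the polynomial ring.\<close>

definition unit_integral :: "real poly \<Rightarrow> real" where
  "unit_integral p = integral {0..1} (poly p)"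

lemma integrable_poly [simp]: "poly (p::real poly) integrable_on {a..b}"
  by (intro integrable_continuous_real continuous_intros)

lemma unit_integral_add: "unit_integral (p + q) = unit_integral p + unit_integral q"
proof -
  have "poly (p + q) = (\<lambda>x. poly p x + poly q x)" by auto
  then show ?thesis unfolding unit_integral_def by (simp add: Henstock_Kurzweil_Integration.integral_add)
qed

lemma unit_integral_smult: "unit_integral (smult c p) = c * unit_integral p"
proof -
  have "poly (smult c p) = (\<lambda>x. c * poly p x)" by auto
  then show ?thesis unfolding unit_integral_def by simp
qed

lemma unit_integral_0 [simp]: "unit_integral 0 = 0"
  using unit_integral_smult[of 0 0] by simp

lemma unit_integral_sum: "unit_integral (\<Sum>i\<in>A. f i) = (\<Sum>i\<in>A. unit_integral (f i))"
  by (induction A rule: infinite_finite_induct) (auto simp: unit_integral_add)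

lemma unit_integral_pderiv: "unit_integral (pderiv p) = poly p 1 - poly p 0"
proof -
  have "(poly (pderiv p) has_integral (poly p 1 - poly p 0)) {0..1}"
    by (rule fundamental_theorem_of_calculus)
       (auto intro!: DERIV_subset[OF poly_DERIV] simp flip: has_real_derivative_iff_has_vector_derivative)
  then show ?thesis unfolding unit_integral_def by (rule integral_unique)
qed

lemma unit_integral_by_parts:
  assumes "poly u 0 = 0" "poly u 1 = 0"
  shows "unit_integral (pderiv u * v) = - unit_integral (u * pderiv v)"
proof -
  have "unit_integral (pderiv u * v) + unit_integral (u * pderiv v) = 0"
    using unit_integral_pderiv[of "u * v"] assms
    by (simp add: pderiv_mult unit_integral_add algebra_simps)
  then show ?thesis by simp
qed

lemma power_dvd_pderiv:
  fixes c :: "real poly"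
  assumes "c ^ Suc k dvd u" shows "c ^ k dvd pderiv u"
proof -
  obtain v where "u = c ^ Suc k * v" using assms by (elim dvdE)
  then have "pderiv u = c ^ Suc k * pderiv v + v * (smult (real (Suc k)) (c ^ k) * pderiv c)"
    by (simp only: pderiv_mult pderiv_power_Suc)
  also have "c ^ k dvd \<dots>"
    by (intro dvd_add) (auto simp: dvd_smult)
  finally show ?thesis .
qed

lemma power_dvd_higher_pderiv:
  fixes c :: "real poly"
  shows "c ^ k dvd (pderiv ^^ i) (c ^ (k + i))"
proof (induction i arbitrary: k)
  case (Suc i)
  show ?case using Suc[of "Suc k"] by (simp add: power_dvd_pderiv)
qed simp

text \<open>For \<open>i < n\<close> the derivatives of \<open>c ^ n\<close> keep a factor
  \<open>c\<close> and vanish at both ends, so none of the integrations by parts leaves a boundary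
  term.\<close>

lemma unit_integral_higher_by_parts:
  fixes c :: "real poly"
  assumes "poly c 0 = 0" "poly c 1 = 0" "i \<le> n"
  shows "unit_integral ((pderiv ^^ i) (c ^ n) * v) = (-1) ^ i * unit_integral (c ^ n * (pderiv ^^ i) v)"
  using assms(3)
proof (induction i arbitrary: v)
  case (Suc i)
  have "c dvd (pderiv ^^ i) (c ^ n)"
    using power_dvd_higher_pderiv[of c "n - i" i] Suc.prems
    by (metis Suc_diff_Suc Suc_le_lessD dvd_trans dvd_triv_left le_add_diff_inverse2 less_or_eq_imp_le power_Suc)
  then obtain w where "(pderiv ^^ i) (c ^ n) = c * w" by (elim dvdE)
  then have "poly ((pderiv ^^ i) (c ^ n)) 0 = 0" "poly ((pderiv ^^ i) (c ^ n)) 1 = 0"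
    using assms by auto
  then have "unit_integral ((pderiv ^^ Suc i) (c ^ n) * v) = - unit_integral ((pderiv ^^ i) (c ^ n) * pderiv v)"
    by (simp add: unit_integral_by_parts)
  also have "\<dots> = (-1) ^ Suc i * unit_integral (c ^ n * (pderiv ^^ Suc i) v)"
    using Suc by (simp add: funpow_Suc_right del: funpow.simps)
  finally show ?case .
qed simp

lemma higher_pderiv_eq_0: "degree (p::real poly) < n \<Longrightarrow> (pderiv ^^ n) p = 0"
proof (induction n arbitrary: p)
  case (Suc n)
  show ?case
  proof (cases "degree p = 0")
    case True
    then show ?thesis using Suc by (metis Suc_eq_plus1 add_diff_cancel_left' funpow_swap1 funpow.simps(2) o_apply pderiv_0 pderiv_eq_0_iff higher_pderiv_0)
  next
    case False
    then have "degree (pderiv p) < n" using Suc.prems by (simp add: degree_pderiv)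
    then show ?thesis using Suc.IH by (simp add: funpow_swap1)
  qed
qed simp

text \<open>All \<open>n\<close> derivatives in Rodrigues' formula are moved onto \<open>p\<close>,
  which they annihilate.\<close>

lemma legendre_orthogonal:
  assumes "degree p < n" shows "unit_integral (P n * p) = 0"
  using unit_integral_higher_by_parts[of "[:0,-1,1:]" n n p] higher_pderiv_eq_0[OF assms]
  by (simp add: shifted_legendre_def unit_integral_smult)

lemma pcompose_power:
  fixes p :: "real poly" shows "pcompose (p ^ n) q = pcompose p q ^ n"
  by (induction n) (auto simp: pcompose_mult pcompose_1)

lemma pcompose_higher_pderiv:
  fixes p :: "real poly"
  assumes "b \<noteq> 0"
  shows "pcompose ((pderiv ^^ n) p) [:a, b:] = smult (inverse b ^ n) ((pderiv ^^ n) (pcompose p [:a, b:]))"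
proof (induction n)
  case (Suc n)
  have "smult b (pcompose (pderiv q) [:a, b:]) = pderiv (pcompose q [:a, b:])" for q
    by (simp add: pderiv_pcompose pderiv_pCons)
  then have *: "pcompose (pderiv q) [:a, b:] = smult (inverse b) (pderiv (pcompose q [:a, b:]))" for q
    using assms by (metis left_inverse smult_1_left smult_smult)
  show ?case by (simp add: * Suc pderiv_smult)
qed simp

text \<open>Centred at the endpoint \<open>1\<close>, the base \<open>x^2 - x\<close> becomes
  \<open>x * (x + 1)\<close>, so Rodrigues' formula differentiates
  \<open>x ^ n * (1 + x) ^ n\<close>, whose coefficients are explicit. The degree, the value at
  \<open>1\<close> and the sign of the derivative beyond \<open>1\<close> are read off from
  them.\<close>

lemma legendre_shift:
  "pcompose (P n) [:1, 1:] = smult (1 / fact n) ((pderiv ^^ n) (monom 1 n * [:1, 1:] ^ n))"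
proof -
  have "pcompose ([:0, -1, 1:] ^ n) [:1, 1:] = ([:0, 1:] * [:1, 1::real:]) ^ n"
    by (simp add: pcompose_power pcompose_pCons algebra_simps)
  also have "\<dots> = monom 1 n * [:1, 1:] ^ n"
    by (simp only: power_mult_distrib) (simp add: monom_altdef)
  finally show ?thesis
    by (simp add: shifted_legendre_def pcompose_smult pcompose_higher_pderiv)
qed

text \<open>\<open>x ^ n * (1 + x) ^ n\<close> has the coefficient \<open>n choose j\<close> at
  \<open>x ^ (n + j)\<close>, and \<open>n\<close> derivatives multiply it by
  \<open>(j + 1) * ... * (j + n)\<close>, the Pochhammer symbol.\<close>

lemma coeff_legendre_shift:
  "coeff (pcompose (P n) [:1, 1:]) j = pochhammer (real (Suc j)) n / fact n * real (n choose j)"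
proof -
  have "coeff ([:1, 1:] ^ n) j = real (n choose j)"
    by (cases "j \<le> n") (auto simp: coeff_linear_poly_power coeff_eq_0 degree_power_eq)
  then show ?thesis
    by (simp add: legendre_shift coeff_higher_pderiv coeff_monom_mult del: of_nat_Suc)
qed

lemma degree_legendre [simp]: "degree (P n) = n"
proof -
  have "degree (pcompose (P n) [:1, 1:]) = n"
  proof (rule antisym)
    show "degree (pcompose (P n) [:1, 1:]) \<le> n"
      by (intro degree_le) (auto simp: coeff_legendre_shift)
    show "n \<le> degree (pcompose (P n) [:1, 1:])"
      by (intro le_degree) (simp add: coeff_legendre_shift pochhammer_eq_0_iff)
  qed
  then show ?thesis by (simp add: degree_pcompose)
qed

lemma legendre_at_1 [simp]: "poly (P n) 1 = 1"
proof -
  have "poly (P n) 1 = coeff (pcompose (P n) [:1, 1:]) 0"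
    by (subst poly_0_coeff_0[symmetric], subst poly_pcompose) simp
  also have "\<dots> = pochhammer 1 n / fact n" using coeff_legendre_shift[of n 0] by simp
  finally show ?thesis by (simp flip: pochhammer_fact)
qed

text \<open>\<open>x^2 - x\<close> is invariant under \<open>x \<mapsto> 1 - x\<close>, and each of
  the \<open>n\<close> derivatives contributes a sign. This is the source of the alternating signs
  when cells are matched.\<close>

lemma legendre_reflect: "pcompose (P n) [:1, -1:] = smult ((-1) ^ n) (P n)"
proof -
  have "pcompose ([:0, -1, 1:] ^ n) [:1, -1::real:] = [:0, -1, 1:] ^ n"
    by (simp add: pcompose_power pcompose_pCons algebra_simps)
  then show ?thesis
    by (simp add: shifted_legendre_def pcompose_smult pcompose_higher_pderiv)
qed

lemma poly_legendre_reflect: "poly (P n) (1 - x) = (-1) ^ n * poly (P n) x"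
proof -
  have "poly (P n) (1 - x) = poly (pcompose (P n) [:1, -1:]) x"
    by (simp add: poly_pcompose)
  then show ?thesis by (simp add: legendre_reflect)
qed

lemma legendre_at_0 [simp]: "poly (P n) 0 = (-1) ^ n"
  using poly_legendre_reflect[of n 1] by simp

text \<open>Expanded in powers of \<open>x - 1\<close>, Rodrigues' formula has nonnegative coefficients, so \<open>P\<^sub>n'\<close> has no root in
  \<open>[1, \<infinity>)\<close>; the reflection \<open>x \<mapsto> 1 - x\<close> excludes the roots in \<open>(-\<infinity>, 0]\<close>.\<close>

lemma pderiv_legendre_pos:
  assumes "n \<ge> 1" "x \<ge> 1" shows "poly (pderiv (P n)) x > 0"
proof -
  let ?q = "pcompose (P n) [:1, 1:]"
  have "poly (pderiv (P n)) x = poly (pderiv ?q) (x - 1)"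
    by (simp add: pderiv_pcompose pderiv_pCons poly_pcompose)
  also have "\<dots> = (\<Sum>i\<le>degree (pderiv ?q). coeff (pderiv ?q) i * (x - 1) ^ i)"
    by (rule poly_altdef)
  also have "\<dots> \<ge> (\<Sum>i\<in>{0}. coeff (pderiv ?q) i * (x - 1) ^ i)"
    using assms by (intro sum_mono2) (auto simp: coeff_pderiv coeff_legendre_shift intro!: mult_nonneg_nonneg divide_nonneg_nonneg pochhammer_nonneg)
  moreover have "(\<Sum>i\<in>{0}. coeff (pderiv ?q) i * (x - 1) ^ i) > 0"
    using assms by (auto simp: coeff_pderiv coeff_legendre_shift intro!: mult_pos_pos divide_pos_pos pochhammer_pos)
  ultimately show ?thesis by linarith
qed

lemma legendre_deriv_root:
  assumes "n \<ge> 1" "poly (pderiv (P n)) x = 0" shows "0 < x" "x < 1"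
proof -
  show "x < 1" using pderiv_legendre_pos[of n x] assms by force
  have "poly (pderiv (smult ((-1) ^ n) (P n))) (1 - x) = - poly (pderiv (P n)) x"
    unfolding legendre_reflect[symmetric] by (simp add: pderiv_pcompose pderiv_pCons poly_pcompose)
  then have "poly (pderiv (P n)) (1 - x) = 0" using assms by (simp add: pderiv_smult)
  then show "0 < x" using pderiv_legendre_pos[of n "1 - x"] assms by force
qed

section \<open>Norms of the Legendre polynomials and expansion in them\<close>

definition legendre_weight :: "nat \<Rightarrow> real" where
  "legendre_weight j = unit_integral (P j * P j)"

text \<open>A continuous nonnegative function with integral zero vanishes, but \<open>P j\<close>
  takes the value \<open>1\<close> at \<open>1\<close>.\<close>

lemma legendre_weight_pos: "legendre_weight j > 0"
proof -
  have "legendre_weight j \<ge> 0" unfolding legendre_weight_def unit_integral_def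
    by (intro integral_nonneg) auto
  moreover have "legendre_weight j \<noteq> 0"
  proof
    assume "legendre_weight j = 0"
    then have "(poly (P j * P j) has_integral 0) (cbox 0 1)"
      unfolding legendre_weight_def unit_integral_def by (metis integrable_poly integrable_integral box_real(2))
    then have "poly (P j * P j) 1 = 0"
      by (rule has_integral_0_cbox_imp_0[rotated 2]) (auto intro!: continuous_intros)
    then show False by simp
  qed
  ultimately show ?thesis by simp
qed

lemma legendre_inner:
  "unit_integral (P i * P j) = (if i = j then legendre_weight j else 0)"
proof -
  consider "i = j" | "i < j" | "j < i" by linarith
  then show ?thesis
  proof cases
    case 2
    then have "unit_integral (P j * P i) = 0" by (intro legendre_orthogonal) simp
    with 2 show ?thesis by (simp add: mult.commute)
  next
    case 3
    then have "unit_integral (P i * P j) = 0" by (intro legendre_orthogonal) simp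
    with 3 show ?thesis by simp
  qed (simp add: legendre_weight_def)
qed

text \<open>Removing the right multiple of \<open>P n\<close> lowers the degree. The leading
  coefficient is part of the conclusion because the top Legendre coefficient of the integrated error
  has to be known explicitly.\<close>

lemma legendre_expansion:
  assumes "degree p \<le> n"
  shows "\<exists>a. p = (\<Sum>j\<le>n. smult (a j) (P j)) \<and> a n = coeff p n / lead_coeff (P n)"
  using assms
proof (induction n arbitrary: p)
  case 0
  then obtain c where p: "p = [:c:]" by (metis degree_eq_zeroE le_zero_eq)
  have "P 0 = 1" by (simp add: shifted_legendre_def)
  with p show ?case by (intro exI[of _ "\<lambda>_. c"]) simp
next
  case (Suc n)
  define c where "c = coeff p (Suc n) / lead_coeff (P (Suc n))"
  have lc: "lead_coeff (P (Suc n)) \<noteq> 0" by (metis degree_legendre leading_coeff_0_iff nat.distinct(1) degree_0)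
  have "degree (p - smult c (P (Suc n))) \<le> n"
  proof (rule degree_le, intro allI impI)
    fix i assume "n < i"
    then consider "i = Suc n" | "i > Suc n" by linarith
    then show "coeff (p - smult c (P (Suc n))) i = 0"
      using lc Suc.prems by cases (auto simp: c_def coeff_eq_0)
  qed
  from Suc.IH[OF this] obtain a where a: "p - smult c (P (Suc n)) = (\<Sum>j\<le>n. smult (a j) (P j))" by blast
  have "p = (\<Sum>j\<le>Suc n. smult ((a(Suc n := c)) j) (P j))"
    using a by (simp add: algebra_simps)
  then show ?case by (intro exI[of _ "a(Suc n := c)"]) (simp add: c_def)
qed

section \<open>Regularity of the exact solution\<close>

lemma Ck_on_cong:
  assumes "Ck_on n S f" "\<And>x. x \<in> S \<Longrightarrow> f x = g x"
  shows "Ck_on n S g"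
  using assms
proof (cases n)
  case 0
  then show ?thesis using assms by (auto cong: continuous_on_cong)
next
  case (Suc n)
  then obtain f' where f': "\<forall>x\<in>S. (f has_derivative (\<lambda>v. f' x \<bullet> v)) (at x within S)"
      "\<forall>b\<in>Basis. Ck_on n S (\<lambda>x. f' x \<bullet> b)"
    using assms by auto
  then have "\<forall>x\<in>S. (g has_derivative (\<lambda>v. f' x \<bullet> v)) (at x within S)"
    using assms(2) by (metis has_derivative_transform)
  with f' Suc show ?thesis by auto
qed

lemma Ck_on_Suc_imp: "Ck_on (Suc n) S f \<Longrightarrow> Ck_on n S f"
proof (induction n arbitrary: f)
  case 0
  then obtain f' where "\<forall>x\<in>S. (f has_derivative (\<lambda>v. f' x \<bullet> v)) (at x within S)" by auto
  then show ?case by (auto intro: has_derivative_continuous_on)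
next
  case (Suc n)
  then obtain f' where f': "\<forall>x\<in>S. (f has_derivative (\<lambda>v. f' x \<bullet> v)) (at x within S)"
      "\<forall>b\<in>Basis. Ck_on (Suc n) S (\<lambda>x. f' x \<bullet> b)"
    by (subst (asm) Ck_on.simps(2)) blast
  then have "\<forall>b\<in>Basis. Ck_on n S (\<lambda>x. f' x \<bullet> b)" using Suc.IH by blast
  with f' show ?case by (subst Ck_on.simps(2)) blast
qed

lemma Ck_on_mono: "Ck_on n S f \<Longrightarrow> k \<le> n \<Longrightarrow> Ck_on k S f"
proof (induction n)
  case (Suc n)
  show ?case
  proof (cases "k \<le> n")
    case True
    then show ?thesis using Suc.IH Ck_on_Suc_imp[OF Suc.prems(1)] by blast
  next
    case False
    then have "k = Suc n" using Suc.prems(2) by simp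
    with Suc.prems(1) show ?thesis by blast
  qed
qed simp

lemma Ck_on_imp_continuous_on: "Ck_on n S f \<Longrightarrow> continuous_on S f"
  using Ck_on_mono[of n S f 0] by simp

lemma Ck_on_Suc_real:
  fixes S :: "real set"
  shows "Ck_on (Suc n) S f \<longleftrightarrow>
    (\<exists>f'. (\<forall>x\<in>S. (f has_real_derivative f' x) (at x within S)) \<and> Ck_on n S f')"
  by (simp add: has_field_derivative_def)

declare Ck_on.simps(2) [simp del]

lemma Ck_on_const: "Ck_on n (S::real set) (\<lambda>x. c)"
proof (induction n arbitrary: c)
  case (Suc n)
  show ?case unfolding Ck_on_Suc_real using Suc by (intro exI[of _ "\<lambda>x. 0"] conjI ballI) auto
qed simp

lemma Ck_on_add:
  fixes S :: "real set"
  shows "Ck_on n S f \<Longrightarrow> Ck_on n S g \<Longrightarrow> Ck_on n S (\<lambda>x. f x + g x)"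
proof (induction n arbitrary: f g)
  case 0
  then show ?case by (auto intro: continuous_intros)
next
  case (Suc n)
  then obtain f' g' where "\<forall>x\<in>S. (f has_real_derivative f' x) (at x within S)" "Ck_on n S f'"
    "\<forall>x\<in>S. (g has_real_derivative g' x) (at x within S)" "Ck_on n S g'" unfolding Ck_on_Suc_real by blast
  with Suc.IH show ?case unfolding Ck_on_Suc_real
    by (intro exI[of _ "\<lambda>x. f' x + g' x"] conjI ballI DERIV_add) auto
qed

lemma Ck_on_mult:
  fixes S :: "real set"
  shows "Ck_on n S f \<Longrightarrow> Ck_on n S g \<Longrightarrow> Ck_on n S (\<lambda>x. f x * g x)"
proof (induction n arbitrary: f g)
  case 0
  then show ?case by (auto intro: continuous_intros)
next
  case (Suc n)
  then obtain f' g' where "\<forall>x\<in>S. (f has_real_derivative f' x) (at x within S)" "Ck_on n S f'"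
    "\<forall>x\<in>S. (g has_real_derivative g' x) (at x within S)" "Ck_on n S g'" unfolding Ck_on_Suc_real by blast
  with Suc.IH[of f' g] Suc.IH[of g' f] Suc.prems[THEN Ck_on_Suc_imp] show ?case unfolding Ck_on_Suc_real
    by (intro exI[of _ "\<lambda>x. f' x * g x + g' x * f x"] conjI ballI DERIV_mult Ck_on_add) auto
qed

lemma Ck_on_inverse:
  fixes S :: "real set"
  assumes nz: "\<And>x. x \<in> S \<Longrightarrow> f x \<noteq> 0"
  shows "Ck_on n S f \<Longrightarrow> Ck_on n S (\<lambda>x. inverse (f x))"
proof (induction n)
  case 0
  then show ?case using nz by (auto intro: continuous_intros)
next
  case (Suc n)
  then obtain f' where "\<forall>x\<in>S. (f has_real_derivative f' x) (at x within S)" "Ck_on n S f'"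
    unfolding Ck_on_Suc_real by blast
  moreover have "Ck_on n S (\<lambda>x. inverse (f x))" using Suc Ck_on_Suc_imp by blast
  ultimately show ?case using nz unfolding Ck_on_Suc_real
    by (intro exI[of _ "\<lambda>x. - 1 * (f' x * (inverse (f x) * inverse (f x)))"] conjI ballI
          Ck_on_mult Ck_on_const)
       (auto intro!: derivative_eq_intros)
qed

section \<open>Partial derivatives on the triangle and restriction to lines\<close>

lemma Ck_on_Suc_pairD:
  fixes F :: "real \<times> real \<Rightarrow> real"
  assumes "Ck_on (Suc n) D F"
  shows "\<exists>F1 F2. Ck_on n D F1 \<and> Ck_on n D F2 \<and>
    (\<forall>p\<in>D. (F has_derivative (\<lambda>v. F1 p * fst v + F2 p * snd v)) (at p within D))"
proof -
  obtain f' where f': "\<forall>x\<in>D. (F has_derivative (\<lambda>v. f' x \<bullet> v)) (at x within D)"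
      "\<forall>b\<in>Basis. Ck_on n D (\<lambda>x. f' x \<bullet> b)"
    using assms by (auto simp: Ck_on.simps(2))
  have "Ck_on n D (\<lambda>x. fst (f' x))" "Ck_on n D (\<lambda>x. snd (f' x))"
    using f'(2)[rule_format, of "(1,0)"] f'(2)[rule_format, of "(0,1)"]
    by (auto simp: Basis_prod_def inner_prod_def)
  with f'(1) show ?thesis
    by (intro exI[of _ "\<lambda>x. fst (f' x)"] exI[of _ "\<lambda>x. snd (f' x)"]) (auto simp: inner_prod_def)
qed

text \<open>Chain rule along horizontal, vertical and diagonal lines. The parameter set
  \<open>A\<close> is arbitrary, so at the boundary of the triangle one-sided derivatives are
  obtained.\<close>

lemma has_derivative_partials:
  fixes F :: "real \<times> real \<Rightarrow> real"
  assumes F: "\<And>p. p \<in> D \<Longrightarrow> (F has_derivative (\<lambda>v. F1 p * fst v + F2 p * snd v)) (at p within D)"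
  shows has_derivative_partial_fst:
      "(\<And>t. t \<in> A \<Longrightarrow> (t, s) \<in> D) \<Longrightarrow> t \<in> A \<Longrightarrow> ((\<lambda>t. F (t, s)) has_real_derivative F1 (t, s)) (at t within A)"
    and has_derivative_partial_snd:
      "(\<And>s. s \<in> A \<Longrightarrow> (t, s) \<in> D) \<Longrightarrow> s \<in> A \<Longrightarrow> ((\<lambda>s. F (t, s)) has_real_derivative F2 (t, s)) (at s within A)"
    and has_derivative_diagonal:
      "(\<And>t. t \<in> A \<Longrightarrow> (t, t) \<in> D) \<Longrightarrow> t \<in> A \<Longrightarrow>
         ((\<lambda>t. F (t, t)) has_real_derivative F1 (t, t) + F2 (t, t)) (at t within A)"
proof -
  show "((\<lambda>t. F (t, s)) has_real_derivative F1 (t, s)) (at t within A)"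
    if "\<And>t. t \<in> A \<Longrightarrow> (t, s) \<in> D" "t \<in> A"
  proof -
    have "((\<lambda>t. F (t, s)) has_derivative (\<lambda>v. F1 (t, s) * fst (v, 0::real) + F2 (t, s) * snd (v, 0::real))) (at t within A)"
      by (rule has_derivative_in_compose2[where f = "\<lambda>t. (t, s)" and f' = "\<lambda>v. (v, 0)" and x = t
            and t = D and s = A and g = F and g' = "\<lambda>p v. F1 p * fst v + F2 p * snd v"])
         (use that F in \<open>auto intro!: has_derivative_Pair has_derivative_ident has_derivative_const\<close>)
    then show ?thesis by (simp add: has_field_derivative_def)
  qed
  show "((\<lambda>s. F (t, s)) has_real_derivative F2 (t, s)) (at s within A)"
    if "\<And>s. s \<in> A \<Longrightarrow> (t, s) \<in> D" "s \<in> A"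
  proof -
    have "((\<lambda>s. F (t, s)) has_derivative (\<lambda>v. F1 (t, s) * fst (0::real, v) + F2 (t, s) * snd (0::real, v))) (at s within A)"
      by (rule has_derivative_in_compose2[where f = "\<lambda>s. (t, s)" and f' = "\<lambda>v. (0, v)" and x = s
            and t = D and s = A and g = F and g' = "\<lambda>p v. F1 p * fst v + F2 p * snd v"])
         (use that F in \<open>auto intro!: has_derivative_Pair has_derivative_ident has_derivative_const\<close>)
    then show ?thesis by (simp add: has_field_derivative_def)
  qed
  show "((\<lambda>t. F (t, t)) has_real_derivative F1 (t, t) + F2 (t, t)) (at t within A)"
    if "\<And>t. t \<in> A \<Longrightarrow> (t, t) \<in> D" "t \<in> A"
  proof -
    have "((\<lambda>t. F (t, t)) has_derivative (\<lambda>v. F1 (t, t) * fst (v, v) + F2 (t, t) * snd (v, v))) (at t within A)"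
      by (rule has_derivative_in_compose2[where f = "\<lambda>t. (t, t)" and f' = "\<lambda>v. (v, v)" and x = t
            and t = D and s = A and g = F and g' = "\<lambda>p v. F1 p * fst v + F2 p * snd v"])
         (use that F in \<open>auto intro!: has_derivative_Pair has_derivative_ident has_derivative_const\<close>)
    then show ?thesis unfolding has_field_derivative_def by (rule has_derivative_eq_rhs) (auto simp: algebra_simps)
  qed
qed

lemma Ck_on_diagonal:
  fixes F :: "real \<times> real \<Rightarrow> real"
  assumes "\<And>t. t \<in> A \<Longrightarrow> (t, t) \<in> D"
  shows "Ck_on n D F \<Longrightarrow> Ck_on n A (\<lambda>t. F (t, t))"
proof (induction n arbitrary: F)
  case 0
  have "continuous_on A (\<lambda>t. (t, t))" by (intro continuous_intros)
  from continuous_on_compose2[OF _ this, of D F] show ?case using 0 assms by auto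
next
  case (Suc n)
  obtain F1 F2 where F: "Ck_on n D F1" "Ck_on n D F2"
    "\<forall>p\<in>D. (F has_derivative (\<lambda>v. F1 p * fst v + F2 p * snd v)) (at p within D)"
    using Ck_on_Suc_pairD[OF Suc.prems] by blast
  have "\<And>t. t \<in> A \<Longrightarrow> ((\<lambda>t. F (t, t)) has_real_derivative F1 (t, t) + F2 (t, t)) (at t within A)"
    by (rule has_derivative_diagonal[OF F(3)[rule_format]]) (use assms in auto)
  moreover have "Ck_on n A (\<lambda>t. F1 (t, t) + F2 (t, t))"
    by (intro Ck_on_add Suc.IH F(1,2))
  ultimately show ?case unfolding Ck_on_Suc_real
    by (intro exI[of _ "\<lambda>t. F1 (t, t) + F2 (t, t)"] conjI ballI)
qed

section \<open>Continuity and smoothness of Volterra integrals\<close>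

lemma integral_affine:
  fixes f :: "real \<Rightarrow> real"
  assumes "h \<ge> 0" "x \<ge> 0" "continuous_on {a..a + h * x} f"
  shows "integral {a..a + h * x} f = h * integral {0..x} (\<lambda>u. f (a + h * u))"
proof -
  have "((\<lambda>u. h *\<^sub>R f (a + h * u)) has_integral (integral {a + h * 0..a + h * x} f)) {0..x}"
    using assms by (intro has_integral_substitution[where c = a and d = "a + h * x"])
      (auto intro!: derivative_eq_intros mult_left_mono)
  then show ?thesis by (simp add: has_integral_iff)
qed

lemma volterra_domain_iff [simp]: "(t, s) \<in> volterra_domain T \<longleftrightarrow> 0 \<le> s \<and> s \<le> t \<and> t \<le> T"
  by (simp add: volterra_domain_def)

lemma continuous_on_volterra_section:
  assumes "continuous_on (volterra_domain T) F" "t \<in> {0..T}"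
  shows "continuous_on {0..t} (\<lambda>s. F (t, s))"
  by (rule continuous_on_compose2[OF assms(1)]) (use assms(2) in \<open>auto intro!: continuous_intros\<close>)

text \<open>Substituting \<open>s = t * u\<close> moves the integral to the fixed interval
  \<open>[0,1]\<close>; what remains is the continuity of a parameter integral on a
  rectangle.\<close>

lemma continuous_on_volterra:
  fixes F :: "real \<times> real \<Rightarrow> real"
  assumes "continuous_on (volterra_domain T) F" "continuous_on {0..T} y"
  shows "continuous_on {0..T} (\<lambda>t. integral {0..t} (\<lambda>s. F (t, s) * y s))"
proof -
  have le: "t * u \<le> T" if "0 \<le> t" "t \<le> T" "0 \<le> u" "u \<le> 1" for t u
    using mult_left_le[of u t] that by linarith
  have "continuous_on ({0..T} \<times> cbox 0 1) (\<lambda>p. F (fst p, fst p * snd p) * y (fst p * snd p))"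
  proof (intro continuous_intros)
    show "continuous_on ({0..T} \<times> cbox 0 1) (\<lambda>p. F (fst p, fst p * snd p))"
      by (rule continuous_on_compose2[OF assms(1)]) (auto intro!: continuous_intros simp: mult_left_le)
    show "continuous_on ({0..T} \<times> cbox 0 1) (\<lambda>p. y (fst p * snd p))"
      by (rule continuous_on_compose2[OF assms(2)]) (auto intro!: continuous_intros le)
  qed
  then have "continuous_on ({0..T} \<times> cbox 0 1) (\<lambda>(t, u). F (t, t * u) * y (t * u))"
    by (simp add: split_beta)
  then have "continuous_on {0..T} (\<lambda>t. t * integral (cbox 0 1) (\<lambda>u. F (t, t * u) * y (t * u)))"
    by (intro continuous_intros integral_continuous_on_param)
  then show ?thesis
  proof (rule continuous_on_eq)
    fix t assume t: "t \<in> {0..T}"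
    have "continuous_on {0..t} (\<lambda>s. F (t, s) * y s)"
      using t by (intro continuous_intros continuous_on_volterra_section[OF assms(1)] continuous_on_subset[OF assms(2)]) auto
    \<comment> \<open>The point \<open>t = 0\<close> is covered as well, since
      \<open>integral_affine\<close> admits a zero scale.\<close>
    then show "t * integral (cbox 0 1) (\<lambda>u. F (t, t * u) * y (t * u)) = integral {0..t} (\<lambda>s. F (t, s) * y s)"
      using integral_affine[of t 1 0 "\<lambda>s. F (t, s) * y s"] t by simp
  qed
qed

text \<open>Leibniz' rule for the triangle: \<open>F\<close> is first extended to the square, linearly in its first argument
  above the diagonal, so that both limits of integration can be treated as independent variables.\<close>

lemma volterra_has_derivative:
  fixes F F1 :: "real \<times> real \<Rightarrow> real"
  assumes F: "continuous_on (volterra_domain T) F" and F1: "continuous_on (volterra_domain T) F1"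
    and der: "\<And>t s. 0 \<le> s \<Longrightarrow> s \<le> t \<Longrightarrow> t \<le> T \<Longrightarrow>
      ((\<lambda>t. F (t, s)) has_real_derivative F1 (t, s)) (at t within {s..T})"
    and y: "continuous_on {0..T} y" and t: "t \<in> {0..T}"
  shows "((\<lambda>t. integral {0..t} (\<lambda>s. F (t, s) * y s)) has_real_derivative
    F (t, t) * y t + integral {0..t} (\<lambda>s. F1 (t, s) * y s)) (at t within {0..T})"
proof -
  \<comment> \<open>For \<open>t < s\<close> the slope \<open>F1 (s, s)\<close> fits the derivative
    on the other side, so the derivative in \<open>t\<close> is \<open>F1 (max t s, s)\<close>,
    continuous on the whole square.\<close>
  define Fe where "Fe t s = F (max t s, s) + min (t - s) 0 * F1 (s, s)" for t s
  define G where "G t c = integral (cbox 0 c) (\<lambda>s. Fe t s * y s)" for t c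
  have cont_comp: "continuous_on S (\<lambda>p. H (a p, b p))"
    if "continuous_on (volterra_domain T) H" "continuous_on S a" "continuous_on S b"
      "\<And>p. p \<in> S \<Longrightarrow> 0 \<le> b p \<and> b p \<le> a p \<and> a p \<le> T"
    for H :: "real \<times> real \<Rightarrow> real" and S :: "(real \<times> real) set" and a b
    by (rule continuous_on_compose2[OF that(1)]) (use that in \<open>auto intro!: continuous_intros\<close>)
  have Fe_cont: "continuous_on ({0..T} \<times> {0..T}) (\<lambda>p. Fe (fst p) (snd p))"
    unfolding Fe_def by (intro continuous_intros cont_comp F F1) auto
  have F1_cont: "continuous_on ({0..T} \<times> {0..T}) (\<lambda>p. F1 (max (fst p) (snd p), snd p))"
    by (intro continuous_intros cont_comp F1) auto
  have Fe_sect: "continuous_on {0..T} (\<lambda>s. Fe t s * y s)" if "t \<in> {0..T}" for t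
    using that by (intro continuous_intros y)
      (auto intro!: continuous_on_compose2[OF Fe_cont, of _ "\<lambda>s. (t, s)", simplified] continuous_intros)
  have Fe_der: "((\<lambda>t. Fe t s) has_real_derivative F1 (max t s, s)) (at t within {0..T})"
    if s: "s \<in> {0..T}" and t: "t \<in> {0..T}" for s t
  proof -
    have *: "((\<lambda>x. if x \<in> {s..T} then F (x, s) else F (s, s) + (x - s) * F1 (s, s)) has_vector_derivative
        (if t \<in> {s..T} then F1 (t, s) else F1 (s, s))) (at t within {0..T})"
    proof (rule has_vector_derivative_If_within_closures[where T = "{0..s}"])
      have "{s..T} \<inter> {0..s} = {s}" using s by auto
      then have eq: "closure {s..T} \<inter> closure {0..s} = {s}" by simp
      show "t \<in> {s..T} \<union> {0..s}" "{0..T} = {s..T} \<union> {0..s}" using s t by auto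
      show "((\<lambda>x. F (x, s)) has_vector_derivative F1 (t, s)) (at t within {s..T} \<union> closure {s..T} \<inter> closure {0..s})"
        if "t \<in> {s..T} \<union> closure {s..T} \<inter> closure {0..s}"
        using der[of s t] s that unfolding eq
        by (auto simp: has_real_derivative_iff_has_vector_derivative insert_absorb)
      show "((\<lambda>x. F (s, s) + (x - s) * F1 (s, s)) has_vector_derivative F1 (s, s))
          (at t within {0..s} \<union> closure {s..T} \<inter> closure {0..s})"
        unfolding has_real_derivative_iff_has_vector_derivative[symmetric]
        by (auto intro!: derivative_eq_intros)
    qed auto
    have "(\<lambda>x. if x \<in> {s..T} then F (x, s) else F (s, s) + (x - s) * F1 (s, s)) x = Fe x s" if "x \<in> {0..T}" for x
      using that s by (auto simp: Fe_def max_def min_def)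
    moreover have "(if t \<in> {s..T} then F1 (t, s) else F1 (s, s)) = F1 (max t s, s)"
      using s t by (auto simp: max_def)
    ultimately show ?thesis
      unfolding has_real_derivative_iff_has_vector_derivative
      using has_vector_derivative_transform[OF t _ *, of "\<lambda>x. Fe x s"] by simp
  qed
  have D1: "((\<lambda>x. G x t) has_derivative (*) (integral (cbox 0 t) (\<lambda>s. F1 (max t s, s) * y s))) (at t within {0..T})"
    unfolding G_def has_field_derivative_def[symmetric]
  proof (rule leibniz_rule_field_derivative)
    show "((\<lambda>x. Fe x s * y s) has_field_derivative F1 (max x s, s) * y s) (at x within {0..T})"
      if "x \<in> {0..T}" "s \<in> cbox 0 t" for x s
      using that t by (intro DERIV_cmult_right Fe_der) auto
    show "(\<lambda>s. Fe x s * y s) integrable_on cbox 0 t" if "x \<in> {0..T}" for x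
      using t by (intro integrable_continuous continuous_on_subset[OF Fe_sect[OF that]]) auto
    have "continuous_on ({0..T} \<times> cbox 0 t) (\<lambda>p. F1 (max (fst p) (snd p), snd p) * y (snd p))"
      using t by (intro continuous_intros continuous_on_subset[OF F1_cont] continuous_on_compose2[OF y]) auto
    then show "continuous_on ({0..T} \<times> cbox 0 t) (\<lambda>(x, s). F1 (max x s, s) * y s)"
      by (simp add: split_beta)
  qed (use t in auto)
  have D2: "((\<lambda>(x, c). G x c) has_derivative (\<lambda>(tx, ty). integral (cbox 0 t) (\<lambda>s. F1 (max t s, s) * y s) * tx
      + blinfun_apply ((Fe t t * y t) *\<^sub>R id_blinfun) ty)) (at (t, t) within {0..T} \<times> {0..T})"
  proof (rule has_derivative_partialsI[where f = G and X = "{0..T}" and Y = "{0..T}" and x = t and y = t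
        and fy = "\<lambda>x c. (Fe x c * y c) *\<^sub>R id_blinfun"])
    show "((\<lambda>x. G x t) has_derivative (*) (integral (cbox 0 t) (\<lambda>s. F1 (max t s, s) * y s))) (at t within {0..T})"
      by (rule D1)
    show "(G x has_derivative blinfun_apply ((Fe x c * y c) *\<^sub>R id_blinfun)) (at c within {0..T})"
      if "x \<in> {0..T}" "c \<in> {0..T}" for x c
      using integral_has_real_derivative[OF Fe_sect[OF that(1)] that(2)]
      by (simp add: G_def[abs_def] has_field_derivative_def scaleR_blinfun.rep_eq)
    have "continuous_on ({0..T} \<times> {0..T}) (\<lambda>p. (Fe (fst p) (snd p) * y (snd p)) *\<^sub>R (id_blinfun :: real \<Rightarrow>\<^sub>L real))"
      by (intro continuous_intros Fe_cont continuous_on_compose2[OF y]) auto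
    then show "continuous (at (t, t) within {0..T} \<times> {0..T}) (\<lambda>(x, y'). (Fe x y' * y y') *\<^sub>R (id_blinfun :: real \<Rightarrow>\<^sub>L real))"
      using t by (simp add: case_prod_unfold continuous_on_eq_continuous_within)
  qed (use t in auto)
  \<comment> \<open>The total derivative is restricted to the diagonal of the square; composing with
    \<open>x \<mapsto> (x, x)\<close> then adds the two partial derivatives.\<close>
  have D2': "((\<lambda>(x, c). G x c) has_derivative (\<lambda>(tx, ty). integral (cbox 0 t) (\<lambda>s. F1 (max t s, s) * y s) * tx
      + blinfun_apply ((Fe t t * y t) *\<^sub>R id_blinfun) ty)) (at (t, t) within (\<lambda>x. (x, x)) ` {0..T})"
    by (rule has_derivative_subset[OF D2]) auto
  have "((\<lambda>x. (x, x)) has_derivative (\<lambda>v. (v, v))) (at t within {0..T})"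
    by (intro has_derivative_Pair has_derivative_ident)
  from has_derivative_in_compose[OF this D2']
  have "((\<lambda>x. G x x) has_derivative (\<lambda>v. integral (cbox 0 t) (\<lambda>s. F1 (max t s, s) * y s) * v
      + blinfun_apply ((Fe t t * y t) *\<^sub>R id_blinfun) v)) (at t within {0..T})"
    by simp
  then have D3: "((\<lambda>x. G x x) has_real_derivative F (t, t) * y t + integral {0..t} (\<lambda>s. F1 (max t s, s) * y s)) (at t within {0..T})"
    by (rule has_derivative_imp_has_field_derivative) (simp add: Fe_def scaleR_blinfun.rep_eq algebra_simps)
  have "integral {0..t} (\<lambda>s. F1 (max t s, s) * y s) = integral {0..t} (\<lambda>s. F1 (t, s) * y s)"
    by (intro integral_cong) auto
  moreover have "G x x = integral {0..x} (\<lambda>s. F (x, s) * y s)" for x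
    unfolding G_def by (auto simp: Fe_def intro!: integral_cong)
  ultimately show ?thesis using D3 by simp
qed

text \<open>By Leibniz' rule the derivative is \<open>F (t, t) * y t\<close> plus the same operator
  with kernel \<open>F1\<close>, hence the induction over all \<open>F\<close>. Integration gains
  one order, so \<open>y\<close> may be one order less smooth; for \<open>n = 0\<close> the
  truncated \<open>n - 1\<close> asks for continuity only.\<close>

lemma Ck_on_volterra:
  fixes F :: "real \<times> real \<Rightarrow> real"
  shows "Ck_on n (volterra_domain T) F \<Longrightarrow> Ck_on (n - 1) {0..T} y \<Longrightarrow>
    Ck_on n {0..T} (\<lambda>t. integral {0..t} (\<lambda>s. F (t, s) * y s))"
proof (induction n arbitrary: F)
  case 0
  then show ?case by (simp add: continuous_on_volterra)
next
  case (Suc n)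
  obtain F1 F2 where F: "Ck_on n (volterra_domain T) F1" "Ck_on n (volterra_domain T) F2"
    "\<forall>p\<in>volterra_domain T. (F has_derivative (\<lambda>v. F1 p * fst v + F2 p * snd v)) (at p within volterra_domain T)"
    using Ck_on_Suc_pairD[OF Suc.prems(1)] by blast
  have y: "Ck_on n {0..T} y" using Suc.prems by simp
  have F0: "Ck_on n (volterra_domain T) F" using Suc.prems(1) by (rule Ck_on_Suc_imp)
  have "((\<lambda>t. integral {0..t} (\<lambda>s. F (t, s) * y s)) has_real_derivative
    F (t, t) * y t + integral {0..t} (\<lambda>s. F1 (t, s) * y s)) (at t within {0..T})" if "t \<in> {0..T}" for t
  proof (rule volterra_has_derivative)
    show "((\<lambda>t. F (t, s)) has_real_derivative F1 (t, s)) (at t within {s..T})"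
      if "0 \<le> s" "s \<le> t" "t \<le> T" for t s
      using that by (intro has_derivative_partial_fst[OF F(3)[rule_format]]) auto
  qed (use that Ck_on_imp_continuous_on F F0 y in auto)
  moreover have "Ck_on n {0..T} (\<lambda>t. F (t, t) * y t + integral {0..t} (\<lambda>s. F1 (t, s) * y s))"
    using Ck_on_mono[OF y, of "n - 1"]
    by (intro Ck_on_add Ck_on_mult y Suc.IH F Ck_on_diagonal[OF _ F0]) auto
  ultimately show ?case unfolding Ck_on_Suc_real
    by (intro exI[of _ "\<lambda>t. F (t, t) * y t + integral {0..t} (\<lambda>s. F1 (t, s) * y s)"] conjI ballI)
qed

text \<open>Differentiating the equation gives a Volterra equation of the second kind, from which
  \<open>y\<close> gains one derivative at a time.\<close>

lemma exact_solution_Ck_on: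
  assumes T: "T > 0" and k0: "k0 > 0" "\<forall>t\<in>{0..T}. \<bar>k t t\<bar> \<ge> k0"
    and y: "exact_solution T k g y"
    and g: "Ck_on (Suc n) {0..T} g" and k: "Ck_on (Suc n) (volterra_domain T) (\<lambda>(t, s). k t s)"
  shows "Ck_on n {0..T} y"
proof -
  define F where "F = (\<lambda>(t, s). k t s)"
  obtain F1 F2 where F: "Ck_on n (volterra_domain T) F1" "Ck_on n (volterra_domain T) F2"
    "\<forall>p\<in>volterra_domain T. (F has_derivative (\<lambda>v. F1 p * fst v + F2 p * snd v)) (at p within volterra_domain T)"
    using Ck_on_Suc_pairD[OF k] unfolding F_def by blast
  have F0: "Ck_on n (volterra_domain T) F" using k unfolding F_def by (rule Ck_on_Suc_imp)
  have yc: "continuous_on {0..T} y" using y by (simp add: exact_solution_def)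
  obtain g' where g': "\<And>t. t \<in> {0..T} \<Longrightarrow> (g has_real_derivative g' t) (at t within {0..T})" "Ck_on n {0..T} g'"
    using g unfolding Ck_on_Suc_real by blast
  define W where "W t = integral {0..t} (\<lambda>s. F1 (t, s) * y s)" for t
  have nz: "F (t, t) \<noteq> 0" if "t \<in> {0..T}" for t using k0 that by (force simp: F_def)
  \<comment> \<open>The diagonal of the kernel is bounded away from zero, so the differentiated
    equation can be solved for \<open>y\<close>.\<close>
  have eq: "inverse (F (t, t)) * (g' t + (- 1) * W t) = y t" if t: "t \<in> {0..T}" for t
  proof -
    have "((\<lambda>t. integral {0..t} (\<lambda>s. F (t, s) * y s)) has_real_derivative F (t, t) * y t + W t) (at t within {0..T})"
      unfolding W_def
    proof (rule volterra_has_derivative)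
      show "((\<lambda>t. F (t, s)) has_real_derivative F1 (t, s)) (at t within {s..T})"
        if "0 \<le> s" "s \<le> t" "t \<le> T" for t s
        using that by (intro has_derivative_partial_fst[OF F(3)[rule_format]]) auto
    qed (use t Ck_on_imp_continuous_on F F0 yc in auto)
    then have "(g has_vector_derivative F (t, t) * y t + W t) (at t within {0..T})"
      unfolding has_real_derivative_iff_has_vector_derivative
      by (rule has_vector_derivative_transform[OF t, rotated])
         (use y in \<open>auto simp: exact_solution_def volterra_def F_def\<close>)
    moreover have "(g has_vector_derivative g' t) (at t within {0..T})"
      using g'(1)[OF t] unfolding has_real_derivative_iff_has_vector_derivative .
    ultimately have "F (t, t) * y t + W t = g' t"
      using T t vector_derivative_within_closed_interval by metis
    then have "g' t + (- 1) * W t = F (t, t) * y t" by simp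
    then show ?thesis using nz[OF t] by simp
  qed
  have "j \<le> n \<Longrightarrow> Ck_on j {0..T} y" for j
  proof (induction j)
    case 0
    then show ?case using yc by simp
  next
    case (Suc j)
    have "Ck_on (Suc j) {0..T} (\<lambda>t. inverse (F (t, t)) * (g' t + (- 1) * W t))"
      unfolding W_def using Suc
      by (intro Ck_on_mult Ck_on_inverse Ck_on_add Ck_on_const Ck_on_volterra Ck_on_diagonal[where D = "volterra_domain T"] nz
          Ck_on_mono[OF F(1)] Ck_on_mono[OF F0] Ck_on_mono[OF g'(2)]) auto
    then show ?case using eq by (rule Ck_on_cong)
  qed
  then show ?thesis by simp
qed

section \<open>Discrete Gronwall inequalities\<close>

text \<open>Since \<open>1 + c \<le> exp c\<close>, each step costs a factor \<open>exp c\<close>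
  and one copy of \<open>e\<close>. The recursion is required only for indices below
  \<open>N\<close>, the range in which cells exist.\<close>

lemma discrete_gronwall:
  fixes S :: "nat \<Rightarrow> real"
  assumes "c \<ge> 0" "e \<ge> 0" "S 0 \<ge> 0"
    and step: "\<And>n. Suc n < N \<Longrightarrow> S (Suc n) \<le> (1 + c) * S n + e"
    and "n < N"
  shows "S n \<le> exp (c * real n) * (S 0 + real n * e)"
  using \<open>n < N\<close>
proof (induction n)
  case (Suc n)
  have "S (Suc n) \<le> (1 + c) * S n + e" using step Suc.prems by simp
  also have "\<dots> \<le> (1 + c) * (exp (c * real n) * (S 0 + real n * e)) + e"
    using Suc assms by (intro add_right_mono mult_left_mono) auto
  also have "\<dots> \<le> exp c * (exp (c * real n) * (S 0 + real n * e)) + exp (c * real (Suc n)) * e"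
  proof (rule add_mono)
    show "(1 + c) * (exp (c * real n) * (S 0 + real n * e)) \<le> exp c * (exp (c * real n) * (S 0 + real n * e))"
      using assms by (intro mult_right_mono) auto
    show "e \<le> exp (c * real (Suc n)) * e" using assms mult_right_mono[of 1 "exp (c * real (Suc n))" e] by simp
  qed
  also have "\<dots> = exp (c * real (Suc n)) * (S 0 + real (Suc n) * e)"
    by (simp add: exp_add algebra_simps)
  finally show ?case .
qed simp

text \<open>The unknown \<open>B'\<close> on the right is absorbed:
  \<open>(1 + x) / (1 - x) \<le> 1 + 4 * x\<close> for \<open>x \<le> 1/2\<close>. With
  \<open>x\<close> a multiple of \<open>h\<close>, this is a place where \<open>h\<close> has to be
  small.\<close>

lemma implicit_step:
  fixes x B B' e :: real
  assumes "0 \<le> x" "x \<le> 1/2" "0 \<le> B" "0 \<le> e" "B' \<le> (1 + x) * B + x * B' + e"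
  shows "B' \<le> (1 + 4 * x) * B + 2 * e"
proof -
  have "(1 - x) * B' \<le> (1 + x) * B + e" using assms(5) by (simp add: algebra_simps)
  also have "\<dots> \<le> (1 - x) * ((1 + 4 * x) * B + 2 * e)"
  proof -
    have "(1 - x) * (1 + 4 * x) - (1 + x) = 2 * x * (1 - 2 * x)" by algebra
    moreover have "2 * x * (1 - 2 * x) \<ge> 0" using assms by simp
    ultimately have "(1 + x) * B \<le> (1 - x) * (1 + 4 * x) * B"
      using assms by (intro mult_right_mono) linarith+
    moreover have "e \<le> (1 - x) * (2 * e)"
      using mult_right_mono[of "1/2" "1 - x" "2 * e"] assms by simp
    ultimately show ?thesis by (simp add: algebra_simps)
  qed
  finally show ?thesis using assms by (simp add: mult_le_cancel_left)
qed

lemma scaled_index_le: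
  fixes h T :: real
  assumes "real N * h \<le> T" "n \<le> N" "0 \<le> h" shows "h * real n \<le> T"
proof -
  have "h * real n \<le> h * real N" using assms by (intro mult_left_mono) auto
  then show ?thesis using assms by (simp add: mult.commute)
qed

text \<open>For \<open>S n = x n + x (n + 1)\<close> the two-step recursion becomes a one-step one
  of implicit kind. About \<open>T / h\<close> defects accumulate, so \<open>x\<close> may reach the
  size \<open>e / h\<close>; the conclusion is therefore stated for \<open>h * x\<close>.\<close>

lemma two_step_gronwall:
  fixes C T :: real
  assumes "C \<ge> 0" "T \<ge> 0"
  shows "\<exists>C' h0. h0 > 0 \<and> (\<forall>N h e. \<forall>x :: nat \<Rightarrow> real.
     0 < h \<longrightarrow> h \<le> h0 \<longrightarrow> real N * h \<le> T \<longrightarrow> 0 \<le> e \<longrightarrow> (\<forall>n. 0 \<le> x n) \<longrightarrow>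
     (\<forall>n. Suc (Suc n) < N \<longrightarrow>
        x (Suc (Suc n)) \<le> x n + C * (e + h * (x n + x (Suc n) + x (Suc (Suc n))))) \<longrightarrow>
     (\<forall>n. Suc n < N \<longrightarrow> h * (x n + x (Suc n)) \<le> C' * (e + h * (x 0 + x 1))))"
proof (intro exI conjI allI impI)
  \<comment> \<open>Chosen so that \<open>C * h \<le> 1/2\<close>, as \<open>implicit_step\<close>
    demands.\<close>
  define h0 where "h0 = 1 / (2 * (C + 1))"
  define C' where "C' = exp (4 * C * T) * (1 + 2 * C * T)"
  show "h0 > 0" using assms by (simp add: h0_def)
  fix N :: nat and h e :: real and x :: "nat \<Rightarrow> real" and n
  assume h: "0 < h" "h \<le> h0" "real N * h \<le> T" and e: "0 \<le> e" and x: "\<forall>n. 0 \<le> x n"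
    and rec: "\<forall>n. Suc (Suc n) < N \<longrightarrow>
        x (Suc (Suc n)) \<le> x n + C * (e + h * (x n + x (Suc n) + x (Suc (Suc n))))"
    and n: "Suc n < N"
  define S where "S n = x n + x (Suc n)" for n
  have Ch: "C * h \<le> 1/2"
  proof -
    have "C * h \<le> (C + 1) * h0" using assms h by (intro mult_mono) auto
    also have "(C + 1) * h0 = 1/2" using assms by (simp add: h0_def)
    finally show ?thesis .
  qed
  have S0: "S n \<ge> 0" for n using x by (simp add: S_def)
  have step: "S (Suc n) \<le> (1 + 4 * (C * h)) * S n + 2 * (C * e)" if "Suc n < N - 1" for n
  proof (rule implicit_step)
    have "S (Suc n) \<le> S n + C * (e + h * (x n + x (Suc n) + x (Suc (Suc n))))"
      using rec that by (simp add: S_def)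
    also have "\<dots> \<le> S n + C * (e + h * (S n + S (Suc n)))"
      using assms h x by (intro add_left_mono mult_left_mono) (auto simp: S_def)
    finally show "S (Suc n) \<le> (1 + C * h) * S n + C * h * S (Suc n) + C * e"
      by (simp add: algebra_simps)
  qed (use assms h e Ch S0 in auto)
  have "S n \<le> exp (4 * (C * h) * real n) * (S 0 + real n * (2 * (C * e)))"
    using assms h e S0 step n by (intro discrete_gronwall[where N = "N - 1"]) auto
  also have "\<dots> \<le> exp (4 * C * T) * (S 0 + real n * (2 * (C * e)))"
  proof (intro mult_right_mono)
    have "h * real n \<le> T" using h n by (intro scaled_index_le[of N]) auto
    then have "4 * C * (h * real n) \<le> 4 * C * T" using assms by (intro mult_left_mono) auto
    then show "exp (4 * (C * h) * real n) \<le> exp (4 * C * T)" by (simp add: mult_ac)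
  qed (use S0 assms e in auto)
  finally have "h * S n \<le> h * (exp (4 * C * T) * (S 0 + real n * (2 * (C * e))))"
    using h by (intro mult_left_mono) auto
  also have "\<dots> = exp (4 * C * T) * (h * S 0 + (h * real n) * (2 * (C * e)))" by (simp add: algebra_simps)
  also have "\<dots> \<le> exp (4 * C * T) * (h * S 0 + T * (2 * (C * e)))"
  proof -
    have "h * real n \<le> T" using h n by (intro scaled_index_le[of N]) auto
    then show ?thesis using assms e by (intro mult_left_mono add_left_mono mult_right_mono) auto
  qed
  also have "\<dots> \<le> exp (4 * C * T) * ((1 + 2 * C * T) * (e + h * S 0))"
  proof (rule mult_left_mono)
    have "0 \<le> C * T * (h * S 0)" "0 \<le> e" using assms h S0 e by auto
    then show "h * S 0 + T * (2 * (C * e)) \<le> (1 + 2 * C * T) * (e + h * S 0)"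
      by (simp add: algebra_simps)
  qed simp
  finally show "h * (x n + x (Suc n)) \<le> C' * (e + h * (x 0 + x 1))"
    by (simp add: C'_def S_def)
qed

text \<open>\<open>y\<close> stands for the tested coefficients, \<open>x\<close> for the
  transported one. In the memory sum \<open>x\<close> carries an extra \<open>h\<close>, so that
  even with \<open>x\<close> of size \<open>e / h\<close> the sum over about \<open>T / h\<close>
  cells remains of order \<open>e\<close>. The quantity \<open>B n\<close> of the proof collects
  everything that bounds \<open>y n\<close>, and grows by a factor \<open>1 + O(h)\<close> per
  cell.\<close>

lemma coupled_gronwall:
  fixes C T :: real
  assumes "C \<ge> 0" "T \<ge> 0"
  shows "\<exists>C' h0. h0 > 0 \<and> (\<forall>N h e. \<forall>x y :: nat \<Rightarrow> real.
     0 < h \<longrightarrow> h \<le> h0 \<longrightarrow> real N * h \<le> T \<longrightarrow> 0 \<le> e \<longrightarrow> (\<forall>n. 0 \<le> x n) \<longrightarrow> (\<forall>n. 0 \<le> y n) \<longrightarrow>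
     (\<forall>n<N. y n \<le> C * (e + h * (y n + x n) + h * (\<Sum>l<n. y l + h * x l))) \<longrightarrow>
     (\<forall>n. Suc n < N \<longrightarrow> x (Suc n) \<le> x n + C * (e + y n + y (Suc n))) \<longrightarrow>
     h * x 0 \<le> C * (e + h * y 0) \<longrightarrow>
     (\<forall>n<N. h * x n \<le> C' * e \<and> y n \<le> C' * e))"
proof (intro exI allI conjI[of "_ > 0"] impI)
  \<comment> \<open>One step adds \<open>h * y n\<close>, \<open>h * (h * x n)\<close> and
    \<open>h * (x (Suc n) - x n)\<close> to \<open>B n\<close>; their bounds contribute
    \<open>2 * C\<close>, \<open>1\<close> and \<open>C + 2 * C^2\<close> to the factor of
    \<open>h * B n\<close>.\<close>
  define c where "c = 1 + 3 * C + 2 * C\<^sup>2"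
  define h0 where "h0 = 1 / (4 * (c + 1))"
  define C' where "C' = (1 + 2 * C) * (exp (4 * c * T) * (2 * (1 + C)))"
  have c: "c \<ge> 1" using assms by (simp add: c_def)
  show "h0 > 0" using c by (simp add: h0_def)
  fix N :: nat and h e :: real and x y :: "nat \<Rightarrow> real" and n
  assume h: "0 < h" "h \<le> h0" "real N * h \<le> T" and e: "0 \<le> e" and x: "\<forall>n. 0 \<le> x n" and y: "\<forall>n. 0 \<le> y n"
    and recy: "\<forall>n<N. y n \<le> C * (e + h * (y n + x n) + h * (\<Sum>l<n. y l + h * x l))"
    and recx: "\<forall>n. Suc n < N \<longrightarrow> x (Suc n) \<le> x n + C * (e + y n + y (Suc n))"
    and x0: "h * x 0 \<le> C * (e + h * y 0)" and n: "n < N"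
  define B where "B n = e + h * (\<Sum>l<n. y l + h * x l) + h * x n" for n
  have ch: "c * h \<le> 1/4"
  proof -
    have "c * h \<le> (c + 1) * h0" using c h by (intro mult_mono) auto
    also have "(c + 1) * h0 = 1/4" using c by (simp add: h0_def)
    finally show ?thesis .
  qed
  have sm: "2 * C\<^sup>2 * h \<le> 1/4" "C * h \<le> 1/4"
  proof -
    have "2 * C\<^sup>2 * h \<le> c * h" "C * h \<le> c * h" using assms h by (auto simp: c_def intro!: mult_right_mono)
    with ch show "2 * C\<^sup>2 * h \<le> 1/4" "C * h \<le> 1/4" by linarith+
  qed
  have sum0: "0 \<le> h * (\<Sum>l<n. y l + h * x l)" for n
    using h x y by (intro mult_nonneg_nonneg sum_nonneg add_nonneg_nonneg) auto
  have B: "e \<le> B n" "h * x n \<le> B n" "0 \<le> B n" for n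
    using sum0[of n] e h x by (auto simp: B_def)
  have yB: "y n \<le> 2 * C * B n" if "n < N" for n
  proof -
    have "y n \<le> C * (B n + h * y n)"
      using recy that by (simp add: B_def algebra_simps)
    also have "\<dots> = C * B n + (C * h) * y n" by (simp add: algebra_simps)
    also have "\<dots> \<le> C * B n + 1/4 * y n" using sm y by (intro add_left_mono mult_right_mono) auto
    finally show ?thesis using mult_nonneg_nonneg[OF assms(1) B(3)[of n]] y[rule_format, of n]
      unfolding mult.assoc by linarith
  qed
  have step: "B (Suc n) \<le> (1 + 4 * (c * h)) * B n + 2 * 0" if n: "Suc n < N" for n
  proof (rule implicit_step)
    have "B (Suc n) = B n + h * y n + h * (h * x n) + h * (x (Suc n) - x n)"
      by (simp add: B_def algebra_simps)
    also have "\<dots> \<le> B n + h * (2 * C * B n) + h * B n + h * (C * (B n + 2 * C * B n + 2 * C * B (Suc n)))"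
    proof (intro add_mono mult_left_mono)
      have "x (Suc n) - x n \<le> C * (e + y n + y (Suc n))" using recx n by (simp add: algebra_simps)
      also have "\<dots> \<le> C * (B n + 2 * C * B n + 2 * C * B (Suc n))"
        using assms B yB n by (intro mult_left_mono add_mono) auto
      finally show "x (Suc n) - x n \<le> C * (B n + 2 * C * B n + 2 * C * B (Suc n))" .
    qed (use h B yB n in auto)
    also have "\<dots> = (1 + c * h) * B n + (2 * C\<^sup>2 * h) * B (Suc n)"
      by (simp add: c_def algebra_simps power2_eq_square)
    also have "\<dots> \<le> (1 + c * h) * B n + (c * h) * B (Suc n) + 0"
    proof -
      have "2 * C\<^sup>2 * h \<le> c * h" using assms h by (intro mult_right_mono) (auto simp: c_def)
      then show ?thesis using mult_right_mono[OF _ B(3)[of "Suc n"]] by simp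
    qed
    finally show "B (Suc n) \<le> (1 + c * h) * B n + (c * h) * B (Suc n) + 0" .
  qed (use c h ch B in auto)
  \<comment> \<open>Apparently circular: \<open>x 0\<close> is bounded through \<open>y 0\<close>,
    and \<open>y 0\<close> through \<open>B 0\<close>. The returning term has the factor
    \<open>2 * C^2 * h \<le> 1/4\<close> and is absorbed.\<close>
  have B0: "B 0 \<le> 2 * (1 + C) * e"
  proof -
    have "y 0 \<le> 2 * C * B 0" using yB n by auto
    then have "h * y 0 \<le> h * (2 * C * B 0)" using h by (intro mult_left_mono) auto
    then have "C * (h * y 0) \<le> C * (h * (2 * C * B 0))" by (rule mult_left_mono) (use assms in auto)
    moreover have "B 0 = e + h * x 0" by (simp add: B_def)
    ultimately have "B 0 \<le> (1 + C) * e + (2 * C\<^sup>2 * h) * B 0"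
      using x0 by (simp add: algebra_simps power2_eq_square)
    also have "\<dots> \<le> (1 + C) * e + 1/4 * B 0" using sm B by (intro add_left_mono mult_right_mono) auto
    finally show ?thesis using e assms mult_nonneg_nonneg[of "1 + C" e] unfolding mult.assoc by linarith
  qed
  have "B n \<le> exp (4 * (c * h) * real n) * (B 0 + real n * (2 * 0))"
    using c h B step n by (intro discrete_gronwall[where N = N]) auto
  also have "\<dots> \<le> exp (4 * c * T) * (2 * (1 + C) * e)"
  proof (intro mult_mono)
    have "h * real n \<le> T" using h n by (intro scaled_index_le[of N]) auto
    then have "4 * c * (h * real n) \<le> 4 * c * T" using c by (intro mult_left_mono) auto
    then show "exp (4 * (c * h) * real n) \<le> exp (4 * c * T)" by (simp add: mult_ac)
  qed (use B0 B in auto)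
  finally have Bn: "B n \<le> exp (4 * c * T) * (2 * (1 + C)) * e" by simp
  have "(1 + 2 * C) * B n \<le> C' * e"
    using mult_left_mono[OF Bn, of "1 + 2 * C"] assms by (simp add: C'_def mult_ac)
  moreover have "(1 + 2 * C) * B n = B n + 2 * C * B n" by (simp add: algebra_simps)
  moreover have "0 \<le> 2 * C * B n" using assms B(3)[of n] by simp
  moreover note B[of n] yB[OF n]
  ultimately show "h * x n \<le> C' * e \<and> y n \<le> C' * e" by linarith
qed

section \<open>Propagation of the error from cell to cell\<close>

text \<open>With the weight frozen at \<open>w 0\<close>, orthogonality leaves the single
  coefficient \<open>c j\<close>. The error is the variation of the weight times all coefficients
  plus the size of the weight times the remainder. One factor \<open>K\<close> bounds the test
  polynomial, the other the \<open>P i\<close> of the expansion.\<close>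

lemma legendre_test:
  fixes c :: "nat \<Rightarrow> real"
  assumes K: "1 \<le> K" "\<And>j x. j \<le> M \<Longrightarrow> x \<in> {0..1} \<Longrightarrow> \<bar>poly (P j) x\<bar> \<le> K"
    and D: "continuous_on {0..1} D" "\<And>x. x \<in> {0..1} \<Longrightarrow> D x = (\<Sum>i\<le>M. c i * poly (P i) x) + r x"
    and r: "\<And>x. x \<in> {0..1} \<Longrightarrow> \<bar>r x\<bar> \<le> R"
    and w: "continuous_on {0..1} w" "\<And>x. x \<in> {0..1} \<Longrightarrow> \<bar>w x\<bar> \<le> B0"
      "\<And>x. x \<in> {0..1} \<Longrightarrow> \<bar>w x - w 0\<bar> \<le> B1"
    and j: "j \<le> M"
  shows "\<bar>integral {0..1} (\<lambda>x. poly (P j) x * (w x * D x)) - w 0 * legendre_weight j * c j\<bar>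
    \<le> K\<^sup>2 * (B1 * (\<Sum>i\<le>M. \<bar>c i\<bar>) + B0 * R)"
proof -
  define p where "p = (\<Sum>i\<le>M. smult (c i) (P i))"
  have p: "poly p x = (\<Sum>i\<le>M. c i * poly (P i) x)" for x by (simp add: p_def poly_sum)
  have pos: "0 \<le> R" "0 \<le> B0" "0 \<le> B1" using r[of 0] w(2,3)[of 0] by auto
  have p_le: "\<bar>poly p x\<bar> \<le> K * (\<Sum>i\<le>M. \<bar>c i\<bar>)" if "x \<in> {0..1}" for x
  proof -
    have "\<bar>poly p x\<bar> \<le> (\<Sum>i\<le>M. \<bar>c i * poly (P i) x\<bar>)" unfolding p by (rule sum_abs)
    also have "\<dots> \<le> (\<Sum>i\<le>M. \<bar>c i\<bar> * K)"
      using K(2) that by (intro sum_mono) (auto simp: abs_mult intro!: mult_left_mono)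
    finally show ?thesis by (simp add: sum_distrib_right mult.commute[of K])
  qed
  have "unit_integral (P j * p) = (\<Sum>i\<le>M. c i * unit_integral (P j * P i))"
    by (simp add: p_def sum_distrib_left unit_integral_sum unit_integral_smult)
  also have "\<dots> = (\<Sum>i\<le>M. if j = i then legendre_weight j * c j else 0)"
    by (intro sum.cong) (auto simp: legendre_inner)
  also have "\<dots> = legendre_weight j * c j" using j by simp
  finally have *: "unit_integral (P j * p) = legendre_weight j * c j" .
  have pj: "integral {0..1} (\<lambda>x. poly (P j) x * poly p x) = legendre_weight j * c j"
  proof -
    have "poly (P j * p) = (\<lambda>x. poly (P j) x * poly p x)" by auto
    then show ?thesis using * by (simp add: unit_integral_def)
  qed
  have "integral {0..1} (\<lambda>x. poly (P j) x * (w x * D x)) - w 0 * legendre_weight j * c j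
    = integral {0..1} (\<lambda>x. poly (P j) x * (w x * D x)) - integral {0..1} (\<lambda>x. w 0 * (poly (P j) x * poly p x))"
    by (simp add: pj)
  also have "\<dots> = integral {0..1} (\<lambda>x. poly (P j) x * (w x * D x) - w 0 * (poly (P j) x * poly p x))"
    by (intro Henstock_Kurzweil_Integration.integral_diff[symmetric] integrable_continuous_real continuous_intros D w)
  finally have eq: "integral {0..1} (\<lambda>x. poly (P j) x * (w x * D x)) - w 0 * legendre_weight j * c j
    = integral {0..1} (\<lambda>x. poly (P j) x * (w x * D x) - w 0 * (poly (P j) x * poly p x))" .
  have "norm (integral {0..1} (\<lambda>x. poly (P j) x * (w x * D x) - w 0 * (poly (P j) x * poly p x)))
    \<le> K\<^sup>2 * (B1 * (\<Sum>i\<le>M. \<bar>c i\<bar>) + B0 * R) * (1 - 0)"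
  proof (intro integral_bound continuous_intros D w)
    fix x :: real assume x: "x \<in> {0..1}"
    have "poly (P j) x * (w x * D x) - w 0 * (poly (P j) x * poly p x)
      = poly (P j) x * ((w x - w 0) * poly p x + w x * r x)"
      using D(2)[OF x] by (simp add: p algebra_simps)
    also have "\<bar>\<dots>\<bar> \<le> K * (B1 * (K * (\<Sum>i\<le>M. \<bar>c i\<bar>)) + B0 * R)"
      unfolding abs_mult
    proof (intro mult_mono K(2) j x)
      have "\<bar>(w x - w 0) * poly p x + w x * r x\<bar> \<le> \<bar>w x - w 0\<bar> * \<bar>poly p x\<bar> + \<bar>w x\<bar> * \<bar>r x\<bar>"
        by (metis abs_mult abs_triangle_ineq)
      also have "\<dots> \<le> B1 * (K * (\<Sum>i\<le>M. \<bar>c i\<bar>)) + B0 * R"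
        using pos x by (intro add_mono mult_mono w r p_le) auto
      finally show "\<bar>(w x - w 0) * poly p x + w x * r x\<bar> \<le> B1 * (K * (\<Sum>i\<le>M. \<bar>c i\<bar>)) + B0 * R" .
    qed (use K in auto)
    also have "\<dots> \<le> K * (K * (B1 * (\<Sum>i\<le>M. \<bar>c i\<bar>) + B0 * R))"
    proof (rule mult_left_mono)
      have "B0 * R \<le> K * (B0 * R)" using K pos mult_right_mono[of 1 K "B0 * R"] by simp
      then show "B1 * (K * (\<Sum>i\<le>M. \<bar>c i\<bar>)) + B0 * R \<le> K * (B1 * (\<Sum>i\<le>M. \<bar>c i\<bar>) + B0 * R)"
        by (simp add: algebra_simps)
    qed (use K in auto)
    finally show "norm (poly (P j) x * (w x * D x) - w 0 * (poly (P j) x * poly p x))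
        \<le> K\<^sup>2 * (B1 * (\<Sum>i\<le>M. \<bar>c i\<bar>) + B0 * R)"
      by (simp add: power2_eq_square mult.assoc)
  qed simp_all
  then show ?thesis unfolding eq by simp
qed

lemma legendre_0: "P 0 = 1" by (simp add: shifted_legendre_def)

lemma legendre_weight_0: "legendre_weight 0 = 1"
proof -
  have "poly 1 = (\<lambda>x::real. 1)" by auto
  then show ?thesis by (simp add: legendre_weight_def unit_integral_def legendre_0)
qed

text \<open>Constants are multiples of \<open>P 0\<close>, so this is \<open>legendre_test\<close>
  for \<open>j = 0\<close>. Only \<open>c 0\<close> meets the full size \<open>B0\<close> of the
  weight; the other coefficients meet just its variation \<open>B1\<close>.\<close>

lemma legendre_mean:
  fixes c :: "nat \<Rightarrow> real"
  assumes K: "1 \<le> K" "\<And>j x. j \<le> M \<Longrightarrow> x \<in> {0..1} \<Longrightarrow> \<bar>poly (P j) x\<bar> \<le> K"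
    and D: "continuous_on {0..1} D" "\<And>x. x \<in> {0..1} \<Longrightarrow> D x = (\<Sum>i\<le>M. c i * poly (P i) x) + r x"
    and r: "\<And>x. x \<in> {0..1} \<Longrightarrow> \<bar>r x\<bar> \<le> R"
    and w: "continuous_on {0..1} w" "\<And>x. x \<in> {0..1} \<Longrightarrow> \<bar>w x\<bar> \<le> B0"
      "\<And>x. x \<in> {0..1} \<Longrightarrow> \<bar>w x - w 0\<bar> \<le> B1"
  shows "\<bar>integral {0..1} (\<lambda>x. w x * D x)\<bar>
    \<le> B0 * \<bar>c 0\<bar> + K\<^sup>2 * (B1 * (\<Sum>i\<le>M. \<bar>c i\<bar>) + B0 * R)"
proof -
  have "\<bar>integral {0..1} (\<lambda>x. w x * D x) - w 0 * c 0\<bar> \<le> K\<^sup>2 * (B1 * (\<Sum>i\<le>M. \<bar>c i\<bar>) + B0 * R)"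
    using legendre_test[OF assms, of 0] by (simp add: legendre_0 legendre_weight_0)
  moreover have "\<bar>w 0 * c 0\<bar> \<le> B0 * \<bar>c 0\<bar>" using w(2)[of 0] by (auto simp: abs_mult intro: mult_right_mono)
  ultimately show ?thesis by linarith
qed

lemma integral_mesh:
  fixes f :: "real \<Rightarrow> real"
  assumes h: "0 \<le> h" and x: "0 \<le> x" and f: "continuous_on {0..real n * h + h * x} f"
  shows "integral {0..real n * h + h * x} f =
    (\<Sum>l<n. h * integral {0..1} (\<lambda>u. f (real l * h + h * u))) + h * integral {0..x} (\<lambda>u. f (real n * h + h * u))"
proof -
  have nn: "0 \<le> real n * h" "0 \<le> h * x" using h x by auto
  have *: "l \<le> n \<Longrightarrow> integral {0..real l * h} f = (\<Sum>i<l. h * integral {0..1} (\<lambda>u. f (real i * h + h * u)))" for l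
  proof (induction l)
    case (Suc l)
    have le: "real (Suc l) * h \<le> real n * h" using Suc.prems h by (intro mult_right_mono) auto
    have eq: "real (Suc l) * h = real l * h + h * 1" by (simp add: algebra_simps)
    have "integral {0..real (Suc l) * h} f = integral {0..real l * h} f + integral {real l * h..real (Suc l) * h} f"
      using h le nn
      by (intro Henstock_Kurzweil_Integration.integral_combine[symmetric] integrable_continuous_real continuous_on_subset[OF f])
         (auto intro: mult_right_mono)
    also have "integral {real l * h..real (Suc l) * h} f = h * integral {0..1} (\<lambda>u. f (real l * h + h * u))"
      unfolding eq using le h nn unfolding eq
      by (intro integral_affine continuous_on_subset[OF f]) auto
    finally show ?case using Suc by simp
  qed simp
  have "integral {0..real n * h + h * x} f = integral {0..real n * h} f + integral {real n * h..real n * h + h * x} f"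
    using nn by (intro Henstock_Kurzweil_Integration.integral_combine[symmetric] integrable_continuous_real continuous_on_subset[OF f]) auto
  also have "integral {real n * h..real n * h + h * x} f = h * integral {0..x} (\<lambda>u. f (real n * h + h * u))"
    using h x nn by (intro integral_affine continuous_on_subset[OF f]) auto
  finally show ?thesis using *[of n] by simp
qed

text \<open>A single bound \<open>K\<close> stands for all constants that depend on \<open>m\<close> and on the data.\<close>

locale dg_kernel =
  fixes m :: nat and T K :: real and q :: "real \<Rightarrow> real \<Rightarrow> real" and \<kappa> :: "real \<Rightarrow> real"
  assumes m: "1 \<le> m"
    and K: "1 \<le> K" "real m \<le> K" "T \<le> K"
    and P_le: "\<And>j x. j \<le> m + 1 \<Longrightarrow> x \<in> {0..1} \<Longrightarrow> \<bar>poly (P j) x\<bar> \<le> K"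
    and weight_ge: "\<And>j. j < m \<Longrightarrow> 1 \<le> K * legendre_weight j"
    and weight_le: "\<And>j. j < m \<Longrightarrow> legendre_weight j \<le> K"
    and q_cont: "continuous_on (volterra_domain T) (\<lambda>(t, s). q t s)"
    and q_le: "\<And>t s. 0 \<le> s \<Longrightarrow> s \<le> t \<Longrightarrow> t \<le> T \<Longrightarrow> \<bar>q t s\<bar> \<le> K"
    and q_lip_snd: "\<And>t s s'. 0 \<le> s \<Longrightarrow> s \<le> s' \<Longrightarrow> s' \<le> t \<Longrightarrow> t \<le> T \<Longrightarrow> \<bar>q t s' - q t s\<bar> \<le> K * (s' - s)"
    and q_lip_fst: "\<And>t t' s. 0 \<le> s \<Longrightarrow> s \<le> t \<Longrightarrow> t \<le> t' \<Longrightarrow> t' \<le> T \<Longrightarrow> \<bar>q t' s - q t s\<bar> \<le> K * (t' - t)"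
    and q_mixed: "\<And>t t' s s'. 0 \<le> s \<Longrightarrow> s \<le> s' \<Longrightarrow> s' \<le> t \<Longrightarrow> t \<le> t' \<Longrightarrow> t' \<le> T \<Longrightarrow>
       \<bar>(q t' s' - q t s') - (q t' s - q t s)\<bar> \<le> K * (t' - t) * (s' - s)"
    and \<kappa>_cont: "continuous_on {0..T} \<kappa>"
    and \<kappa>_ge: "\<And>t. t \<in> {0..T} \<Longrightarrow> 1 \<le> K * \<bar>\<kappa> t\<bar>"
    and \<kappa>_le: "\<And>t. t \<in> {0..T} \<Longrightarrow> \<bar>\<kappa> t\<bar> \<le> K"
    and \<kappa>_lip: "\<And>t t'. 0 \<le> t \<Longrightarrow> t \<le> t' \<Longrightarrow> t' \<le> T \<Longrightarrow> \<bar>\<kappa> t' - \<kappa> t\<bar> \<le> K * (t' - t)"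
    and \<kappa>_diff2: "\<And>t t' r. 0 \<le> t \<Longrightarrow> t \<le> t' \<Longrightarrow> 0 \<le> r \<Longrightarrow> t' + r \<le> T \<Longrightarrow>
       \<bar>(\<kappa> (t' + r) - \<kappa> (t + r)) - (\<kappa> t' - \<kappa> t)\<bar> \<le> K * (t' - t) * r"

text \<open>On the cell starting at \<open>n * h\<close> the integrated error \<open>E\<close> is \<open>\<Sum>j. a n j * P j\<close>, up to the Taylor
  remainder \<open>\<rho> n\<close>. The top coefficient \<open>a n (m + 1)\<close> is fixed by \<open>y\<close>, the ones with \<open>j < m\<close> are tested by the
  Galerkin equations, and \<open>a n m\<close> is transported from cell to cell by the continuity of \<open>E\<close>.\<close>

locale dg_error = dg_kernel m T K q \<kappa> for m T K q \<kappa> +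
  fixes N :: nat and h :: real and E :: "real \<Rightarrow> real"
    and a :: "nat \<Rightarrow> nat \<Rightarrow> real" and \<rho> :: "nat \<Rightarrow> real \<Rightarrow> real" and \<Delta> :: real
  assumes h: "0 < h" "h \<le> 1" and Nh: "real N * h = T" and \<Delta>: "0 \<le> \<Delta>"
    and E_cont: "continuous_on {0..T} E" and E_0: "E 0 = 0"
    and E_rep: "\<And>n x. n < N \<Longrightarrow> x \<in> {0..1} \<Longrightarrow>
       E (real n * h + h * x) = (\<Sum>j\<le>m + 1. a n j * poly (P j) x) + \<rho> n x"
    and \<rho>_0: "\<And>n. n < N \<Longrightarrow> \<rho> n 0 = 0"
    and \<rho>_le: "\<And>n x. n < N \<Longrightarrow> x \<in> {0..1} \<Longrightarrow> \<bar>\<rho> n x\<bar> \<le> K * h ^ (m + 2)"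
    and \<rho>_diff: "\<And>n x. Suc n < N \<Longrightarrow> x \<in> {0..1} \<Longrightarrow> \<bar>\<rho> (Suc n) x - \<rho> n x\<bar> \<le> K * h ^ (m + 3)"
    and b_le: "\<And>n. n < N \<Longrightarrow> \<bar>a n (m + 1)\<bar> \<le> K * h ^ (m + 1)"
    and b_diff: "\<And>n. Suc n < N \<Longrightarrow> \<bar>a (Suc n) (m + 1) - a n (m + 1)\<bar> \<le> K * h ^ (m + 2)"
    and b_diff2: "\<And>n. Suc (Suc n) < N \<Longrightarrow>
       \<bar>a (Suc (Suc n)) (m + 1) - 2 * a (Suc n) (m + 1) + a n (m + 1)\<bar> \<le> K * h ^ (m + 3)"
    and galerkin: "\<And>n j. n < N \<Longrightarrow> j < m \<Longrightarrow>
       \<bar>integral {0..1} (\<lambda>x. poly (P j) x *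
          (\<kappa> (real n * h + h * x) * E (real n * h + h * x)
            - integral {0..real n * h + h * x} (\<lambda>s. q (real n * h + h * x) s * E s)))\<bar> \<le> K * \<Delta>"
begin

section \<open>First pass: coefficients of one cell in terms of the previous ones\<close>

definition "H t = integral {0..t} (\<lambda>s. q t s * E s)"
definition "lam n = (\<Sum>j<m. \<bar>a n j\<bar>)"
abbreviation (input) "d n \<equiv> \<bar>a n m\<bar>"
abbreviation (input) "b n \<equiv> \<bar>a n (m + 1)\<bar>"
abbreviation "tn n x \<equiv> real n * h + h * x"

lemma lam_nonneg: "0 \<le> lam n" by (simp add: lam_def sum_nonneg)

lemma sum_abs_a: "(\<Sum>j\<le>m + 1. \<bar>a n j\<bar>) = lam n + d n + b n"
  by (simp add: lam_def flip: lessThan_Suc_atMost)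

lemma tn_in: "n < N \<Longrightarrow> x \<in> {0..1} \<Longrightarrow> tn n x \<in> {0..T}"
proof -
  assume n: "n < N" and x: "x \<in> {0..1}"
  have "tn n x \<le> real n * h + h" using h x by (auto simp: mult_left_le)
  also have "\<dots> = real (Suc n) * h" by (simp add: algebra_simps)
  also have "\<dots> \<le> real N * h" using n h by (intro mult_right_mono) auto
  finally show ?thesis using h x Nh by auto
qed

lemma tn_mono: "l < n \<Longrightarrow> u \<in> {0..1} \<Longrightarrow> 0 \<le> x \<Longrightarrow> tn l u \<le> tn n x"
proof -
  assume l: "l < n" and u: "u \<in> {0..1}" and x: "0 \<le> x"
  have "tn l u \<le> real (Suc l) * h" using h u by (auto simp: algebra_simps mult_left_le)
  also have "\<dots> \<le> real n * h" using l h by (intro mult_right_mono) auto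
  finally show ?thesis using h x by (smt (verit) mult_nonneg_nonneg)
qed

lemma tn_Suc: "tn (Suc n) x = tn n x + h" by (simp add: algebra_simps)

lemma cont_tn:
  assumes "continuous_on {0..T} f" "n < N" shows "continuous_on {0..1} (\<lambda>x. f (tn n x))"
  by (rule continuous_on_compose2[OF assms(1)]) (use tn_in[OF assms(2)] in \<open>auto intro!: continuous_intros\<close>)

lemma cont_q: "continuous_on A f \<Longrightarrow> continuous_on A g \<Longrightarrow> (\<And>x. x \<in> A \<Longrightarrow> 0 \<le> g x \<and> g x \<le> f x \<and> f x \<le> T) \<Longrightarrow>
    continuous_on A (\<lambda>x. q (f x) (g x))"
proof -
  assume fg: "continuous_on A f" "continuous_on A g" and le: "\<And>x. x \<in> A \<Longrightarrow> 0 \<le> g x \<and> g x \<le> f x \<and> f x \<le> T"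
  have "continuous_on A (\<lambda>x. (\<lambda>(t, s). q t s) (f x, g x))"
    by (rule continuous_on_compose2[OF q_cont continuous_on_Pair[OF fg]]) (use le in auto)
  then show ?thesis by simp
qed

lemma cont_H: "continuous_on {0..T} H"
  using continuous_on_volterra[OF q_cont E_cont] by (simp add: H_def[abs_def])

lemma H_split:
  assumes n: "n < N" and x: "x \<in> {0..1}"
  shows "H (tn n x) = (\<Sum>l<n. h * integral {0..1} (\<lambda>u. q (tn n x) (tn l u) * E (tn l u)))
    + h * integral {0..x} (\<lambda>u. q (tn n x) (tn n u) * E (tn n u))"
proof -
  have "continuous_on {0..tn n x} (\<lambda>s. q (tn n x) s * E s)"
    using tn_in[OF n x] by (intro continuous_intros cont_q continuous_on_subset[OF E_cont]) auto
  then show ?thesis unfolding H_def using h x by (intro integral_mesh) auto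
qed

lemma E_le:
  assumes n: "n < N" and x: "x \<in> {0..1}"
  shows "\<bar>E (tn n x)\<bar> \<le> K * (lam n + d n + b n) + K * h ^ (m + 2)"
proof -
  have "\<bar>\<Sum>j\<le>m + 1. a n j * poly (P j) x\<bar> \<le> (\<Sum>j\<le>m + 1. \<bar>a n j\<bar> * K)"
    using P_le x by (intro order_trans[OF sum_abs] sum_mono) (auto simp: abs_mult intro!: mult_left_mono)
  also have "\<dots> = K * (lam n + d n + b n)"
    unfolding sum_abs_a[symmetric] sum_distrib_left by (simp only: mult.commute)
  finally show ?thesis using E_rep[OF n x] \<rho>_le[OF n x] by linarith
qed

text \<open>One full cell of the memory integral. For a kernel weight \<open>B1\<close> is of order
  \<open>h\<close>, so \<open>d l\<close> and \<open>b l\<close> enter with one more power of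
  \<open>h\<close> than \<open>lam l\<close>.\<close>

lemma kernel_mean_le:
  assumes l: "l < N" and w: "continuous_on {0..1} w" "\<And>x. x \<in> {0..1} \<Longrightarrow> \<bar>w x\<bar> \<le> B0"
      "\<And>x. x \<in> {0..1} \<Longrightarrow> \<bar>w x - w 0\<bar> \<le> B1"
  shows "\<bar>integral {0..1} (\<lambda>u. w u * E (tn l u))\<bar>
    \<le> B0 * lam l + K\<^sup>2 * (B1 * (lam l + d l + b l) + B0 * (K * h ^ (m + 2)))"
proof -
  have "\<bar>integral {0..1} (\<lambda>u. w u * E (tn l u))\<bar>
    \<le> B0 * \<bar>a l 0\<bar> + K\<^sup>2 * (B1 * (\<Sum>j\<le>m + 1. \<bar>a l j\<bar>) + B0 * (K * h ^ (m + 2)))"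
    by (rule legendre_mean[where r = "\<rho> l"]) (use K P_le E_rep \<rho>_le cont_tn[OF E_cont] l w in auto)
  moreover have "B0 * \<bar>a l 0\<bar> \<le> B0 * lam l"
  proof (rule mult_left_mono)
    show "\<bar>a l 0\<bar> \<le> lam l" unfolding lam_def using m by (intro member_le_sum) auto
    show "0 \<le> B0" using w(2)[of 0] by simp
  qed
  ultimately show ?thesis unfolding sum_abs_a by linarith
qed


lemma K_power_le: "i \<le> j \<Longrightarrow> 0 \<le> x \<Longrightarrow> K ^ i * x \<le> K ^ j * x"
  using K(1) by (intro mult_right_mono power_increasing)

lemma h_b_le: "n < N \<Longrightarrow> h * b n \<le> K * h ^ (m + 2)"
  using mult_left_mono[OF b_le, of n h] h by (simp add: mult_ac)

text \<open>\<open>X\<close> is the bracket in the recursion of \<open>coupled_gronwall\<close> for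
  \<open>y = lam\<close> and \<open>x = d\<close>. Past cells use orthogonality through
  \<open>kernel_mean_le\<close>; their remainders add up to a bounded multiple of one remainder
  because \<open>n * h \<le> T\<close>.\<close>

lemma H_le:
  assumes n: "n < N" and x: "x \<in> {0..1}" and e: "h ^ (m + 2) \<le> e"
    and X: "X = e + h * (lam n + d n) + h * (\<Sum>l<n. lam l + h * d l)"
  shows "\<bar>H (tn n x)\<bar> \<le> 4 * K ^ 5 * X"
proof -
  define R where "R = h ^ (m + 2)"
  define S where "S = h * (\<Sum>l<n. lam l + h * d l)"
  have R: "0 \<le> R" "R \<le> e" using h e by (auto simp: R_def)
  have S: "0 \<le> S" using h by (auto simp: S_def lam_nonneg intro!: mult_nonneg_nonneg sum_nonneg add_nonneg_nonneg)
  have nh: "real n * h \<le> K"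
    using n h K Nh mult_right_mono[of "real n" "real N" h] by simp
  have cell: "\<bar>h * integral {0..1} (\<lambda>u. q (tn n x) (tn l u) * E (tn l u))\<bar>
      \<le> 2 * K ^ 3 * (h * (lam l + h * d l)) + h * (2 * K ^ 4 * R)" if l: "l < n" for l
  proof -
    have lN: "l < N" using l n by simp
    have tn: "tn l u \<le> tn n x" "0 \<le> tn l u" "tn n x \<le> T" "tn l 0 \<le> tn l u" if "u \<in> {0..1}" for u
      using tn_mono[OF l that, of x] tn_in[OF n x] x h that by auto
    have "\<bar>integral {0..1} (\<lambda>u. q (tn n x) (tn l u) * E (tn l u))\<bar>
      \<le> K * lam l + K\<^sup>2 * ((K * h) * (lam l + d l + b l) + K * (K * h ^ (m + 2)))"
    proof (rule kernel_mean_le[OF lN])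
      show "continuous_on {0..1} (\<lambda>u. q (tn n x) (tn l u))"
        using tn by (intro cont_q continuous_intros) auto
      show "\<bar>q (tn n x) (tn l u)\<bar> \<le> K" if "u \<in> {0..1}" for u
        using tn[OF that] by (intro q_le) auto
      show "\<bar>q (tn n x) (tn l u) - q (tn n x) (tn l 0)\<bar> \<le> K * h" if "u \<in> {0..1}" for u
      proof -
        have "\<bar>q (tn n x) (tn l u) - q (tn n x) (tn l 0)\<bar> \<le> K * (tn l u - tn l 0)"
          using tn[OF that] tn[of 0] by (intro q_lip_snd) auto
        also have "\<dots> \<le> K * h" using that h K by (intro mult_left_mono) (auto simp: mult_left_le)
        finally show ?thesis .
      qed
    qed
    also have "\<dots> = K * lam l + K ^ 3 * (h * lam l) + K ^ 3 * (h * d l) + K ^ 3 * (h * b l) + K ^ 4 * R"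
      by (simp add: R_def algebra_simps power2_eq_square power3_eq_cube power4_eq_xxxx)
    also have "\<dots> \<le> K ^ 3 * lam l + K ^ 3 * lam l + K ^ 3 * (h * d l) + K ^ 3 * (K * R) + K ^ 4 * R"
    proof (intro add_mono mult_left_mono)
      show "K * lam l \<le> K ^ 3 * lam l" using K_power_le[of 1 3 "lam l"] lam_nonneg by simp
      show "h * lam l \<le> lam l" using h lam_nonneg by (simp add: mult_left_le_one_le)
      show "h * b l \<le> K * R" unfolding R_def by (rule h_b_le[OF lN])
    qed (use K h in auto)
    also have "\<dots> \<le> 2 * K ^ 3 * (lam l + h * d l) + 2 * K ^ 4 * R"
      using K h by (simp add: algebra_simps power3_eq_cube power4_eq_xxxx)
    finally have "h * \<bar>integral {0..1} (\<lambda>u. q (tn n x) (tn l u) * E (tn l u))\<bar>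
      \<le> h * (2 * K ^ 3 * (lam l + h * d l) + 2 * K ^ 4 * R)" using h by (intro mult_left_mono) auto
    then show ?thesis using h by (simp add: abs_mult algebra_simps)
  qed
  have "\<bar>\<Sum>l<n. h * integral {0..1} (\<lambda>u. q (tn n x) (tn l u) * E (tn l u))\<bar>
      \<le> (\<Sum>l<n. 2 * K ^ 3 * (h * (lam l + h * d l)) + h * (2 * K ^ 4 * R))"
    using cell by (intro order_trans[OF sum_abs] sum_mono) auto
  also have "\<dots> = 2 * K ^ 3 * S + (real n * h) * (2 * K ^ 4 * R)"
    by (simp add: S_def sum.distrib flip: sum_distrib_left)
  also have "\<dots> \<le> 2 * K ^ 3 * S + K * (2 * K ^ 4 * R)"
    using nh K R by (intro add_left_mono mult_right_mono) auto
  also have "\<dots> = 2 * (K ^ 3 * S) + 2 * (K ^ 5 * R)" by (simp add: power_numeral_reduce)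
  also have "\<dots> \<le> 2 * (K ^ 5 * S) + 2 * (K ^ 5 * R)"
    using K_power_le[of 3 5 S] S by simp
  finally have 1: "\<bar>\<Sum>l<n. h * integral {0..1} (\<lambda>u. q (tn n x) (tn l u) * E (tn l u))\<bar>
      \<le> 2 * (K ^ 5 * S) + 2 * (K ^ 5 * R)" .
  \<comment> \<open>On the current cell the integral stops at \<open>x\<close>, so orthogonality is
    lost; the factor \<open>h\<close> in front of \<open>d n\<close> is just the length of the
    cell.\<close>
  have 2: "\<bar>h * integral {0..x} (\<lambda>u. q (tn n x) (tn n u) * E (tn n u))\<bar> \<le> K\<^sup>2 * (h * (lam n + d n)) + 2 * (K ^ 3 * R)"
  proof -
    have u: "u \<in> {0..1}" "0 \<le> tn n u" "tn n u \<le> tn n x" "tn n x \<le> T" if "u \<in> {0..x}" for u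
      using that x h tn_in[OF n x] by auto
    have "norm (integral {0..x} (\<lambda>u. q (tn n x) (tn n u) * E (tn n u)))
       \<le> (K * (K * (lam n + d n + b n) + K * R)) * (x - 0)"
    proof (rule integral_bound)
      show "continuous_on {0..x} (\<lambda>u. q (tn n x) (tn n u) * E (tn n u))"
        using u x by (intro continuous_intros cont_q continuous_on_subset[OF cont_tn[OF E_cont n]]) auto
      show "norm (q (tn n x) (tn n v) * E (tn n v)) \<le> K * (K * (lam n + d n + b n) + K * R)"
        if "v \<in> {0..x}" for v
        unfolding real_norm_def abs_mult R_def
        by (intro mult_mono E_le q_le) (use u[OF that] n K in auto)
    qed (use x in auto)
    also have "\<dots> \<le> (K * (K * (lam n + d n + b n) + K * R)) * 1"
      using x K R lam_nonneg by (intro mult_left_mono) (auto intro!: mult_nonneg_nonneg add_nonneg_nonneg)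
    finally have "h * norm (integral {0..x} (\<lambda>u. q (tn n x) (tn n u) * E (tn n u)))
       \<le> h * ((K * (K * (lam n + d n + b n) + K * R)) * 1)" using h by (intro mult_left_mono) auto
    also have "\<dots> = K\<^sup>2 * (h * (lam n + d n)) + K\<^sup>2 * (h * b n) + K\<^sup>2 * (h * R)"
      by (simp add: algebra_simps power2_eq_square)
    also have "\<dots> \<le> K\<^sup>2 * (h * (lam n + d n)) + K\<^sup>2 * (K * R) + K\<^sup>2 * (K * R)"
      using h_b_le[OF n] h K R mult_mono[of h K R R] by (intro add_mono mult_left_mono) (auto simp: R_def)
    finally show ?thesis using h by (simp add: abs_mult power2_eq_square power3_eq_cube)
  qed
  have "K\<^sup>2 * (h * (lam n + d n)) \<le> K ^ 5 * (h * (lam n + d n))"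
    "K ^ 3 * R \<le> K ^ 5 * R" "K ^ 5 * R \<le> K ^ 5 * e"
    using h lam_nonneg[of n] R K by (auto intro!: K_power_le mult_left_mono)
  moreover have "0 \<le> K ^ 5 * S" "0 \<le> K ^ 5 * (h * (lam n + d n))" "0 \<le> K ^ 5 * R"
    using K S R h lam_nonneg[of n] by auto
  moreover have "4 * K ^ 5 * X = 4 * (K ^ 5 * e) + 4 * (K ^ 5 * (h * (lam n + d n))) + 4 * (K ^ 5 * S)"
    unfolding X S_def by (simp add: algebra_simps)
  ultimately show ?thesis unfolding H_split[OF n x] using 1 2 by linarith
qed

text \<open>Both \<open>\<kappa> t\<close> and the Legendre weight are at least \<open>1 / K\<close>
  in absolute value, so dividing them out costs \<open>K^2\<close>.\<close>

lemma abs_a_le_of_test: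
  assumes "j < m" "t \<in> {0..T}" "\<bar>\<kappa> t * legendre_weight j * c\<bar> \<le> B"
  shows "\<bar>c\<bar> \<le> K\<^sup>2 * B"
proof -
  have w: "0 < legendre_weight j" by (rule legendre_weight_pos)
  have "1 * 1 \<le> (K * \<bar>\<kappa> t\<bar>) * (K * legendre_weight j)"
    using \<kappa>_ge[OF assms(2)] weight_ge[OF assms(1)] by (intro mult_mono) auto
  then have "1 * \<bar>c\<bar> \<le> ((K * \<bar>\<kappa> t\<bar>) * (K * legendre_weight j)) * \<bar>c\<bar>"
    by (intro mult_right_mono) auto
  also have "\<dots> = K\<^sup>2 * \<bar>\<kappa> t * legendre_weight j * c\<bar>"
    using w by (simp add: abs_mult power2_eq_square)
  also have "\<dots> \<le> K\<^sup>2 * B" using assms by (intro mult_left_mono) auto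
  finally show ?thesis by simp
qed

lemma galerkin_H: "n < N \<Longrightarrow> j < m \<Longrightarrow>
    \<bar>integral {0..1} (\<lambda>x. poly (P j) x * (\<kappa> (tn n x) * E (tn n x)))
      - integral {0..1} (\<lambda>x. poly (P j) x * H (tn n x))\<bar> \<le> K * \<Delta>"
  using galerkin[of n j]
  by (subst Henstock_Kurzweil_Integration.integral_diff[symmetric])
     (auto simp: H_def right_diff_distrib intro!: integrable_continuous_real continuous_intros cont_tn \<kappa>_cont E_cont cont_H[unfolded H_def])

lemma abs_integral_P_le:
  assumes "j < m" "continuous_on {0..1} f" "\<And>x. x \<in> {0..1} \<Longrightarrow> \<bar>f x\<bar> \<le> B"
  shows "\<bar>integral {0..1} (\<lambda>x. poly (P j) x * f x)\<bar> \<le> K * B"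
proof -
  have "norm (integral {0..1} (\<lambda>x. poly (P j) x * f x)) \<le> (K * B) * (1 - 0)"
    by (rule integral_bound)
       (use assms P_le K in \<open>auto intro!: continuous_intros mult_mono simp: abs_mult\<close>)
  then show ?thesis by simp
qed

lemma kappa_variation: "n < N \<Longrightarrow> x \<in> {0..1} \<Longrightarrow> \<bar>\<kappa> (tn n x) - \<kappa> (tn n 0)\<bar> \<le> K * h"
proof -
  assume n: "n < N" and x: "x \<in> {0..1}"
  have "\<bar>\<kappa> (tn n x) - \<kappa> (tn n 0)\<bar> \<le> K * (tn n x - tn n 0)"
    using h tn_in[OF n x] x by (intro \<kappa>_lip) auto
  also have "\<dots> \<le> K * h" using x h K by (intro mult_left_mono) (auto simp: mult_left_le)
  finally show ?thesis .
qed

text \<open>Testing with \<open>P j\<close> isolates \<open>a n j\<close> up to the error of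
  \<open>legendre_test\<close> (3), the memory (4) and the perturbation (1), whence the 8. From
  \<open>K ^ 6\<close> the exponent rises by two through \<open>abs_a_le_of_test\<close> and by one
  through the sum over \<open>j < m\<close>.\<close>

lemma lam_le:
  assumes n: "n < N" and e: "h ^ (m + 2) \<le> e" "\<Delta> \<le> e"
  shows "lam n \<le> 8 * K ^ 9 * (e + h * (lam n + d n) + h * (\<Sum>l<n. lam l + h * d l))"
proof -
  define X where "X = e + h * (lam n + d n) + h * (\<Sum>l<n. lam l + h * d l)"
  define R where "R = h ^ (m + 2)"
  have R: "0 \<le> R" "R \<le> e" using h e by (auto simp: R_def)
  have X: "e \<le> X" "h * (lam n + d n) \<le> X" "0 \<le> X"
  proof -
    have "0 \<le> h * (\<Sum>l<n. lam l + h * d l)"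
      using h by (auto simp: lam_nonneg intro!: mult_nonneg_nonneg sum_nonneg add_nonneg_nonneg)
    moreover have "0 \<le> h * (lam n + d n)" using h lam_nonneg[of n] by auto
    ultimately show "e \<le> X" "h * (lam n + d n) \<le> X" "0 \<le> X" using R unfolding X_def by linarith+
  qed
  have "\<bar>a n j\<bar> \<le> K\<^sup>2 * (8 * K ^ 6 * X)" if j: "j < m" for j
  proof (rule abs_a_le_of_test[OF j])
    show "tn n 0 \<in> {0..T}" using tn_in[OF n, of 0] by simp
    have 1: "\<bar>integral {0..1} (\<lambda>x. poly (P j) x * (\<kappa> (tn n x) * E (tn n x))) - \<kappa> (tn n 0) * legendre_weight j * a n j\<bar>
      \<le> K\<^sup>2 * ((K * h) * (\<Sum>j\<le>m + 1. \<bar>a n j\<bar>) + K * (K * h ^ (m + 2)))"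
      by (rule legendre_test[where r = "\<rho> n"])
         (use K P_le E_rep \<rho>_le cont_tn[OF E_cont] cont_tn[OF \<kappa>_cont] n j \<kappa>_le[OF tn_in[OF n]] kappa_variation[OF n] in auto)
    have "K\<^sup>2 * ((K * h) * (\<Sum>j\<le>m + 1. \<bar>a n j\<bar>) + K * (K * h ^ (m + 2)))
      = K ^ 3 * (h * (lam n + d n)) + K ^ 3 * (h * b n) + K ^ 4 * R"
      unfolding sum_abs_a R_def by (simp add: algebra_simps power_numeral_reduce)
    also have "\<dots> \<le> K ^ 3 * X + K ^ 3 * (K * X) + K ^ 4 * X"
      using X R K h_b_le[OF n] by (intro add_mono mult_left_mono) (auto simp: R_def intro: order_trans[OF _ mult_left_mono])
    also have "\<dots> = K ^ 3 * X + 2 * (K ^ 4 * X)" by (simp add: power_numeral_reduce)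
    also have "\<dots> \<le> K ^ 6 * X + 2 * (K ^ 6 * X)" using X by (intro add_mono mult_left_mono K_power_le) auto
    finally have 2: "K\<^sup>2 * ((K * h) * (\<Sum>j\<le>m + 1. \<bar>a n j\<bar>) + K * (K * h ^ (m + 2))) \<le> 3 * (K ^ 6 * X)" by linarith
    have "\<bar>integral {0..1} (\<lambda>x. poly (P j) x * H (tn n x))\<bar> \<le> K * (4 * K ^ 5 * X)"
      by (rule abs_integral_P_le[OF j cont_tn[OF cont_H n] H_le[OF n _ e(1) X_def]])
    then have 3: "\<bar>integral {0..1} (\<lambda>x. poly (P j) x * H (tn n x))\<bar> \<le> 4 * (K ^ 6 * X)"
      by (simp add: power_numeral_reduce mult_ac)
    have "K * \<Delta> \<le> K * X" using e X K by (intro mult_left_mono) auto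
    also have "\<dots> \<le> K ^ 6 * X" using K_power_le[of 1 6 X] X by simp
    finally show "\<bar>\<kappa> (tn n 0) * legendre_weight j * a n j\<bar> \<le> 8 * K ^ 6 * X"
      using galerkin_H[OF n j] 1 2 3 by linarith
  qed
  then have "lam n \<le> (\<Sum>j<m. K\<^sup>2 * (8 * K ^ 6 * X))" unfolding lam_def by (intro sum_mono) auto
  also have "\<dots> = real m * (8 * K ^ 8 * X)" by (simp add: power_numeral_reduce)
  also have "\<dots> \<le> K * (8 * K ^ 8 * X)" using K X by (intro mult_right_mono) auto
  also have "\<dots> = 8 * K ^ 9 * X" by (simp add: power_numeral_reduce)
  finally show ?thesis unfolding X_def .
qed

text \<open>The two expansions of \<open>E\<close> are equated at the common mesh point, where
  \<open>P j\<close> is \<open>1\<close> from the left and \<open>(- 1) ^ j\<close> from the right.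
  \<open>\<rho> (Suc n)\<close> is absent because it vanishes at the left end of its cell.\<close>

lemma matching:
  assumes "Suc n < N"
  shows "(\<Sum>j\<le>m + 1. a n j) + \<rho> n 1 = (\<Sum>j\<le>m + 1. a (Suc n) j * (- 1) ^ j)"
proof -
  have "E (tn n 1) = E (tn (Suc n) 0)" by (simp add: algebra_simps)
  then show ?thesis using E_rep[of n 1] E_rep[of "Suc n" 0] assms \<rho>_0[of "Suc n"] by simp
qed

lemma split_sum: "(\<Sum>j\<le>m + 1. f j) = (\<Sum>j<m. f j) + f m + (f (m + 1) :: real)"
  by (simp flip: lessThan_Suc_atMost)

lemma abs_alternating_le: "\<bar>\<Sum>j<m. c j * (- 1) ^ j\<bar> \<le> (\<Sum>j<m. \<bar>c j :: real\<bar>)"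
  by (rule order_trans[OF sum_abs]) (simp add: abs_mult power_abs)

text \<open>Solving \<open>matching\<close> for the transported coefficient leaves the top
  coefficients in the combination bounded by assumption \<open>b\<close>: a sum for even
  \<open>m\<close>, a difference for odd \<open>m\<close>. Keeping the bound as a parameter
  \<open>e\<close> serves both parities.\<close>

lemma coefficient_step:
  assumes n: "Suc n < N" and e: "h ^ (m + 2) \<le> e"
    and b: "\<bar>a n (m + 1) + (- 1) ^ m * a (Suc n) (m + 1)\<bar> \<le> 2 * K * e"
  shows "d (Suc n) \<le> d n + 3 * K * (e + lam n + lam (Suc n))"
proof -
  have eq: "(- 1) ^ m * a (Suc n) m = a n m + (a n (m + 1) + (- 1) ^ m * a (Suc n) (m + 1))
      + (\<Sum>j<m. a n j) - (\<Sum>j<m. a (Suc n) j * (- 1) ^ j) + \<rho> n 1"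
    using matching[OF n] unfolding split_sum by (simp add: algebra_simps)
  have "d (Suc n) = \<bar>(- 1) ^ m * a (Suc n) m\<bar>" by (simp add: abs_mult power_abs)
  also have "\<dots> \<le> d n + 2 * K * e + lam n + lam (Suc n) + K * e"
  proof -
    have "K * h ^ (m + 2) \<le> K * e" using K e by (intro mult_left_mono) auto
    then have "\<bar>\<rho> n 1\<bar> \<le> K * e" using \<rho>_le[of n 1] n by simp
    moreover have "\<bar>\<Sum>j<m. a n j\<bar> \<le> lam n" unfolding lam_def by (rule sum_abs)
    moreover have "\<bar>\<Sum>j<m. a (Suc n) j * (- 1) ^ j\<bar> \<le> lam (Suc n)" unfolding lam_def by (rule abs_alternating_le)
    ultimately show ?thesis unfolding eq using b by linarith
  qed
  also have "\<dots> \<le> d n + 3 * K * (e + lam n + lam (Suc n))"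
    using K lam_nonneg[of n] lam_nonneg[of "Suc n"] mult_right_mono[of 1 K "lam n"] mult_right_mono[of 1 K "lam (Suc n)"]
    by (simp add: algebra_simps)
  finally show ?thesis .
qed

text \<open>On the first cell \<open>E 0 = 0\<close> takes the role of continuity: the alternating
  sum of the coefficients is zero.\<close>

lemma initial_coefficient_le:
  assumes N: "0 < N"
  shows "d 0 \<le> b 0 + lam 0"
proof -
  have "(\<Sum>j\<le>m + 1. a 0 j * (- 1) ^ j) = 0" using E_rep[of 0 0] E_0 \<rho>_0[of 0] N by simp
  then have eq: "(- 1) ^ m * a 0 m = (- 1) ^ m * a 0 (m + 1) - (\<Sum>j<m. a 0 j * (- 1) ^ j)"
    unfolding split_sum by (simp add: algebra_simps)
  have "d 0 = \<bar>(- 1) ^ m * a 0 m\<bar>" by (simp add: abs_mult power_abs)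
  also have "\<dots> \<le> \<bar>(- 1) ^ m * a 0 (m + 1)\<bar> + \<bar>\<Sum>j<m. a 0 j * (- 1) ^ j\<bar>" unfolding eq by linarith
  also have "\<dots> \<le> b 0 + lam 0"
    unfolding lam_def by (intro add_mono abs_alternating_le) (simp add: abs_mult power_abs)
  finally show ?thesis .
qed


section \<open>Second pass: differences of neighbouring cells\<close>

lemma h_power_3: "h ^ (m + 3) = h * h ^ (m + 2)"
proof -
  have "m + 3 = Suc (m + 2)" by simp
  then show ?thesis by (simp only: power_Suc)
qed

text \<open>With an a priori bound for the coefficients (parameters \<open>Q\<close>, \<open>e\<close>) the difference of the Galerkin equations
  of two neighbouring cells is of order \<open>Y n\<close>, where \<open>e2\<close> is one power of \<open>h\<close> better than \<open>e\<close>. This makes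
  \<open>a (n + 2) m - a n m\<close> summable over all cells when \<open>m\<close> is odd.\<close>

context
  fixes Q e e2 :: real
  assumes Q: "K \<le> Q" and e: "h ^ (m + 2) \<le> e" "h * e \<le> e2" "\<Delta> \<le> e2"
    and lam_Q: "\<And>l. l < N \<Longrightarrow> lam l \<le> Q * e" and d_Q: "\<And>l. l < N \<Longrightarrow> h * d l \<le> Q * e"
begin

abbreviation "Y n \<equiv> e2 + h * (d n + d (Suc n))"

lemma e2_nonneg: "0 \<le> e2" using e \<Delta> by linarith

lemma Y_ge: "e2 \<le> Y n" "0 \<le> Y n" "h * d n \<le> Y n" "h * d (Suc n) \<le> Y n"
  using h e2_nonneg by (auto simp: algebra_simps)

lemma Q_ge_1: "1 \<le> Q" using Q K by linarith

lemma Q_power_le: "i \<le> j \<Longrightarrow> 0 \<le> x \<Longrightarrow> Q ^ i * x \<le> Q ^ j * x"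
  using Q_ge_1 by (intro mult_right_mono power_increasing)

lemma KQ_le:
  assumes "0 \<le> x" "x \<le> y" shows "K * x \<le> Q * y" "K ^ i * x \<le> Q ^ i * y"
  using assms Q K by (auto intro!: mult_mono power_mono)

text \<open>Every a priori bound by \<open>e\<close> is multiplied by one further \<open>h\<close>,
  and \<open>h * e \<le> e2\<close>.\<close>

lemma scaled_coefficient_le:
  assumes l: "l < N"
  shows "h * lam l \<le> Q * e2" "h * (h * d l) \<le> Q * e2" "h * (h * b l) \<le> Q * e2"
    "h * h ^ (m + 2) \<le> e2" "h * (h * (lam l + d l + b l)) \<le> 3 * (Q * e2)"
proof -
  have he: "Q * (h * e) \<le> Q * e2" using e Q_ge_1 by (intro mult_left_mono) auto
  have "h * lam l \<le> h * (Q * e)" using lam_Q[OF l] h by (intro mult_left_mono) auto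
  with he show 1: "h * lam l \<le> Q * e2" by (simp add: mult_ac)
  have "h * (h * d l) \<le> h * (Q * e)" using d_Q[OF l] h by (intro mult_left_mono) auto
  with he show 2: "h * (h * d l) \<le> Q * e2" by (simp add: mult_ac)
  have "h * h ^ (m + 2) \<le> h * e" using h e by (intro mult_left_mono) auto
  with e show 3: "h * h ^ (m + 2) \<le> e2" by linarith
  have "h * (h * b l) \<le> h * (K * h ^ (m + 2))" using h_b_le[OF l] h by (intro mult_left_mono) auto
  also have "\<dots> = K * (h * h ^ (m + 2))" by simp
  also have "\<dots> \<le> Q * e2" using 3 Q K h by (intro mult_mono) auto
  finally show 4: "h * (h * b l) \<le> Q * e2" .
  have "h * (h * lam l) \<le> h * lam l" using h lam_nonneg[of l] by (intro mult_left_le_one_le) auto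
  with 1 2 4 show "h * (h * (lam l + d l + b l)) \<le> 3 * (Q * e2)"
    by (simp only: distrib_left)
qed

definition "da n j = a (Suc n) j - a n j"

lemma E_diff_rep:
  assumes "Suc n < N" "x \<in> {0..1}"
  shows "E (tn (Suc n) x) - E (tn n x) = (\<Sum>j\<le>m + 1. da n j * poly (P j) x) + (\<rho> (Suc n) x - \<rho> n x)"
  using E_rep[of n x] E_rep[of "Suc n" x] assms
  by (simp add: da_def left_diff_distrib sum_subtractf)

text \<open>The difference of the top coefficients gains a power of \<open>h\<close>. The
  coefficients of \<open>P m\<close> need not cancel, as their signs may alternate, and stay visible
  as \<open>d n + d (Suc n)\<close> in \<open>Y n\<close>.\<close>

lemma da_sum_le:
  assumes n: "Suc n < N"
  shows "h * (\<Sum>j\<le>m + 1. \<bar>da n j\<bar>) \<le> 4 * Q * Y n"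
proof -
  have nN: "n < N" using n by simp
  have "(\<Sum>j<m. \<bar>da n j\<bar>) \<le> lam (Suc n) + lam n"
    unfolding lam_def sum.distrib[symmetric] da_def by (intro sum_mono abs_triangle_ineq4)
  moreover have "\<bar>da n m\<bar> \<le> d (Suc n) + d n" unfolding da_def by (rule abs_triangle_ineq4)
  moreover have "\<bar>da n (m + 1)\<bar> \<le> K * h ^ (m + 2)" unfolding da_def by (rule b_diff[OF n])
  ultimately have "(\<Sum>j\<le>m + 1. \<bar>da n j\<bar>) \<le> lam (Suc n) + lam n + (d n + d (Suc n)) + K * h ^ (m + 2)"
    unfolding split_sum by linarith
  then have "h * (\<Sum>j\<le>m + 1. \<bar>da n j\<bar>) \<le> h * (lam (Suc n) + lam n + (d n + d (Suc n)) + K * h ^ (m + 2))"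
    using h by (intro mult_left_mono) auto
  also have "\<dots> = h * lam (Suc n) + h * lam n + h * (d n + d (Suc n)) + K * (h * h ^ (m + 2))"
    by (simp only: distrib_left mult.left_commute)
  also have "\<dots> \<le> Q * e2 + Q * e2 + h * (d n + d (Suc n)) + Q * e2"
    using h by (intro add_mono KQ_le scaled_coefficient_le[OF n] scaled_coefficient_le[OF nN]) auto
  also have "\<dots> \<le> Q * Y n + Q * Y n + Q * Y n + Q * Y n"
  proof (intro add_mono mult_left_mono Y_ge)
    have "h * (d n + d (Suc n)) \<le> 1 * Y n" using e2_nonneg by simp
    also have "\<dots> \<le> Q * Y n" using Q_ge_1 Y_ge by (intro mult_right_mono) auto
    finally show "h * (d n + d (Suc n)) \<le> Q * Y n" .
  qed (use Q_ge_1 in auto)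
  finally show ?thesis by simp
qed

text \<open>Meant for increments of \<open>q\<close> over a step \<open>h\<close> in its first
  argument: of size \<open>h\<close> by \<open>q_lip_fst\<close>, with variation \<open>h^2\<close>
  by \<open>q_mixed\<close>. Every term is one power of \<open>h\<close> better than for
  \<open>q\<close> itself.\<close>

lemma kernel_increment_mean_le:
  assumes l: "l < N" and w: "continuous_on {0..1} w" "\<And>x. x \<in> {0..1} \<Longrightarrow> \<bar>w x\<bar> \<le> K * h"
      "\<And>x. x \<in> {0..1} \<Longrightarrow> \<bar>w x - w 0\<bar> \<le> K * (h * h)"
  shows "\<bar>integral {0..1} (\<lambda>u. w u * E (tn l u))\<bar> \<le> 5 * (Q ^ 4 * e2)"
proof -
  have "\<bar>integral {0..1} (\<lambda>u. w u * E (tn l u))\<bar>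
    \<le> (K * h) * lam l + K\<^sup>2 * ((K * (h * h)) * (lam l + d l + b l) + (K * h) * (K * h ^ (m + 2)))"
    by (rule kernel_mean_le[OF l w])
  also have "\<dots> = K * (h * lam l) + K ^ 3 * (h * (h * (lam l + d l + b l))) + K ^ 4 * (h * h ^ (m + 2))"
    by (simp add: algebra_simps power_numeral_reduce)
  also have "\<dots> \<le> Q * (Q * e2) + Q ^ 3 * (3 * (Q * e2)) + Q ^ 4 * e2"
    using h lam_nonneg[of l] by (intro add_mono KQ_le scaled_coefficient_le[OF l]) auto
  also have "\<dots> = Q ^ 2 * e2 + 4 * (Q ^ 4 * e2)" by (simp add: power_numeral_reduce)
  also have "\<dots> \<le> Q ^ 4 * e2 + 4 * (Q ^ 4 * e2)" using Q_power_le[of 2 4 e2] e2_nonneg by linarith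
  finally show ?thesis by linarith
qed

text \<open>From cell \<open>n\<close> to cell \<open>n + 1\<close> the memory changes in three
  ways: the kernel on the past cells moves (\<open>A\<close>), the whole cell \<open>n\<close> is
  added (\<open>B\<close>), and the partial current cells differ (\<open>C\<close>). The bounds
  \<open>5 + 5 + 13\<close> make the 23.\<close>

lemma H_diff_le:
  assumes n: "Suc n < N" and x: "x \<in> {0..1}"
  shows "\<bar>H (tn (Suc n) x) - H (tn n x)\<bar> \<le> 23 * (Q ^ 5 * Y n)"
proof -
  have nN: "n < N" using n by simp
  define t where "t = tn n x"
  have t': "tn (Suc n) x = t + h" by (simp add: t_def algebra_simps)
  have t: "t \<in> {0..T}" "t + h \<in> {0..T}" "0 \<le> t"
    using tn_in[OF nN x] tn_in[OF n x] unfolding t' by (auto simp: t_def)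
  define A where "A l = h * integral {0..1} (\<lambda>u. q (t + h) (tn l u) * E (tn l u)) - h * integral {0..1} (\<lambda>u. q t (tn l u) * E (tn l u))" for l
  define B where "B = h * integral {0..1} (\<lambda>u. q (t + h) (tn n u) * E (tn n u))"
  define C where "C = h * integral {0..x} (\<lambda>u. q (t + h) (tn (Suc n) u) * E (tn (Suc n) u))
    - h * integral {0..x} (\<lambda>u. q t (tn n u) * E (tn n u))"
  have split: "H (tn (Suc n) x) - H (tn n x) = (\<Sum>l<n. A l) + B + C"
    using H_split[OF n x] H_split[OF nN x] unfolding t' A_def B_def C_def sum_subtractf t_def[symmetric] by simp
  have A: "\<bar>A l\<bar> \<le> h * (5 * (Q ^ 4 * e2))" if l: "l < n" for l
  proof -
    have lN: "l < N" using l n by simp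
    have tn: "tn l u \<le> t" "0 \<le> tn l u" "tn l 0 \<le> tn l u" if "u \<in> {0..1}" for u
      using tn_mono[OF l that, of x] x h that by (auto simp: t_def)
    have tn': "tn l u \<le> t + h" if "u \<in> {0..1}" for u using tn(1)[OF that] h by linarith
    have c: "continuous_on {0..1} (\<lambda>u. q (t + h) (tn l u))" "continuous_on {0..1} (\<lambda>u. q t (tn l u))"
      using tn tn' t by (auto intro!: cont_q continuous_intros)
    have "A l = h * integral {0..1} (\<lambda>u. (q (t + h) (tn l u) - q t (tn l u)) * E (tn l u))"
      unfolding A_def right_diff_distrib[symmetric] left_diff_distrib
      by (subst Henstock_Kurzweil_Integration.integral_diff)
         (auto intro!: integrable_continuous_real continuous_intros c cont_tn[OF E_cont lN])
    also have "\<bar>\<dots>\<bar> \<le> h * (5 * (Q ^ 4 * e2))"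
      unfolding abs_mult abs_of_pos[OF h(1)]
    proof (intro mult_left_mono kernel_increment_mean_le lN continuous_intros c)
      fix u :: real assume u: "u \<in> {0..1}"
      show "\<bar>q (t + h) (tn l u) - q t (tn l u)\<bar> \<le> K * h"
        using q_lip_fst[of "tn l u" t "t + h"] tn[OF u] t h by auto
      have "\<bar>(q (t + h) (tn l u) - q t (tn l u)) - (q (t + h) (tn l 0) - q t (tn l 0))\<bar> \<le> K * (t + h - t) * (tn l u - tn l 0)"
        using tn[OF u] tn[of 0] t h by (intro q_mixed) auto
      also have "\<dots> = K * h * (h * u)" by simp
      also have "\<dots> \<le> K * h * h" using K h u by (intro mult_left_mono) (auto simp: mult_left_le)
      finally show "\<bar>q (t + h) (tn l u) - q t (tn l u) - (q (t + h) (tn l 0) - q t (tn l 0))\<bar> \<le> K * (h * h)"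
        by (simp add: mult.assoc)
    qed (use h in auto)
    finally show ?thesis .
  qed
  have "\<bar>\<Sum>l<n. A l\<bar> \<le> (\<Sum>l<n. h * (5 * (Q ^ 4 * e2)))"
    using A by (intro order_trans[OF sum_abs] sum_mono) auto
  also have "\<dots> = (real n * h) * (5 * (Q ^ 4 * e2))" by simp
  also have "\<dots> \<le> Q * (5 * (Q ^ 4 * e2))"
    using nN h K Nh Q Q_ge_1 e2_nonneg mult_right_mono[of "real n" "real N" h] by (intro mult_right_mono) auto
  also have "\<dots> = 5 * (Q ^ 5 * e2)" by (simp add: power_numeral_reduce)
  also have "\<dots> \<le> 5 * (Q ^ 5 * Y n)" using Q_ge_1 Y_ge by (intro mult_left_mono) auto
  finally have 1: "\<bar>\<Sum>l<n. A l\<bar> \<le> 5 * (Q ^ 5 * Y n)" .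
  have 2: "\<bar>B\<bar> \<le> 5 * (Q ^ 5 * Y n)"
  proof -
    have tn: "tn n u \<le> t + h" "0 \<le> tn n u" "tn n 0 \<le> tn n u" if "u \<in> {0..1}" for u
      using tn_mono[of n "Suc n" u x] x h that unfolding t' by auto
    have I: "\<bar>integral {0..1} (\<lambda>u. q (t + h) (tn n u) * E (tn n u))\<bar>
      \<le> K * lam n + K\<^sup>2 * ((K * h) * (lam n + d n + b n) + K * (K * h ^ (m + 2)))"
    proof (rule kernel_mean_le[OF nN])
      show "continuous_on {0..1} (\<lambda>u. q (t + h) (tn n u))"
        using tn t by (intro cont_q continuous_intros) auto
      fix u :: real assume u: "u \<in> {0..1}"
      show "\<bar>q (t + h) (tn n u)\<bar> \<le> K" using tn[OF u] t by (intro q_le) auto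
      have "\<bar>q (t + h) (tn n u) - q (t + h) (tn n 0)\<bar> \<le> K * (tn n u - tn n 0)"
        using tn[OF u] tn[of 0] t by (intro q_lip_snd) auto
      also have "\<dots> \<le> K * h" using u h K by (intro mult_left_mono) (auto simp: mult_left_le)
      finally show "\<bar>q (t + h) (tn n u) - q (t + h) (tn n 0)\<bar> \<le> K * h" .
    qed
    have ring: "h * (K * x + K\<^sup>2 * ((K * h) * y + K * (K * r))) = K * (h * x) + K ^ 3 * (h * (h * y)) + K ^ 4 * (h * r)" for x y r
      by algebra
    have "\<bar>B\<bar> \<le> h * (K * lam n + K\<^sup>2 * ((K * h) * (lam n + d n + b n) + K * (K * h ^ (m + 2))))"
      unfolding B_def abs_mult abs_of_pos[OF h(1)] by (rule mult_left_mono[OF I]) (use h in simp)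
    also have "\<dots> = K * (h * lam n) + K ^ 3 * (h * (h * (lam n + d n + b n))) + K ^ 4 * (h * h ^ (m + 2))"
      by (rule ring)
    also have "\<dots> \<le> Q * (Q * e2) + Q ^ 3 * (3 * (Q * e2)) + Q ^ 4 * e2"
      using h lam_nonneg[of n] by (intro add_mono KQ_le scaled_coefficient_le[OF nN]) auto
    also have "\<dots> = Q ^ 2 * e2 + 4 * (Q ^ 4 * e2)" by (simp add: power_numeral_reduce)
    also have "\<dots> \<le> Q ^ 5 * e2 + 4 * (Q ^ 5 * e2)"
      using e2_nonneg by (intro add_mono mult_left_mono[of _ _ 4] Q_power_le) auto
    also have "\<dots> = 5 * (Q ^ 5 * e2)" by algebra
    also have "\<dots> \<le> 5 * (Q ^ 5 * Y n)" using Q_ge_1 Y_ge by (intro mult_left_mono) auto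
    finally show ?thesis .
  qed
  have 3: "\<bar>C\<bar> \<le> 13 * (Q ^ 5 * Y n)"
  proof -
    have u: "u \<in> {0..1}" "0 \<le> tn n u" "tn n u \<le> t" if "u \<in> {0..x}" for u
      using that x h by (auto simp: t_def)
    have c: "continuous_on {0..x} (\<lambda>u. q (t + h) (tn n u + h))" "continuous_on {0..x} (\<lambda>u. q t (tn n u))"
      "continuous_on {0..x} (\<lambda>u. E (tn n u + h))" "continuous_on {0..x} (\<lambda>u. E (tn n u))"
    proof -
      show "continuous_on {0..x} (\<lambda>u. q (t + h) (tn n u + h))" "continuous_on {0..x} (\<lambda>u. q t (tn n u))"
        by (intro cont_q continuous_intros; use u t h in force)+
      show "continuous_on {0..x} (\<lambda>u. E (tn n u))"
        using u by (intro continuous_on_subset[OF cont_tn[OF E_cont nN]]) auto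
      show "continuous_on {0..x} (\<lambda>u. E (tn n u + h))"
        using u by (intro continuous_on_subset[OF cont_tn[OF E_cont n, unfolded tn_Suc]]) auto
    qed
    have C_eq: "C = h * integral {0..x} (\<lambda>u. q (t + h) (tn n u + h) * E (tn n u + h) - q t (tn n u) * E (tn n u))"
      unfolding C_def tn_Suc
      by (subst Henstock_Kurzweil_Integration.integral_diff)
         (intro integrable_continuous_real continuous_on_mult c right_diff_distrib[symmetric])+
    define G where "G = K * (\<Sum>j\<le>m + 1. \<bar>da n j\<bar>) + K * h ^ (m + 3)"
    define L where "L = K * (lam n + d n + b n) + K * h ^ (m + 2)"
    have G0: "0 \<le> G" and L0: "0 \<le> L" using K h lam_nonneg[of n] by (auto simp: G_def L_def sum_nonneg)
    \<comment> \<open>The partial cells are compared at equal local positions. Both arguments of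
      \<open>q\<close> then move by \<open>h\<close>, which gives \<open>2 * (K * h)\<close>, and
      the change of \<open>E\<close> is the one expanded in \<open>E_diff_rep\<close>.\<close>
    have bound: "\<bar>q (t + h) (tn n v + h) * E (tn n v + h) - q t (tn n v) * E (tn n v)\<bar> \<le> K * G + 2 * (K * h) * L"
      if v: "v \<in> {0..x}" for v
    proof -
      note uv = u[OF v]
      have ring: "\<bar>w * x - y * z\<bar> \<le> \<bar>w\<bar> * \<bar>x - z\<bar> + \<bar>w - y\<bar> * \<bar>z\<bar>" for w x y z :: real
      proof -
        have "w * x - y * z = w * (x - z) + (w - y) * z" by algebra
        then show ?thesis by (simp add: abs_mult[symmetric])
      qed
      have "\<bar>q (t + h) (tn n v + h) * E (tn n v + h) - q t (tn n v) * E (tn n v)\<bar>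
        \<le> \<bar>q (t + h) (tn n v + h)\<bar> * \<bar>E (tn n v + h) - E (tn n v)\<bar> + \<bar>q (t + h) (tn n v + h) - q t (tn n v)\<bar> * \<bar>E (tn n v)\<bar>"
        by (rule ring)
      also have "\<dots> \<le> K * G + 2 * (K * h) * L"
      proof (intro add_mono mult_mono)
        show "\<bar>q (t + h) (tn n v + h)\<bar> \<le> K" using uv t h by (intro q_le) auto
        show "\<bar>E (tn n v)\<bar> \<le> L" unfolding L_def by (rule E_le[OF nN uv(1)])
        have "\<bar>q (t + h) (tn n v + h) - q (t + h) (tn n v)\<bar> \<le> K * (tn n v + h - tn n v)"
          using uv t h by (intro q_lip_snd) auto
        moreover have "\<bar>q (t + h) (tn n v) - q t (tn n v)\<bar> \<le> K * (t + h - t)"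
          using uv t h by (intro q_lip_fst) auto
        ultimately show "\<bar>q (t + h) (tn n v + h) - q t (tn n v)\<bar> \<le> 2 * (K * h)" by simp
        have "\<bar>\<Sum>j\<le>m + 1. da n j * poly (P j) v\<bar> \<le> (\<Sum>j\<le>m + 1. \<bar>da n j\<bar> * K)"
          using P_le uv by (intro order_trans[OF sum_abs] sum_mono) (auto simp: abs_mult intro!: mult_left_mono)
        also have "\<dots> = K * (\<Sum>j\<le>m + 1. \<bar>da n j\<bar>)" by (simp only: sum_distrib_left mult.commute)
        finally show "\<bar>E (tn n v + h) - E (tn n v)\<bar> \<le> G"
          using E_diff_rep[OF n uv(1)] \<rho>_diff[OF n uv(1)] unfolding tn_Suc G_def by linarith
      qed (use K h in auto)
      finally show ?thesis .
    qed
    have "\<bar>C\<bar> \<le> h * ((K * G + 2 * (K * h) * L) * (x - 0))"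
      unfolding C_eq abs_mult abs_of_pos[OF h(1)]
    proof (rule mult_left_mono)
      have "norm (integral {0..x} (\<lambda>u. q (t + h) (tn n u + h) * E (tn n u + h) - q t (tn n u) * E (tn n u)))
        \<le> (K * G + 2 * (K * h) * L) * (x - 0)"
        by (intro integral_bound continuous_intros c) (use x bound in auto)
      then show "\<bar>integral {0..x} (\<lambda>u. q (t + h) (tn n u + h) * E (tn n u + h) - q t (tn n u) * E (tn n u))\<bar>
        \<le> (K * G + 2 * (K * h) * L) * (x - 0)" by simp
    qed (use h in auto)
    also have "\<dots> \<le> h * ((K * G + 2 * (K * h) * L) * 1)"
      using x K h G0 L0 by (intro mult_left_mono) auto
    also have "\<dots> = K\<^sup>2 * (h * (\<Sum>j\<le>m + 1. \<bar>da n j\<bar>)) + K\<^sup>2 * (h * (h * h ^ (m + 2)))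
        + 2 * (K\<^sup>2 * (h * (h * (lam n + d n + b n)))) + 2 * (K\<^sup>2 * (h * (h * h ^ (m + 2))))"
    proof -
      have ring: "h * ((K * (K * s + K * (h * r)) + 2 * (K * h) * (K * y + K * r)) * 1)
        = K\<^sup>2 * (h * s) + K\<^sup>2 * (h * (h * r)) + 2 * (K\<^sup>2 * (h * (h * y))) + 2 * (K\<^sup>2 * (h * (h * r)))" for s r y
        by algebra
      show ?thesis unfolding G_def L_def h_power_3 by (rule ring)
    qed
    also have "\<dots> \<le> Q\<^sup>2 * (4 * Q * Y n) + Q\<^sup>2 * e2 + 2 * (Q\<^sup>2 * (3 * (Q * e2))) + 2 * (Q\<^sup>2 * e2)"
    proof -
      have "h * (h * h ^ (m + 2)) \<le> h * h ^ (m + 2)" using h by (intro mult_left_le_one_le) auto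
      then have "h * (h * h ^ (m + 2)) \<le> e2" using scaled_coefficient_le(4)[OF nN] by linarith
      then show ?thesis
        using h lam_nonneg[of n] by (intro add_mono KQ_le mult_left_mono[of _ _ 2] scaled_coefficient_le[OF nN] da_sum_le n) (auto intro!: mult_nonneg_nonneg sum_nonneg)
    qed
    also have "\<dots> = 4 * (Q ^ 3 * Y n) + 3 * (Q\<^sup>2 * e2) + 6 * (Q ^ 3 * e2)" by (simp add: power_numeral_reduce)
    also have "\<dots> \<le> 4 * (Q ^ 5 * Y n) + 3 * (Q ^ 5 * Y n) + 6 * (Q ^ 5 * Y n)"
    proof -
      have "Q\<^sup>2 * e2 \<le> Q ^ 5 * Y n" "Q ^ 3 * e2 \<le> Q ^ 5 * Y n"
        using Y_ge(1)[of n] e2_nonneg Q_ge_1 by (auto intro!: mult_mono power_increasing)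
      then show ?thesis using Q_power_le[of 3 5 "Y n"] Y_ge(2)[of n] by linarith
    qed
    finally show ?thesis by linarith
  qed
  show ?thesis unfolding split using 1 2 3 by linarith
qed

text \<open>The difference of two Galerkin equations is arranged as \<open>\<kappa>\<close> times
  the increment of \<open>E\<close>, plus the increment of \<open>\<kappa>\<close> times
  \<open>E\<close>, minus the increment of \<open>H\<close>. The bounds \<open>5 + 5 + 23\<close>
  and two perturbations make the 35.\<close>

lemma a_diff_le:
  assumes n: "Suc n < N" and j: "j < m"
  shows "\<bar>a (Suc n) j - a n j\<bar> \<le> 35 * (Q ^ 8 * Y n)"
proof -
  have nN: "n < N" using n by simp
  let ?k = "\<lambda>x. \<kappa> (tn (Suc n) x)" and ?I = "\<lambda>f. integral {0..1} (\<lambda>x. poly (P j) x * f x)"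
  have c: "continuous_on {0..1} (\<lambda>x. \<kappa> (tn (Suc n) x))" "continuous_on {0..1} (\<lambda>x. \<kappa> (tn n x))"
    "continuous_on {0..1} (\<lambda>x. E (tn (Suc n) x))" "continuous_on {0..1} (\<lambda>x. E (tn n x))"
    "continuous_on {0..1} (\<lambda>x. H (tn (Suc n) x))" "continuous_on {0..1} (\<lambda>x. H (tn n x))"
    by (rule cont_tn[OF \<kappa>_cont n] cont_tn[OF \<kappa>_cont nN] cont_tn[OF E_cont n] cont_tn[OF E_cont nN]
        cont_tn[OF cont_H n] cont_tn[OF cont_H nN])+
  have 1: "\<bar>?I (\<lambda>x. ?k x * (E (tn (Suc n) x) - E (tn n x))) - ?k 0 * legendre_weight j * da n j\<bar> \<le> 5 * (Q ^ 4 * Y n)"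
  proof -
    have "\<bar>?I (\<lambda>x. ?k x * (E (tn (Suc n) x) - E (tn n x))) - ?k 0 * legendre_weight j * da n j\<bar>
      \<le> K\<^sup>2 * ((K * h) * (\<Sum>j\<le>m + 1. \<bar>da n j\<bar>) + K * (K * h ^ (m + 3)))"
    proof (rule legendre_test[where r = "\<lambda>x. \<rho> (Suc n) x - \<rho> n x"])
      show "continuous_on {0..1} (\<lambda>x. E (tn (Suc n) x) - E (tn n x))" by (intro continuous_on_diff c)
      show "j \<le> m + 1" using j by simp
      fix x :: real assume x: "x \<in> {0..1}"
      show "E (tn (Suc n) x) - E (tn n x) = (\<Sum>i\<le>m + 1. da n i * poly (P i) x) + (\<rho> (Suc n) x - \<rho> n x)"
        by (rule E_diff_rep[OF n x])
      show "\<bar>\<rho> (Suc n) x - \<rho> n x\<bar> \<le> K * h ^ (m + 3)" by (rule \<rho>_diff[OF n x])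
      show "\<bar>?k x\<bar> \<le> K" by (rule \<kappa>_le[OF tn_in[OF n x]])
      show "\<bar>?k x - ?k 0\<bar> \<le> K * h" by (rule kappa_variation[OF n x])
    qed (use K(1) P_le c in blast)+
    also have "\<dots> = K ^ 3 * (h * (\<Sum>j\<le>m + 1. \<bar>da n j\<bar>)) + K ^ 4 * (h * h ^ (m + 2))"
    proof -
      have "K\<^sup>2 * ((K * h) * s + K * (K * (h * r))) = K ^ 3 * (h * s) + K ^ 4 * (h * r)" for s r by algebra
      then show ?thesis unfolding h_power_3 .
    qed
    also have "\<dots> \<le> Q ^ 3 * (4 * Q * Y n) + Q ^ 4 * Y n"
      using order_trans[OF scaled_coefficient_le(4)[OF nN] Y_ge(1)] h
      by (intro add_mono KQ_le da_sum_le n) (auto intro!: mult_nonneg_nonneg sum_nonneg)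
    also have "\<dots> = 5 * (Q ^ 4 * Y n)" by (simp add: power_numeral_reduce)
    finally show ?thesis .
  qed
  \<comment> \<open>A pointwise bound would leave \<open>h * b n\<close>, bounded only by a multiple
    of \<open>h ^ (m + 2)\<close>, one power short of \<open>e2\<close>. Testing with
    \<open>P j\<close> removes it up to the variation of the increment of \<open>\<kappa>\<close>,
    of order \<open>h^2\<close> by \<open>\<kappa>_diff2\<close>.\<close>
  have 2: "\<bar>?I (\<lambda>x. (?k x - \<kappa> (tn n x)) * E (tn n x))\<bar> \<le> 5 * (Q ^ 4 * Y n)"
  proof -
    have w: "\<bar>?k x - \<kappa> (tn n x)\<bar> \<le> K * h" if "x \<in> {0..1}" for x
      using \<kappa>_lip[of "tn n x" "tn (Suc n) x"] tn_in[OF n that] tn_in[OF nN that] h unfolding tn_Suc by auto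
    have w': "\<bar>(?k x - \<kappa> (tn n x)) - (?k 0 - \<kappa> (tn n 0))\<bar> \<le> K * (h * h)" if x: "x \<in> {0..1}" for x
    proof -
      have eq: "tn (Suc n) 0 + h * x = tn (Suc n) x" "tn n 0 + h * x = tn n x" "tn (Suc n) 0 - tn n 0 = h"
        by (simp_all add: algebra_simps)
      have "\<bar>(\<kappa> (tn (Suc n) 0 + h * x) - \<kappa> (tn n 0 + h * x)) - (\<kappa> (tn (Suc n) 0) - \<kappa> (tn n 0))\<bar>
         \<le> K * (tn (Suc n) 0 - tn n 0) * (h * x)"
      proof (rule \<kappa>_diff2)
        show "tn n 0 \<le> tn (Suc n) 0" using eq(3) h by linarith
        show "tn (Suc n) 0 + h * x \<le> T" unfolding eq using tn_in[OF n x] by simp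
      qed (use h x in auto)
      also have "\<dots> = K * (h * (h * x))" unfolding eq by simp
      also have "\<dots> \<le> K * (h * h)" using K h x by (intro mult_left_mono) (auto simp: mult_left_le)
      finally show ?thesis unfolding eq .
    qed
    have "\<bar>?I (\<lambda>x. (?k x - \<kappa> (tn n x)) * E (tn n x)) - (?k 0 - \<kappa> (tn n 0)) * legendre_weight j * a n j\<bar>
      \<le> K\<^sup>2 * ((K * (h * h)) * (\<Sum>j\<le>m + 1. \<bar>a n j\<bar>) + (K * h) * (K * h ^ (m + 2)))"
    proof (rule legendre_test[where r = "\<rho> n"])
      show "continuous_on {0..1} (\<lambda>x. ?k x - \<kappa> (tn n x))" by (intro continuous_on_diff c)
      show "j \<le> m + 1" using j by simp
      fix x :: real assume x: "x \<in> {0..1}"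
      show "E (tn n x) = (\<Sum>i\<le>m + 1. a n i * poly (P i) x) + \<rho> n x" by (rule E_rep[OF nN x])
      show "\<bar>\<rho> n x\<bar> \<le> K * h ^ (m + 2)" by (rule \<rho>_le[OF nN x])
      show "\<bar>?k x - \<kappa> (tn n x)\<bar> \<le> K * h" by (rule w[OF x])
      show "\<bar>(?k x - \<kappa> (tn n x)) - (?k 0 - \<kappa> (tn n 0))\<bar> \<le> K * (h * h)" by (rule w'[OF x])
    qed (use K(1) P_le c in blast)+
    also have "\<dots> = K ^ 3 * (h * (h * (lam n + d n + b n))) + K ^ 4 * (h * h ^ (m + 2))"
    proof -
      have "K\<^sup>2 * ((K * (h * h)) * s + (K * h) * (K * r)) = K ^ 3 * (h * (h * s)) + K ^ 4 * (h * r)" for s r by algebra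
      then show ?thesis unfolding sum_abs_a .
    qed
    also have "\<dots> \<le> Q ^ 3 * (3 * (Q * e2)) + Q ^ 4 * e2"
      using h lam_nonneg[of n] by (intro add_mono KQ_le scaled_coefficient_le[OF nN]) auto
    also have "\<dots> = 4 * (Q ^ 4 * e2)" by (simp add: power_numeral_reduce)
    also have "\<dots> \<le> 4 * (Q ^ 4 * Y n)" using Q_ge_1 Y_ge by (intro mult_left_mono) auto
    finally have *: "\<bar>?I (\<lambda>x. (?k x - \<kappa> (tn n x)) * E (tn n x)) - (?k 0 - \<kappa> (tn n 0)) * legendre_weight j * a n j\<bar>
      \<le> 4 * (Q ^ 4 * Y n)" .
    have "\<bar>a n j\<bar> \<le> lam n" unfolding lam_def using j by (intro member_le_sum) auto
    then have "\<bar>(?k 0 - \<kappa> (tn n 0)) * legendre_weight j * a n j\<bar> \<le> (K * h) * K * lam n"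
      unfolding abs_mult using w[of 0] weight_le[OF j] legendre_weight_pos[of j] K h
      by (intro mult_mono) auto
    also have "\<dots> = K\<^sup>2 * (h * lam n)" by (simp add: power2_eq_square)
    also have "\<dots> \<le> Q\<^sup>2 * (Q * Y n)"
    proof (rule KQ_le)
      have "Q * e2 \<le> Q * Y n" using Q_ge_1 Y_ge by (intro mult_left_mono) auto
      then show "h * lam n \<le> Q * Y n" using scaled_coefficient_le(1)[OF nN] by linarith
    qed (use h lam_nonneg[of n] in auto)
    also have "\<dots> = Q ^ 3 * Y n" by (simp add: power_numeral_reduce)
    also have "\<dots> \<le> Q ^ 4 * Y n" using Y_ge by (intro Q_power_le) auto
    finally show ?thesis using * by linarith
  qed
  have 3: "\<bar>?I (\<lambda>x. H (tn (Suc n) x) - H (tn n x))\<bar> \<le> K * (23 * (Q ^ 5 * Y n))"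
    by (intro abs_integral_P_le[OF j] continuous_intros c H_diff_le n)
  have "K * (23 * (Q ^ 5 * Y n)) \<le> Q * (23 * (Q ^ 5 * Y n))"
    using Q Q_ge_1 Y_ge by (intro mult_right_mono) auto
  also have "\<dots> = 23 * (Q ^ 6 * Y n)" by (simp add: power_numeral_reduce)
  finally have 3: "\<bar>?I (\<lambda>x. H (tn (Suc n) x) - H (tn n x))\<bar> \<le> 23 * (Q ^ 6 * Y n)" using 3 by linarith
  have int: "(\<lambda>x. poly (P j) x * f x) integrable_on {0..1}" if "continuous_on {0..1} f" for f
    by (intro integrable_continuous_real continuous_intros that)
  have Isub: "?I (\<lambda>x. f x - f' x) = ?I f - ?I f'" if "continuous_on {0..1} f" "continuous_on {0..1} f'" for f f'
    unfolding right_diff_distrib by (intro Henstock_Kurzweil_Integration.integral_diff int that)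
  have "?I (\<lambda>x. ?k x * (E (tn (Suc n) x) - E (tn n x))) = ?I (\<lambda>x. ?k x * E (tn (Suc n) x)) - ?I (\<lambda>x. ?k x * E (tn n x))"
    unfolding right_diff_distrib[of "\<kappa> _"] by (intro Isub continuous_on_mult c)
  moreover have "?I (\<lambda>x. (?k x - \<kappa> (tn n x)) * E (tn n x)) = ?I (\<lambda>x. ?k x * E (tn n x)) - ?I (\<lambda>x. \<kappa> (tn n x) * E (tn n x))"
    unfolding left_diff_distrib by (intro Isub continuous_on_mult c)
  moreover have "?I (\<lambda>x. H (tn (Suc n) x) - H (tn n x)) = ?I (\<lambda>x. H (tn (Suc n) x)) - ?I (\<lambda>x. H (tn n x))"
    by (intro Isub c)
  moreover have "K * \<Delta> \<le> Q ^ 6 * Y n"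
  proof -
    have "K * \<Delta> \<le> Q * Y n" using K Q \<Delta> e Y_ge(1)[of n] by (intro mult_mono) auto
    also have "\<dots> \<le> Q ^ 6 * Y n" using Q_power_le[of 1 6 "Y n"] Y_ge by simp
    finally show ?thesis .
  qed
  moreover have "Q ^ 4 * Y n \<le> Q ^ 6 * Y n" using Y_ge by (intro Q_power_le) auto
  ultimately have "\<bar>?k 0 * legendre_weight j * da n j\<bar> \<le> 35 * (Q ^ 6 * Y n)"
    using galerkin_H[OF n j] galerkin_H[OF nN j] 1 2 3 by linarith
  then have "\<bar>da n j\<bar> \<le> K\<^sup>2 * (35 * (Q ^ 6 * Y n))"
    using tn_in[OF n, of 0] by (intro abs_a_le_of_test[OF j]) auto
  also have "\<dots> \<le> Q\<^sup>2 * (35 * (Q ^ 6 * Y n))"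
    using K Q Q_ge_1 Y_ge by (intro mult_right_mono power_mono) auto
  also have "\<dots> = 35 * (Q ^ 8 * Y n)" by (simp add: power_numeral_reduce)
  finally show ?thesis unfolding da_def .
qed

text \<open>For odd \<open>m\<close>, subtracting \<open>matching\<close> at two consecutive mesh
  points cancels \<open>a (Suc n) m\<close> and leaves differences only: two of the lower
  coefficients (35 each), the second difference of the top ones and the increment of
  \<open>\<rho>\<close> (1 each), in total 72.\<close>

lemma coefficient_two_step:
  assumes n: "Suc (Suc n) < N" and odd: "odd m"
  shows "d (Suc (Suc n)) \<le> d n
    + 72 * Q ^ 9 * (e2 + h * (d n + d (Suc n) + d (Suc (Suc n))))"
proof -
  define Z where "Z = e2 + h * (d n + d (Suc n) + d (Suc (Suc n)))"
  have n': "Suc n < N" using n by simp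
  have YZ: "Y n \<le> Z" "Y (Suc n) \<le> Z" "e2 \<le> Z" "0 \<le> Z"
    using h e2_nonneg by (auto simp: Z_def distrib_left)
  have da: "(\<Sum>j<m. \<bar>a (Suc i) j - a i j\<bar>) \<le> 35 * (Q ^ 9 * Z)" if i: "Suc i < N" and "Y i \<le> Z" for i
  proof -
    have "(\<Sum>j<m. \<bar>a (Suc i) j - a i j\<bar>) \<le> (\<Sum>j<m. 35 * (Q ^ 8 * Z))"
    proof (intro sum_mono)
      fix j assume "j \<in> {..<m}"
      then have "\<bar>a (Suc i) j - a i j\<bar> \<le> 35 * (Q ^ 8 * Y i)" by (intro a_diff_le i) auto
      also have "\<dots> \<le> 35 * (Q ^ 8 * Z)" using Q_ge_1 that by (intro mult_left_mono) auto
      finally show "\<bar>a (Suc i) j - a i j\<bar> \<le> 35 * (Q ^ 8 * Z)" .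
    qed
    also have "\<dots> = real m * (35 * (Q ^ 8 * Z))" by simp
    also have "\<dots> \<le> Q * (35 * (Q ^ 8 * Z))" using K Q Q_ge_1 YZ by (intro mult_right_mono) auto
    also have "\<dots> = 35 * (Q ^ 9 * Z)" by (simp add: power_numeral_reduce)
    finally show ?thesis .
  qed
  have 1: "\<bar>(\<Sum>j<m. a (Suc n) j) - (\<Sum>j<m. a n j)\<bar> \<le> 35 * (Q ^ 9 * Z)"
    unfolding sum_subtractf[symmetric] by (rule order_trans[OF sum_abs da[OF n' YZ(1)]])
  have 2: "\<bar>(\<Sum>j<m. a (Suc (Suc n)) j * (- 1) ^ j) - (\<Sum>j<m. a (Suc n) j * (- 1) ^ j)\<bar> \<le> 35 * (Q ^ 9 * Z)"
    unfolding sum_subtractf[symmetric] left_diff_distrib[symmetric]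
    by (rule order_trans[OF abs_alternating_le da[OF n YZ(2)]])
  have 3: "K * h ^ (m + 3) \<le> Q ^ 9 * Z"
  proof -
    have "K * (h * h ^ (m + 2)) \<le> Q * Z" using K Q h scaled_coefficient_le(4)[OF n] YZ by (intro mult_mono) auto
    also have "\<dots> \<le> Q ^ 9 * Z" using Q_power_le[of 1 9 Z] YZ by simp
    finally show ?thesis unfolding h_power_3 .
  qed
  have eq: "a (Suc (Suc n)) m = a n m + (a (Suc (Suc n)) (m + 1) - 2 * a (Suc n) (m + 1) + a n (m + 1))
     - ((\<Sum>j<m. a (Suc n) j) - (\<Sum>j<m. a n j))
     + ((\<Sum>j<m. a (Suc (Suc n)) j * (- 1) ^ j) - (\<Sum>j<m. a (Suc n) j * (- 1) ^ j)) - (\<rho> (Suc n) 1 - \<rho> n 1)"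
    using matching[OF n'] matching[OF n] odd unfolding split_sum by simp
  have "d (Suc (Suc n)) \<le> d n + 72 * (Q ^ 9 * Z)"
    using eq 1 2 3 b_diff2[OF n] \<rho>_diff[OF n', of 1] by simp
  then show ?thesis unfolding Z_def by simp
qed

end

end

section \<open>Bounds for the data\<close>

text \<open>Bounds are stated for all sufficiently large \<open>K\<close>, so that finitely many of them can share one \<open>K\<close>.\<close>

lemma eventually_abs_le:
  fixes f :: "'a::topological_space \<Rightarrow> real"
  assumes "compact S" "continuous_on S f"
  shows "\<forall>\<^sub>F K in at_top. \<forall>x\<in>S. \<bar>f x\<bar> \<le> K"
proof -
  have "bounded (f ` S)" using assms by (intro compact_imp_bounded compact_continuous_image)
  then obtain B where "\<forall>x\<in>S. \<bar>f x\<bar> \<le> B" by (auto simp: bounded_iff)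
  then have "\<forall>x\<in>S. \<bar>f x\<bar> \<le> K" if "K \<ge> B" for K using that by force
  then show ?thesis unfolding eventually_at_top_linorder by blast
qed

text \<open>Lower bounds take the form \<open>1 \<le> K * c\<close>, which, like an upper bound by
  \<open>K\<close>, stays true when \<open>K\<close> grows.\<close>

lemma eventually_mult_ge_1:
  fixes c :: real assumes "c > 0" shows "\<forall>\<^sub>F K in at_top. 1 \<le> K * c"
proof -
  have "1 \<le> K * c" if "K \<ge> 1 / c" for K using that assms by (simp add: field_simps)
  then show ?thesis unfolding eventually_at_top_linorder by blast
qed

lemma compact_volterra_domain: "compact (volterra_domain T)"
proof -
  have "volterra_domain T = {p. 0 \<le> snd p} \<inter> {p. snd p \<le> fst p} \<inter> {p. fst p \<le> T}"
    by (auto simp: volterra_domain_def)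
  moreover have "closed \<dots>" by (intro closed_Int closed_Collect_le continuous_intros)
  moreover have "volterra_domain T \<subseteq> {0..T} \<times> {0..T}" by (auto simp: volterra_domain_def)
  then have "bounded (volterra_domain T)" by (rule bounded_subset[rotated]) (intro bounded_Times bounded_closed_interval)
  ultimately show ?thesis by (simp add: compact_eq_bounded_closed)
qed

section \<open>Mean value estimates and derivatives within an interval\<close>

lemma real_derivative_bound:
  fixes f :: "real \<Rightarrow> real"
  assumes "\<And>x. x \<in> {a..b} \<Longrightarrow> (f has_real_derivative f' x) (at x within {a..b})"
    and "\<And>x. x \<in> {a..b} \<Longrightarrow> \<bar>f' x\<bar> \<le> B" and "a \<le> x" "x \<le> y" "y \<le> b"
  shows "\<bar>f y - f x\<bar> \<le> B * (y - x)"
proof -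
  have "norm (f y - f x) \<le> B * norm (y - x)"
    by (rule field_differentiable_bound[of "{a..b}" f f']) (use assms in auto)
  then show ?thesis using assms by simp
qed

lemma has_real_derivative_shift:
  fixes f :: "real \<Rightarrow> real"
  assumes "(f has_real_derivative D) (at (c + x) within S)" "(+) c ` A \<subseteq> S"
  shows "((\<lambda>x. f (c + x)) has_real_derivative D) (at x within A)"
proof -
  have "(f has_real_derivative D) (at (c + x) within (+) c ` A)" using assms by (rule DERIV_subset)
  moreover have "((+) c has_real_derivative 1) (at x within A)"
    by (auto intro!: derivative_eq_intros)
  ultimately show ?thesis using DERIV_image_chain[of f D "(+) c" x A 1] by (simp add: o_def)
qed

text \<open>Mean value estimate in \<open>r\<close>, where the derivative is an increment of
  \<open>f'\<close> over a distance \<open>t' - t\<close>. Applied to the diagonal of the kernel and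
  to a multiple of the \<open>m\<close>-th derivative of \<open>y\<close>.\<close>

lemma second_difference_le:
  fixes f :: "real \<Rightarrow> real"
  assumes der: "\<And>x. x \<in> {0..T} \<Longrightarrow> (f has_real_derivative f' x) (at x within {0..T})"
    and lip: "\<And>x y. 0 \<le> x \<Longrightarrow> x \<le> y \<Longrightarrow> y \<le> T \<Longrightarrow> \<bar>f' y - f' x\<bar> \<le> K * (y - x)"
    and t: "0 \<le> t" "t \<le> t'" "0 \<le> r" "t' + r \<le> T"
  shows "\<bar>(f (t' + r) - f (t + r)) - (f t' - f t)\<bar> \<le> K * (t' - t) * r"
proof -
  have "\<bar>(f (t' + r) - f (t + r)) - (f (t' + 0) - f (t + 0))\<bar> \<le> K * (t' - t) * (r - 0)"
  proof (rule real_derivative_bound[where a = 0 and b = r and f = "\<lambda>x. f (t' + x) - f (t + x)"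
        and f' = "\<lambda>x. f' (t' + x) - f' (t + x)"])
    fix x assume x: "x \<in> {0..r}"
    show "((\<lambda>x. f (t' + x) - f (t + x)) has_real_derivative f' (t' + x) - f' (t + x)) (at x within {0..r})"
      by (intro DERIV_diff has_real_derivative_shift[where S = "{0..T}"] der) (use t x in auto)
    show "\<bar>f' (t' + x) - f' (t + x)\<bar> \<le> K * (t' - t)" using lip[of "t + x" "t' + x"] t x by simp
  qed (use t in auto)
  then show ?thesis by simp
qed

text \<open>The mean value theorem asks for derivatives in the open interval only. This matters
  because \<open>E\<close> need not be differentiable at mesh points, where \<open>yh\<close> may
  jump.\<close>

lemma interior_derivative_bound:
  fixes f :: "real \<Rightarrow> real"
  assumes "continuous_on {0..1} f" "f 0 = 0"
    and "\<And>x. 0 < x \<Longrightarrow> x < 1 \<Longrightarrow> (f has_real_derivative f' x) (at x)"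
    and "\<And>x. 0 < x \<Longrightarrow> x < 1 \<Longrightarrow> \<bar>f' x\<bar> \<le> B" and x: "x \<in> {0..1}" and B: "0 \<le> B"
  shows "\<bar>f x\<bar> \<le> B"
proof (cases "x = 0")
  case False
  then have x0: "0 < x" "x \<le> 1" using x by auto
  have "\<exists>l z. 0 < z \<and> z < x \<and> (f has_real_derivative l) (at z) \<and> f x - f 0 = (x - 0) * l"
  proof (rule MVT[OF x0(1)])
    show "continuous_on {0..x} f" using assms(1) by (rule continuous_on_subset) (use x0 in auto)
    show "f differentiable at z" if "0 < z" "z < x" for z
      using assms(3)[of z] that x0 by (auto simp: real_differentiable_def)
  qed
  then obtain l z where z: "0 < z" "z < x" "(f has_real_derivative l) (at z)" "f x = x * l"
    using assms(2) by auto
  have "l = f' z" using z(3) assms(3)[of z] z x0 by (intro DERIV_unique) auto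
  then have "\<bar>l\<bar> \<le> B" using assms(4)[of z] z x0 by auto
  then have "\<bar>x\<bar> * \<bar>l\<bar> \<le> 1 * B" using x0 by (intro mult_mono) auto
  then show ?thesis by (simp add: z(4) abs_mult)
qed (use assms in auto)

lemma deriv_within_0 [simp]: "deriv_within 0 S f = f"
  by (simp add: deriv_within_def)

lemma deriv_within_Suc: "deriv_within (Suc n) S f = (\<lambda>t. vector_derivative (deriv_within n S f) (at t within S))"
  by (simp add: deriv_within_def)

text \<open>The derivatives hidden in the existential definition of \<open>Ck_on\<close> are
  identified with iterated \<open>vector_derivative\<close>; they are unique within a nondegenerate
  interval.\<close>

lemma Ck_on_deriv_within:
  assumes T: "T > 0" and f: "Ck_on (n + i) {0..T} f"
  shows "Ck_on n {0..T} (deriv_within i {0..T} f)"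
  using f
proof (induction i arbitrary: n)
  case (Suc i)
  then have "Ck_on (Suc n + i) {0..T} f" by (simp only: add_Suc add_Suc_right)
  then have "Ck_on (Suc n) {0..T} (deriv_within i {0..T} f)" by (rule Suc.IH)
  then obtain g where g: "\<forall>x\<in>{0..T}. (deriv_within i {0..T} f has_real_derivative g x) (at x within {0..T})"
    "Ck_on n {0..T} g" unfolding Ck_on_Suc_real by blast
  have "g x = deriv_within (Suc i) {0..T} f x" if "x \<in> {0..T}" for x
    unfolding deriv_within_Suc using g(1) that T
    by (intro vector_derivative_within_closed_interval[symmetric]) (auto simp: has_real_derivative_iff_has_vector_derivative)
  with g(2) show ?case by (rule Ck_on_cong)
qed simp

lemma deriv_within_has_derivative:
  assumes T: "T > 0" and f: "Ck_on (Suc i) {0..T} f" and x: "x \<in> {0..T}"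
  shows "(deriv_within i {0..T} f has_real_derivative deriv_within (Suc i) {0..T} f x) (at x within {0..T})"
proof -
  have "Ck_on 1 {0..T} (deriv_within i {0..T} f)" using Ck_on_deriv_within[OF T, of 1 i] f by simp
  then obtain d where d: "(deriv_within i {0..T} f has_real_derivative d) (at x within {0..T})"
    using x unfolding One_nat_def Ck_on_Suc_real by blast
  then have "deriv_within (Suc i) {0..T} f x = d"
    unfolding deriv_within_Suc using x T
    by (intro vector_derivative_within_closed_interval) (auto simp: has_real_derivative_iff_has_vector_derivative)
  with d show ?thesis by simp
qed

lemma pderiv_sum: "pderiv (\<Sum>i\<in>A. f i :: real poly) = (\<Sum>i\<in>A. pderiv (f i))"
  by (induction A rule: infinite_finite_induct) (auto simp: pderiv_add)

lemma poly_antiderivative: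
  fixes p :: "real poly"
  obtains A where "pderiv A = p" "poly A 0 = c" "degree A \<le> Suc (degree p)"
proof -
  define A where "A = [:c:] + (\<Sum>i\<le>degree p. monom (coeff p i / real (Suc i)) (Suc i))"
  have "pderiv A = (\<Sum>i\<le>degree p. monom (coeff p i) i)"
    by (simp add: A_def pderiv_add pderiv_sum pderiv_monom pderiv_pCons del: of_nat_Suc)
  also have "\<dots> = p" by (rule poly_as_sum_of_monoms)
  finally have "pderiv A = p" .
  moreover have "poly A 0 = c" by (simp add: A_def poly_sum poly_monom)
  moreover have "degree A \<le> Suc (degree p)"
    unfolding A_def by (intro degree_add_le degree_sum_le) (auto intro: order_trans[OF degree_monom_le])
  ultimately show ?thesis by (rule that)
qed

text \<open>\<open>q\<close> is the derivative of \<open>k\<close> in \<open>s\<close>. The mixed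
  difference is estimated by mean values in \<open>s\<close> and in \<open>t\<close>, so derivatives
  of \<open>k\<close> of order two in \<open>s\<close> and one in \<open>t\<close> are
  bounded.\<close>

lemma kernel_bounds:
  assumes k: "Ck_on 3 (volterra_domain T) (\<lambda>(t, s). k t s)"
  shows "\<exists>q. continuous_on (volterra_domain T) (\<lambda>(t, s). q t s) \<and>
    (\<forall>t s. 0 \<le> s \<longrightarrow> s \<le> t \<longrightarrow> t \<le> T \<longrightarrow> ((\<lambda>s. k t s) has_real_derivative q t s) (at s within {0..t})) \<and>
    (\<forall>\<^sub>F K in at_top.
      (\<forall>t s. 0 \<le> s \<longrightarrow> s \<le> t \<longrightarrow> t \<le> T \<longrightarrow> \<bar>q t s\<bar> \<le> K) \<and>
      (\<forall>t s s'. 0 \<le> s \<longrightarrow> s \<le> s' \<longrightarrow> s' \<le> t \<longrightarrow> t \<le> T \<longrightarrow> \<bar>q t s' - q t s\<bar> \<le> K * (s' - s)) \<and>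
      (\<forall>t t' s. 0 \<le> s \<longrightarrow> s \<le> t \<longrightarrow> t \<le> t' \<longrightarrow> t' \<le> T \<longrightarrow> \<bar>q t' s - q t s\<bar> \<le> K * (t' - t)) \<and>
      (\<forall>t t' s s'. 0 \<le> s \<longrightarrow> s \<le> s' \<longrightarrow> s' \<le> t \<longrightarrow> t \<le> t' \<longrightarrow> t' \<le> T \<longrightarrow>
         \<bar>(q t' s' - q t s') - (q t' s - q t s)\<bar> \<le> K * (t' - t) * (s' - s)))"
proof -
  let ?D = "volterra_domain T"
  define F where "F = (\<lambda>(t, s). k t s)"
  have F3: "Ck_on (Suc 2) ?D F" using k by (simp add: F_def eval_nat_numeral)
  obtain F1 F2 where F2: "Ck_on 2 ?D F2" and dF: "\<forall>p\<in>?D. (F has_derivative (\<lambda>v. F1 p * fst v + F2 p * snd v)) (at p within ?D)"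
    using Ck_on_Suc_pairD[OF F3] by blast
  have "Ck_on (Suc 1) ?D F2" using F2 by (simp add: eval_nat_numeral)
  from Ck_on_Suc_pairD[OF this] obtain F21 F22 where F21: "Ck_on 1 ?D F21" and F22: "Ck_on 1 ?D F22"
    and dF2: "\<forall>p\<in>?D. (F2 has_derivative (\<lambda>v. F21 p * fst v + F22 p * snd v)) (at p within ?D)" by blast
  have "Ck_on (Suc 0) ?D F22" using F22 by simp
  from Ck_on_Suc_pairD[OF this] obtain F221 F222 where F221: "Ck_on 0 ?D F221"
    and dF22: "\<forall>p\<in>?D. (F22 has_derivative (\<lambda>v. F221 p * fst v + F222 p * snd v)) (at p within ?D)" by blast
  define q where "q t s = F2 (t, s)" for t s
  note cont = F2[THEN Ck_on_imp_continuous_on] F21[THEN Ck_on_imp_continuous_on]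
    F22[THEN Ck_on_imp_continuous_on] F221[THEN Ck_on_imp_continuous_on]
  have "continuous_on ?D (\<lambda>(t, s). q t s)" using cont(1) by (simp add: q_def)
  moreover have "\<forall>t s. 0 \<le> s \<longrightarrow> s \<le> t \<longrightarrow> t \<le> T \<longrightarrow> ((\<lambda>s. k t s) has_real_derivative q t s) (at s within {0..t})"
  proof (intro allI impI)
    fix t s assume *: "0 \<le> s" "s \<le> t" "t \<le> T"
    have "((\<lambda>s. F (t, s)) has_real_derivative F2 (t, s)) (at s within {0..t})"
      by (rule has_derivative_partial_snd[OF dF[rule_format]]) (use * in auto)
    then show "((\<lambda>s. k t s) has_real_derivative q t s) (at s within {0..t})" by (simp add: F_def q_def)
  qed
  moreover have "\<forall>\<^sub>F K in at_top.
      (\<forall>t s. 0 \<le> s \<longrightarrow> s \<le> t \<longrightarrow> t \<le> T \<longrightarrow> \<bar>q t s\<bar> \<le> K) \<and>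
      (\<forall>t s s'. 0 \<le> s \<longrightarrow> s \<le> s' \<longrightarrow> s' \<le> t \<longrightarrow> t \<le> T \<longrightarrow> \<bar>q t s' - q t s\<bar> \<le> K * (s' - s)) \<and>
      (\<forall>t t' s. 0 \<le> s \<longrightarrow> s \<le> t \<longrightarrow> t \<le> t' \<longrightarrow> t' \<le> T \<longrightarrow> \<bar>q t' s - q t s\<bar> \<le> K * (t' - t)) \<and>
      (\<forall>t t' s s'. 0 \<le> s \<longrightarrow> s \<le> s' \<longrightarrow> s' \<le> t \<longrightarrow> t \<le> t' \<longrightarrow> t' \<le> T \<longrightarrow>
         \<bar>(q t' s' - q t s') - (q t' s - q t s)\<bar> \<le> K * (t' - t) * (s' - s))"
    using cont[THEN eventually_abs_le[OF compact_volterra_domain]]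
  proof eventually_elim
    case (elim K)
    have snd: "((\<lambda>s. F2 (t, s)) has_real_derivative F22 (t, s)) (at s within {0..u})"
      if "s \<in> {0..u}" "u \<le> t" "t \<le> T" for t s u
      by (rule has_derivative_partial_snd[OF dF2[rule_format]]) (use that in auto)
    have fst2: "((\<lambda>t. F2 (t, s)) has_real_derivative F21 (t, s)) (at t within {s..T})"
      if "t \<in> {s..T}" "0 \<le> s" for t s
      by (rule has_derivative_partial_fst[OF dF2[rule_format]]) (use that in auto)
    have fst22: "((\<lambda>t. F22 (t, s)) has_real_derivative F221 (t, s)) (at t within {s..T})"
      if "t \<in> {s..T}" "0 \<le> s" for t s
      by (rule has_derivative_partial_fst[OF dF22[rule_format]]) (use that in auto)
    show ?case
    proof (intro conjI allI impI)
      show "\<bar>q t s\<bar> \<le> K" if "0 \<le> s" "s \<le> t" "t \<le> T" for t s using elim that by (simp add: q_def)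
      show "\<bar>q t s' - q t s\<bar> \<le> K * (s' - s)" if "0 \<le> s" "s \<le> s'" "s' \<le> t" "t \<le> T" for t s s'
        unfolding q_def by (rule real_derivative_bound[OF snd]) (use elim that in auto)
      show "\<bar>q t' s - q t s\<bar> \<le> K * (t' - t)" if "0 \<le> s" "s \<le> t" "t \<le> t'" "t' \<le> T" for t t' s
        unfolding q_def by (rule real_derivative_bound[OF fst2]) (use elim that in auto)
      fix t t' s s' assume *: "0 \<le> s" "s \<le> s'" "s' \<le> t" "t \<le> t'" "t' \<le> T"
      show "\<bar>(q t' s' - q t s') - (q t' s - q t s)\<bar> \<le> K * (t' - t) * (s' - s)"
      \<comment> \<open>On \<open>[0, t]\<close> both \<open>(t, s)\<close> and
        \<open>(t', s)\<close> lie in the triangle.\<close>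
      proof (rule real_derivative_bound[where a = 0 and b = t and f = "\<lambda>s. q t' s - q t s"
            and f' = "\<lambda>s. F22 (t', s) - F22 (t, s)"])
        fix x assume x: "x \<in> {0..t}"
        show "((\<lambda>s. q t' s - q t s) has_real_derivative F22 (t', x) - F22 (t, x)) (at x within {0..t})"
          unfolding q_def by (intro DERIV_diff snd) (use x * in auto)
        show "\<bar>F22 (t', x) - F22 (t, x)\<bar> \<le> K * (t' - t)"
          by (rule real_derivative_bound[OF fst22, of x]) (use x elim * in auto)
      qed (use * in auto)
    qed
  qed
  ultimately show ?thesis by blast
qed

lemma legendre_bounds:
  "\<forall>\<^sub>F K in at_top. \<forall>j\<in>{..M}. (\<forall>x\<in>{0..1}. \<bar>poly (P j) x\<bar> \<le> K) \<and> (\<forall>x\<in>{0..1}. \<bar>poly (pderiv (P j)) x\<bar> \<le> K) \<and>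
     1 \<le> K * legendre_weight j \<and> legendre_weight j \<le> K"
  by (intro eventually_ball_finite ballI eventually_conj eventually_abs_le eventually_mult_ge_1
      legendre_weight_pos eventually_ge_at_top compact_Icc continuous_intros finite_atMost)

section \<open>The error of the discontinuous Galerkin solution\<close>

text \<open>Everything independent of the mesh, so that \<open>K\<close> does not depend on
  \<open>h\<close>. The constant \<open>c\<close> makes \<open>c * h ^ (m + 1) * yd m\<close> at the
  left mesh point the top Legendre coefficient of the integrated error: \<open>fact m\<close> comes
  from Taylor's formula, \<open>m + 1\<close> from integration, the leading coefficient from the
  change of basis.\<close>

locale dg_problem = dg_kernel m T K q "\<lambda>t. k t t" for m T K q and k :: "real \<Rightarrow> real \<Rightarrow> real" +
  fixes g y :: "real \<Rightarrow> real" and yd :: "nat \<Rightarrow> real \<Rightarrow> real" and c :: real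
  assumes T_pos: "T > 0"
    and k_cont: "continuous_on (volterra_domain T) (\<lambda>(t, s). k t s)"
    and k_der: "\<And>t s. 0 \<le> s \<Longrightarrow> s \<le> t \<Longrightarrow> t \<le> T \<Longrightarrow> ((\<lambda>s. k t s) has_real_derivative q t s) (at s within {0..t})"
    and y_solution: "exact_solution T k g y"
    and g_cont: "continuous_on {0..T} g"
    and yd_0: "yd 0 = y"
    and yd_der: "\<And>i x. i \<le> m + 1 \<Longrightarrow> x \<in> {0..T} \<Longrightarrow> (yd i has_real_derivative yd (Suc i) x) (at x within {0..T})"
    and yd_le: "\<And>x. x \<in> {0..T} \<Longrightarrow> \<bar>yd (m + 1) x\<bar> \<le> K" "\<And>x. x \<in> {0..T} \<Longrightarrow> \<bar>yd (m + 2) x\<bar> \<le> K"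
      "\<And>x. x \<in> {0..T} \<Longrightarrow> \<bar>c * yd m x\<bar> \<le> K" "\<And>x. x \<in> {0..T} \<Longrightarrow> \<bar>c * yd (m + 1) x\<bar> \<le> K"
      "\<And>x. x \<in> {0..T} \<Longrightarrow> \<bar>c * yd (m + 2) x\<bar> \<le> K"
    and c: "c = 1 / (fact m * (real m + 1) * lead_coeff (P (m + 1)))"

text \<open>The mesh, the perturbation and the numerical solution are added on top of an already
  fixed \<open>K\<close>, which makes all later constants uniform in them.\<close>

locale dg_mesh = dg_problem m T K q k g y yd c for m T K q k g y yd c +
  fixes N :: nat and h :: real and yh \<delta> :: "real \<Rightarrow> real" and \<Delta> :: real
  assumes h: "h = mesh_width T N" "h \<le> 1" and N: "N \<ge> 2"
    and yh: "perturbed_dg_solution m T N k g \<delta> yh"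
    and \<delta>_le: "\<And>t. t \<in> {0..T} \<Longrightarrow> \<bar>\<delta> t\<bar> \<le> \<Delta>"
begin

section \<open>The integrated error and its Galerkin equations\<close>

lemma h_pos: "0 < h" and Nh: "real N * h = T"
  using T_pos N by (auto simp: h(1) mesh_width_def)

lemma mesh_pt_eq: "mesh_pt T N n = real n * h" by (simp add: mesh_pt_def h)

abbreviation "tn n x \<equiv> real n * h + h * x"

lemma tn_in: "n < N \<Longrightarrow> x \<in> {0..1} \<Longrightarrow> tn n x \<in> {0..T}"
proof -
  assume n: "n < N" and x: "x \<in> {0..1}"
  have "tn n x \<le> real n * h + h" using h_pos x by (auto simp: mult_left_le)
  also have "\<dots> = real (Suc n) * h" by (simp add: algebra_simps)
  also have "\<dots> \<le> real N * h" using n h_pos by (intro mult_right_mono) auto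
  finally show ?thesis using h_pos x Nh by auto
qed

lemma tn_Suc: "tn n 1 = real (Suc n) * h" by (simp add: algebra_simps)

lemma tn_strict: "0 < x \<Longrightarrow> x < 1 \<Longrightarrow> real n * h < tn n x \<and> tn n x < real (Suc n) * h"
  unfolding tn_Suc[symmetric] using h_pos by simp

lemma y_cont: "continuous_on {0..T} y" using y_solution by (simp add: exact_solution_def)

text \<open>A choice of the polynomial on the half-open cell. At the left mesh point it may differ
  from \<open>yh\<close>, which there belongs to the previous cell or, at \<open>0\<close>, to
  none.\<close>

definition "cell_poly n = (SOME p::real poly. degree p \<le> m - 1 \<and> (\<forall>t\<in>{real n * h<..real (Suc n) * h}. yh t = poly p t))"

lemma cell_poly:
  assumes "n < N"
  shows "degree (cell_poly n) \<le> m - 1" "t \<in> {real n * h<..real (Suc n) * h} \<Longrightarrow> yh t = poly (cell_poly n) t"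
proof -
  have "yh \<in> dg_space (m - 1) T N" using yh by (simp add: perturbed_dg_solution_def)
  then have "\<exists>p::real poly. degree p \<le> m - 1 \<and> (\<forall>t\<in>{real n * h<..real (Suc n) * h}. yh t = poly p t)"
    using assms unfolding dg_space_def mesh_pt_eq by blast
  from someI_ex[OF this, folded cell_poly_def]
  show "degree (cell_poly n) \<le> m - 1" "t \<in> {real n * h<..real (Suc n) * h} \<Longrightarrow> yh t = poly (cell_poly n) t"
    by blast+
qed

definition "e t = y t - yh t"
definition "E t = integral {0..t} e"
definition "H t = integral {0..t} (\<lambda>s. q t s * E s)"
text \<open>Equal to the residual \<open>g - volterra k yh\<close> by \<open>volterra_yh\<close>,
  but expressed through the continuous function \<open>E\<close>.\<close>

definition "R t = k t t * E t - H t"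

lemma cell_of:
  assumes "0 < s" "s < T" "s \<notin> (\<lambda>i. real i * h) ` {..N}"
  obtains n where "n < N" "real n * h < s" "s < real (Suc n) * h"
proof -
  define n where "n = nat \<lfloor>s / h\<rfloor>"
  have "real n \<le> s / h" "s / h < real n + 1" using assms h_pos unfolding n_def by (auto simp: floor_less_iff)
  then have n: "real n * h \<le> s" "s < real (Suc n) * h" using h_pos by (auto simp: field_simps)
  have "real n * h < real N * h" using n assms Nh by simp
  then have nN: "n < N" using h_pos by simp
  then have "real n * h \<noteq> s" using assms(3) by auto
  with n nN that show ?thesis by simp
qed

lemma cell_subset: "n < N \<Longrightarrow> {real n * h..real (Suc n) * h} \<subseteq> {0..T}"
  using tn_in[of n 1] h_pos unfolding tn_Suc by (auto intro: order_trans)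

lemma e_cont_cell:
  assumes "n < N" shows "continuous_on {real n * h..real (Suc n) * h} (\<lambda>t. y t - poly (cell_poly n) t)"
  by (intro continuous_intros continuous_on_subset[OF y_cont] cell_subset assms)

text \<open>On each closed cell \<open>e\<close> agrees with a continuous function except possibly
  at the left mesh point, and a single point does not affect integrability.\<close>

lemma e_integrable: "e integrable_on {0..T}"
proof -
  have "n \<le> N \<Longrightarrow> e integrable_on {0..real n * h}" for n
  proof (induction n)
    case (Suc n)
    have "(\<lambda>t. y t - poly (cell_poly n) t) integrable_on {real n * h..real (Suc n) * h}"
      using Suc.prems by (intro integrable_continuous_real e_cont_cell) simp
    then have "e integrable_on {real n * h..real (Suc n) * h}"
    proof (rule integrable_spike_finite[rotated 2])
      show "finite {real n * h}" by simp
      fix t assume "t \<in> {real n * h..real (Suc n) * h} - {real n * h}"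
      then have "t \<in> {real n * h<..real (Suc n) * h}" by auto
      then show "e t = y t - poly (cell_poly n) t" using cell_poly(2) Suc.prems by (simp add: e_def del: of_nat_Suc)
    qed
    then show ?case using Suc h_pos
      by (intro Henstock_Kurzweil_Integration.integrable_combine[of 0 "real n * h" "real (Suc n) * h"])
         (auto intro: mult_right_mono)
  qed (use integrable_on_refl[of e "0::real"] in simp)
  from this[of N] show ?thesis by (simp add: Nh)
qed

lemma E_cont: "continuous_on {0..T} E"
  unfolding E_def[abs_def] by (rule indefinite_integral_continuous_1[OF e_integrable])

lemma E_0: "E 0 = 0" by (simp add: E_def)

lemma E_der:
  assumes n: "n < N" and s: "real n * h < s" "s < real (Suc n) * h"
  shows "(E has_real_derivative e s) (at s)"
proof -
  have sT: "0 < s" "s < T"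
  proof -
    have "0 \<le> real n * h" using h_pos by simp
    then show "0 < s" using s by linarith
    have "real (Suc n) * h \<le> real N * h" using n h_pos by (intro mult_right_mono) auto
    then show "s < T" using s Nh by linarith
  qed
  have "continuous_on {real n * h<..<real (Suc n) * h} e"
    using continuous_on_subset[OF e_cont_cell[OF n], of "{real n * h<..<real (Suc n) * h}"]
    by (rule continuous_on_eq) (use cell_poly(2)[OF n] in \<open>auto simp: e_def simp del: of_nat_Suc\<close>)
  then have "continuous (at s) e"
    using s by (simp add: continuous_on_eq_continuous_at del: of_nat_Suc)
  then have "((\<lambda>u. integral {0..u} e) has_vector_derivative e s) (at s within {0..T} - {})"
    using sT by (intro integral_has_vector_derivative_continuous_at e_integrable)
      (auto intro: continuous_at_imp_continuous_at_within)
  moreover have "at s within {0..T} = at s" using sT by (rule at_within_Icc_at)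
  ultimately show ?thesis by (simp add: E_def[abs_def] has_real_derivative_iff_has_vector_derivative)
qed

text \<open>Integration by parts for \<open>k t s * E s\<close>. The exceptional mesh points are
  finitely many, and the boundary term at \<open>0\<close> vanishes with \<open>E\<close>.
  Integrability of \<open>k t s * yh s\<close> comes out as a by-product.\<close>

lemma volterra_yh:
  assumes t: "t \<in> {0..T}"
  shows "volterra k yh t = g t - R t"
proof -
  have kt: "continuous_on {0..t} (\<lambda>s. k t s)"
    using continuous_on_volterra_section[OF k_cont t] by simp
  have qt: "continuous_on {0..t} (\<lambda>s. q t s)"
    using continuous_on_volterra_section[OF q_cont t] by simp
  have sub: "{0..t} \<subseteq> {0..T}" using t by auto
  have "((\<lambda>s. q t s * E s + e s * k t s) has_integral (k t t * E t - k t 0 * E 0)) {0..t}"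
  proof (rule fundamental_theorem_of_calculus_interior_strong[where S = "(\<lambda>i. real i * h) ` {..N}"])
    show "continuous_on {0..t} (\<lambda>s. k t s * E s)"
      by (intro continuous_on_mult kt continuous_on_subset[OF E_cont sub])
    fix s assume s: "s \<in> {0<..<t} - (\<lambda>i. real i * h) ` {..N}"
    have "((\<lambda>s. k t s) has_real_derivative q t s) (at s)"
      using k_der[of s t] s t at_within_Icc_at[of 0 s t] by simp
    moreover obtain n where "n < N" "real n * h < s" "s < real (Suc n) * h"
      using s t by (elim cell_of[of s, rotated 3]) auto
    then have "(E has_real_derivative e s) (at s)" by (rule E_der)
    ultimately show "((\<lambda>s. k t s * E s) has_vector_derivative q t s * E s + e s * k t s) (at s)"
      unfolding has_real_derivative_iff_has_vector_derivative[symmetric] by (rule DERIV_mult)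
  qed (use t in auto)
  then have 1: "((\<lambda>s. q t s * E s + e s * k t s) has_integral k t t * E t) {0..t}" by (simp add: E_0)
  have 2: "((\<lambda>s. q t s * E s) has_integral H t) {0..t}"
    unfolding H_def by (intro integrable_integral integrable_continuous_real continuous_on_mult qt continuous_on_subset[OF E_cont sub])
  have 3: "((\<lambda>s. k t s * y s) has_integral g t) {0..t}"
  proof -
    have "(\<lambda>s. k t s * y s) integrable_on {0..t}"
      by (intro integrable_continuous_real continuous_on_mult kt continuous_on_subset[OF y_cont sub])
    moreover have "integral {0..t} (\<lambda>s. k t s * y s) = g t"
      using y_solution t by (simp add: exact_solution_def volterra_def)
    ultimately show ?thesis by (metis integrable_integral)
  qed
  have "((\<lambda>s. k t s * y s - ((q t s * E s + e s * k t s) - q t s * E s)) has_integral (g t - (k t t * E t - H t))) {0..t}"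
    by (intro has_integral_diff 1 2 3)
  moreover have "(\<lambda>s. k t s * y s - ((q t s * E s + e s * k t s) - q t s * E s)) = (\<lambda>s. k t s * yh s)"
    by (simp add: e_def algebra_simps)
  ultimately show ?thesis unfolding volterra_def R_def by (metis integral_unique)
qed

lemma H_cont: "continuous_on {0..T} H"
  using continuous_on_volterra[OF q_cont E_cont] by (simp add: H_def[abs_def])

lemma R_cont: "continuous_on {0..T} R"
  unfolding R_def[abs_def] by (intro continuous_intros \<kappa>_cont E_cont H_cont)

lemma \<Delta>_nonneg: "0 \<le> \<Delta>" using \<delta>_le[of 0] T_pos by force

text \<open>The defining equation makes the moments of \<open>R\<close> and of
  \<open>\<delta>\<close> equal up to sign. In the cell coordinate both carry a factor
  \<open>h\<close>, the cell length, which cancels.\<close>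

lemma galerkin_R:
  assumes n: "n < N" and j: "j < m"
  shows "\<bar>integral {0..1} (\<lambda>x. poly (P j) x * R (tn n x))\<bar> \<le> K * \<Delta>"
proof -
  let ?I = "{real n * h..real (Suc n) * h}"
  \<comment> \<open>One polynomial on the whole line, not cut off outside the cell: the
    \<open>n\<close>-th equation sees only its own cell, and membership in the trial space is
    immediate.\<close>
  define \<phi> where "\<phi> = poly (pcompose (P j) [:- real n, 1 / h:])"
  have "poly [:- real n, 1 / h:] s = s / h - real n" for s by simp
  then have \<phi>: "\<phi> s = poly (P j) (s / h - real n)" for s
    by (simp only: \<phi>_def poly_pcompose)
  have "degree (pcompose (P j) [:- real n, 1 / h:]) \<le> m - 1"
    using j h_pos by (simp add: degree_pcompose)
  then have "\<phi> \<in> dg_space (m - 1) T N" unfolding dg_space_def \<phi>_def by blast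
  then have eq: "integral ?I (\<lambda>s. volterra k yh s * \<phi> s) = integral ?I (\<lambda>s. g s * \<phi> s) + integral ?I (\<lambda>s. \<delta> s * \<phi> s)"
    using yh n unfolding perturbed_dg_solution_def mesh_pt_eq by blast
  have \<phi>_cont: "continuous_on A \<phi>" for A unfolding \<phi>_def by (intro continuous_intros)
  note sub = cell_subset[OF n]
  have gi: "(\<lambda>s. g s * \<phi> s) integrable_on ?I" and Ri: "(\<lambda>s. R s * \<phi> s) integrable_on ?I"
    by (intro integrable_continuous_real continuous_on_mult \<phi>_cont continuous_on_subset[OF g_cont sub]
        continuous_on_subset[OF R_cont sub])+
  have "integral ?I (\<lambda>s. volterra k yh s * \<phi> s) = integral ?I (\<lambda>s. g s * \<phi> s - R s * \<phi> s)"
    using sub by (intro integral_cong) (auto simp: volterra_yh left_diff_distrib)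
  also have "\<dots> = integral ?I (\<lambda>s. g s * \<phi> s) - integral ?I (\<lambda>s. R s * \<phi> s)"
    by (rule Henstock_Kurzweil_Integration.integral_diff[OF gi Ri])
  finally have 1: "integral ?I (\<lambda>s. R s * \<phi> s) = - integral ?I (\<lambda>s. \<delta> s * \<phi> s)" using eq by simp
  have len: "measure lborel (cbox (real n * h) (real (Suc n) * h)) = h"
  proof -
    have *: "real (Suc n) * h - real n * h = h" by (simp add: algebra_simps)
    then have "real n * h \<le> real (Suc n) * h" using h_pos by linarith
    from measure_lborel_Icc[OF this] show ?thesis unfolding * cbox_interval .
  qed
  have 2: "\<bar>integral ?I (\<lambda>s. \<delta> s * \<phi> s)\<bar> \<le> \<Delta> * K * h"
  proof (cases "(\<lambda>s. \<delta> s * \<phi> s) integrable_on ?I")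
    case True
    then have "((\<lambda>s. \<delta> s * \<phi> s) has_integral integral ?I (\<lambda>s. \<delta> s * \<phi> s)) (cbox (real n * h) (real (Suc n) * h))"
      by (simp add: integrable_integral del: of_nat_Suc)
    moreover have "norm (\<delta> s * \<phi> s) \<le> \<Delta> * K" if s: "s \<in> cbox (real n * h) (real (Suc n) * h)" for s
    proof -
      have "real n * h \<le> s" "s \<le> real (Suc n) * h" using s unfolding cbox_interval by auto
      then have "real n \<le> s / h" "s / h \<le> real (Suc n)"
        using h_pos by (simp_all only: pos_le_divide_eq pos_divide_le_eq)
      then have "s / h - real n \<in> {0..1}" by simp
      then show ?thesis unfolding real_norm_def abs_mult \<phi>
        using s sub j by (intro mult_mono \<delta>_le P_le \<Delta>_nonneg) auto
    qed
    ultimately have "norm (integral ?I (\<lambda>s. \<delta> s * \<phi> s)) \<le> \<Delta> * K * measure lborel (cbox (real n * h) (real (Suc n) * h))"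
      using \<Delta>_nonneg K by (intro has_integral_bound) auto
    then show ?thesis unfolding len by simp
  next
    case False \<comment> \<open>then the integral is \<open>0\<close> by convention\<close>
    then show ?thesis using \<Delta>_nonneg K h_pos by (simp add: not_integrable_integral del: of_nat_Suc)
  qed
  have "integral ?I (\<lambda>s. R s * \<phi> s) = h * integral {0..1} (\<lambda>x. R (tn n x) * \<phi> (tn n x))"
    unfolding tn_Suc[symmetric] using h_pos
    by (intro integral_affine continuous_on_mult \<phi>_cont continuous_on_subset[OF R_cont] sub[folded tn_Suc]) auto
  also have "(\<lambda>x. R (tn n x) * \<phi> (tn n x)) = (\<lambda>x. poly (P j) x * R (tn n x))"
  proof
    fix x
    have "tn n x / h - real n = x" using h_pos by (simp add: add_divide_distrib)
    then show "R (tn n x) * \<phi> (tn n x) = poly (P j) x * R (tn n x)" by (simp only: \<phi> mult.commute)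
  qed
  finally have 3: "integral ?I (\<lambda>s. R s * \<phi> s) = h * integral {0..1} (\<lambda>x. poly (P j) x * R (tn n x))" .
  have "h * \<bar>integral {0..1} (\<lambda>x. poly (P j) x * R (tn n x))\<bar> = \<bar>h * integral {0..1} (\<lambda>x. poly (P j) x * R (tn n x))\<bar>"
    by (simp only: abs_mult abs_of_pos[OF h_pos])
  also have "\<dots> \<le> \<Delta> * K * h" using 2 unfolding 3[symmetric] 1 by linarith
  also have "\<dots> = h * (K * \<Delta>)" by simp
  finally show ?thesis using h_pos by (rule mult_left_le_imp_le)
qed

section \<open>Local expansion of the integrated error\<close>

definition "error_poly n = (\<Sum>i\<le>m. monom (yd i (real n * h) * h ^ i / fact i) i) - pcompose (cell_poly n) [:real n * h, h:]"
definition "r n x = y (tn n x) - (\<Sum>i\<le>m. yd i (real n * h) * (h * x) ^ i / fact i)"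
text \<open>In the cell coordinate \<open>E\<close> has the derivative \<open>h * e\<close>, hence
  the factor \<open>h\<close>. The initial value makes \<open>\<rho> n\<close> vanish at the left
  end of the cell.\<close>

definition "A n = (SOME A. pderiv A = smult h (error_poly n) \<and> poly A 0 = E (real n * h) \<and> degree A \<le> m + 1)"
definition "a n = (SOME a. A n = (\<Sum>j\<le>m + 1. smult (a j) (P j)) \<and> a (m + 1) = coeff (A n) (m + 1) / lead_coeff (P (m + 1)))"
definition "\<rho> n x = E (tn n x) - poly (A n) x"

lemma degree_pcompose_cell:
  "n < N \<Longrightarrow> degree (pcompose (cell_poly n) [:real n * h, h:]) < m"
  using cell_poly(1)[of n] m h_pos by (simp add: degree_pcompose)

lemma degree_error_poly: "n < N \<Longrightarrow> degree (error_poly n) \<le> m"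
  unfolding error_poly_def using degree_pcompose_cell[of n]
  by (intro degree_diff_le degree_sum_le) (auto intro: order_trans[OF degree_monom_le])

text \<open>On the cell \<open>yh\<close> has degree below \<open>m\<close>, so this coefficient
  comes from the Taylor polynomial of \<open>y\<close> alone. That is why \<open>b\<close> does not
  depend on the numerical solution.\<close>

lemma coeff_error_poly: "n < N \<Longrightarrow> coeff (error_poly n) m = yd m (real n * h) * h ^ m / fact m"
  unfolding error_poly_def using degree_pcompose_cell[of n]
  by (simp add: coeff_sum coeff_eq_0 sum.delta)

lemma A_props:
  assumes "n < N"
  shows "pderiv (A n) = smult h (error_poly n)" "poly (A n) 0 = E (real n * h)" "degree (A n) \<le> m + 1"
proof -
  obtain B where "pderiv B = smult h (error_poly n)" "poly B 0 = E (real n * h)" "degree B \<le> Suc (degree (smult h (error_poly n)))"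
    by (rule poly_antiderivative)
  moreover have "degree (smult h (error_poly n)) \<le> m" using degree_error_poly[OF assms] h_pos by simp
  ultimately have "\<exists>A. pderiv A = smult h (error_poly n) \<and> poly A 0 = E (real n * h) \<and> degree A \<le> m + 1"
    by (intro exI[of _ B]) auto
  from someI_ex[OF this, folded A_def]
  show "pderiv (A n) = smult h (error_poly n)" "poly (A n) 0 = E (real n * h)" "degree (A n) \<le> m + 1" by blast+
qed

lemma a_props:
  assumes "n < N"
  shows "A n = (\<Sum>j\<le>m + 1. smult (a n j) (P j))"
    and "a n (m + 1) = c * h ^ (m + 1) * yd m (real n * h)"
proof -
  note ex = someI_ex[OF legendre_expansion[OF A_props(3)[OF assms]], folded a_def]
  then show "A n = (\<Sum>j\<le>m + 1. smult (a n j) (P j))" by blast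
  have "coeff (pderiv (A n)) m = real (m + 1) * coeff (A n) (m + 1)" by (simp add: coeff_pderiv)
  then have eq: "real (m + 1) * coeff (A n) (m + 1) = h * (yd m (real n * h) * h ^ m / fact m)"
    unfolding A_props(1)[OF assms] by (simp add: coeff_error_poly[OF assms])
  have "coeff (A n) (m + 1) = real (m + 1) * coeff (A n) (m + 1) / real (m + 1)"
    by (rule nonzero_mult_div_cancel_left[symmetric]) simp
  then have "coeff (A n) (m + 1) = h * (yd m (real n * h) * h ^ m / fact m) / real (m + 1)"
    unfolding eq .
  moreover have "a n (m + 1) = coeff (A n) (m + 1) / lead_coeff (P (m + 1))" using ex by blast
  moreover have "(h * (v * u / f) / M) / L = 1 / (f * M * L) * (h * u) * v" for v u f M L :: real
    by (simp add: divide_inverse mult_ac)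
  ultimately have "a n (m + 1) = 1 / (fact m * real (m + 1) * lead_coeff (P (m + 1))) * (h * h ^ m) * yd m (real n * h)"
    by presburger
  moreover have "real (m + 1) = real m + 1" "h * h ^ m = h ^ (m + 1)" by simp_all
  ultimately show "a n (m + 1) = c * h ^ (m + 1) * yd m (real n * h)" unfolding c by presburger
qed

lemma e_rep:
  assumes n: "n < N" and x: "0 < x" "x \<le> 1"
  shows "e (tn n x) = poly (error_poly n) x + r n x"
proof -
  have "tn n x \<in> {real n * h<..real (Suc n) * h}"
    unfolding tn_Suc[symmetric] using h_pos x by (auto simp: mult_left_le)
  then have "yh (tn n x) = poly (cell_poly n) (tn n x)" by (rule cell_poly(2)[OF n])
  moreover have "poly (error_poly n) x = (\<Sum>i\<le>m. yd i (real n * h) * (h * x) ^ i / fact i) - poly (cell_poly n) (tn n x)"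
    by (simp add: error_poly_def poly_sum poly_monom poly_pcompose power_mult_distrib mult_ac)
  ultimately show ?thesis by (simp add: e_def r_def)
qed

lemma cell_in:
  assumes "n < N" "\<xi> \<in> {0..h}" shows "real n * h + \<xi> \<in> {0..T}"
proof -
  have "real (Suc n) * h = real n * h + h" by (simp add: algebra_simps)
  then have "real n * h + \<xi> \<in> {real n * h..real (Suc n) * h}" using assms(2) by simp
  then show ?thesis using cell_subset[OF assms(1)] by blast
qed

lemma yd_shift_der:
  assumes "n < N" "i \<le> m + 1" "\<xi> \<in> {0..h}"
  shows "((\<lambda>\<xi>. yd i (real n * h + \<xi>)) has_real_derivative yd (Suc i) (real n * h + \<xi>)) (at \<xi> within {0..h})"
proof (rule has_real_derivative_shift)
  have sub: "(+) (real n * h) ` {0..h} \<subseteq> {0..T}"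
    using cell_in[OF assms(1)] by blast
  then show "(+) (real n * h) ` {0..h} \<subseteq> {0..T}" .
  show "(yd i has_real_derivative yd (Suc i) (real n * h + \<xi>)) (at (real n * h + \<xi>) within {0..T})"
    using sub assms by (intro yd_der) auto
qed

lemma taylor_power_le:
  assumes "x \<in> {0..1}" "0 \<le> B"
  shows "B * norm (h * x - 0) ^ Suc m / fact m \<le> B * h ^ (m + 1)"
proof -
  have "norm (h * x - 0) = h * x" using assms h_pos by simp
  moreover have "h * x \<le> h" "0 \<le> h * x" using assms h_pos by (simp_all add: mult_left_le)
  ultimately have "norm (h * x - 0) ^ Suc m \<le> h ^ (m + 1)"
    unfolding Suc_eq_plus1 using power_mono[of "h * x" h "m + 1"] by simp
  then have "B * norm (h * x - 0) ^ Suc m \<le> B * h ^ (m + 1)" using assms by (intro mult_left_mono) auto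
  moreover have "B * norm (h * x - 0) ^ Suc m / fact m \<le> B * norm (h * x - 0) ^ Suc m"
  proof -
    have "0 \<le> B * norm (h * x - 0) ^ Suc m" using assms by (intro mult_nonneg_nonneg) auto
    from divide_left_mono[OF fact_ge_1[of m] this] show ?thesis by simp
  qed
  ultimately show ?thesis by linarith
qed

lemma r_le:
  assumes n: "n < N" and x: "x \<in> {0..1}"
  shows "\<bar>r n x\<bar> \<le> K * h ^ (m + 1)"
proof -
  have hx: "h * x \<in> {0..h}" using x h_pos by (auto simp: mult_left_le)
  have "norm (yd 0 (real n * h + h * x) - (\<Sum>i\<le>m. yd i (real n * h + 0) * (h * x - 0) ^ i / fact i))
    \<le> K * norm (h * x - 0) ^ Suc m / fact m"
    by (rule field_Taylor[where S = "{0..h}" and f = "\<lambda>i \<xi>. yd i (real n * h + \<xi>)"])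
       (use yd_shift_der[OF n] yd_le(1)[OF cell_in[OF n]] hx h_pos in auto)
  also have "\<dots> \<le> K * h ^ (m + 1)" using x K by (intro taylor_power_le) auto
  finally show ?thesis by (simp add: r_def yd_0)
qed

text \<open>Taylor's formula for the difference \<open>W\<close> of two copies of \<open>y\<close> a
  distance \<open>h\<close> apart: its derivative of order \<open>m + 1\<close> is of order
  \<open>h\<close>, because that of \<open>y\<close> of order \<open>m + 2\<close> is
  bounded.\<close>

lemma r_diff_le:
  assumes n: "Suc n < N" and x: "x \<in> {0..1}"
  shows "\<bar>r (Suc n) x - r n x\<bar> \<le> K * h ^ (m + 2)"
proof -
  have nN: "n < N" using n by simp
  have hx: "h * x \<in> {0..h}" using x h_pos by (auto simp: mult_left_le)
  define W where "W i \<xi> = yd i (real (Suc n) * h + \<xi>) - yd i (real n * h + \<xi>)" for i \<xi>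
  have "norm (W 0 (h * x) - (\<Sum>i\<le>m. W i 0 * (h * x - 0) ^ i / fact i))
    \<le> (K * h) * norm (h * x - 0) ^ Suc m / fact m"
  proof (rule field_Taylor[where S = "{0..h}"])
    show "(W i has_real_derivative W (Suc i) \<xi>) (at \<xi> within {0..h})" if "\<xi> \<in> {0..h}" "i \<le> m" for i \<xi>
      unfolding W_def[abs_def] using that by (intro DERIV_diff yd_shift_der n nN) auto
    show "norm (W (Suc m) \<xi>) \<le> K * h" if \<xi>: "\<xi> \<in> {0..h}" for \<xi>
    proof -
      have eq: "real (Suc n) * h + \<xi> - (real n * h + \<xi>) = h" by (simp add: algebra_simps)
      have "\<bar>yd (Suc m) (real (Suc n) * h + \<xi>) - yd (Suc m) (real n * h + \<xi>)\<bar>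
        \<le> K * (real (Suc n) * h + \<xi> - (real n * h + \<xi>))"
      proof (rule real_derivative_bound[where a = 0 and b = T])
        show "(yd (Suc m) has_real_derivative yd (m + 2) x) (at x within {0..T})" if "x \<in> {0..T}" for x
          using yd_der[of "Suc m" x] that by simp
        show "\<bar>yd (m + 2) x\<bar> \<le> K" if "x \<in> {0..T}" for x using yd_le(2)[OF that] .
        show "real n * h + \<xi> \<le> real (Suc n) * h + \<xi>" using eq h_pos by linarith
      qed (use cell_in[OF n \<xi>] cell_in[OF nN \<xi>] in auto)
      then show ?thesis unfolding eq by (simp add: W_def del: of_nat_Suc)
    qed
  qed (use hx h_pos in auto)
  also have "\<dots> \<le> (K * h) * h ^ (m + 1)" using x K h_pos by (intro taylor_power_le) auto
  also have "\<dots> = K * h ^ (m + 2)" by simp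
  also have "W 0 (h * x) - (\<Sum>i\<le>m. W i 0 * (h * x - 0) ^ i / fact i) = r (Suc n) x - r n x"
    unfolding W_def r_def yd_0 by (simp add: left_diff_distrib diff_divide_distrib sum_subtractf del: of_nat_Suc)
  finally show ?thesis by simp
qed

lemma \<rho>_der:
  assumes n: "n < N" and x: "0 < x" "x < 1"
  shows "(\<rho> n has_real_derivative h * r n x) (at x)"
proof -
  have "(E has_real_derivative e (tn n x)) (at (tn n x))"
    using tn_strict[OF x, of n] by (intro E_der[OF n]) auto
  moreover have "((\<lambda>x. tn n x) has_real_derivative h) (at x)" by (auto intro!: derivative_eq_intros)
  ultimately have "((\<lambda>x. E (tn n x)) has_real_derivative e (tn n x) * h) (at x)" by (rule DERIV_chain2)
  then have "(\<rho> n has_real_derivative e (tn n x) * h - poly (pderiv (A n)) x) (at x)"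
    unfolding \<rho>_def[abs_def] by (intro DERIV_diff poly_DERIV)
  moreover have "e (tn n x) * h - poly (pderiv (A n)) x = h * r n x"
    unfolding A_props(1)[OF n] e_rep[OF n x(1) less_imp_le[OF x(2)]] by (simp add: algebra_simps)
  ultimately show ?thesis by simp
qed

lemma \<rho>_cont: "n < N \<Longrightarrow> continuous_on {0..1} (\<rho> n)"
  unfolding \<rho>_def[abs_def]
  by (intro continuous_intros continuous_on_compose2[OF E_cont]) (use tn_in in auto)

lemma \<rho>_zero: "n < N \<Longrightarrow> \<rho> n 0 = 0" by (simp add: \<rho>_def A_props)

lemma h_mult_power: "h * (K * h ^ (m + 1)) = K * h ^ (m + 2)" "h * (K * h ^ (m + 2)) = K * h ^ (m + 3)"
  by (simp_all add: power_add power2_eq_square power3_eq_cube)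

text \<open>\<open>\<rho> n\<close> vanishes at the left end and has the derivative
  \<open>h * r n\<close>, so its bounds are \<open>h\<close> times those of \<open>r n\<close>. The
  bounds on the top coefficient are those on \<open>c * yd m\<close> and its first two
  derivatives.\<close>

lemma is_dg_error: "dg_error m T K q (\<lambda>t. k t t) N h E a \<rho> \<Delta>"
proof unfold_locales
  show "0 < h" "h \<le> 1" "real N * h = T" "0 \<le> \<Delta>" "continuous_on {0..T} E" "E 0 = 0"
    by (rule h_pos h Nh \<Delta>_nonneg E_cont E_0)+
  show "E (real n * h + h * x) = (\<Sum>j\<le>m + 1. a n j * poly (P j) x) + \<rho> n x" if "n < N" "x \<in> {0..1}" for n x
    using arg_cong[OF a_props(1)[OF that(1)], of "\<lambda>p. poly p x"] by (simp add: \<rho>_def poly_sum)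
  show "\<rho> n 0 = 0" if "n < N" for n using that by (rule \<rho>_zero)
  show "\<bar>\<rho> n x\<bar> \<le> K * h ^ (m + 2)" if "n < N" "x \<in> {0..1}" for n x
    unfolding h_mult_power(1)[symmetric]
  proof (rule interior_derivative_bound[where f = "\<rho> n" and x = x and f' = "\<lambda>x. h * r n x"])
    show "continuous_on {0..1} (\<rho> n)" "\<rho> n 0 = 0" using that by (simp_all add: \<rho>_cont \<rho>_zero)
    fix z :: real assume z: "0 < z" "z < 1"
    show "(\<rho> n has_real_derivative h * r n z) (at z)" by (rule \<rho>_der[OF that(1) z])
    show "\<bar>h * r n z\<bar> \<le> h * (K * h ^ (m + 1))"
      using r_le[OF that(1), of z] z h_pos by (simp add: abs_mult del: power_Suc)
  qed (use that K h_pos in auto)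
  show "\<bar>\<rho> (Suc n) x - \<rho> n x\<bar> \<le> K * h ^ (m + 3)" if n: "Suc n < N" and x: "x \<in> {0..1}" for n x
    unfolding h_mult_power(2)[symmetric]
  proof (rule interior_derivative_bound[where f = "\<lambda>x. \<rho> (Suc n) x - \<rho> n x" and x = x
        and f' = "\<lambda>x. h * r (Suc n) x - h * r n x"])
    show "continuous_on {0..1} (\<lambda>x. \<rho> (Suc n) x - \<rho> n x)" using n by (intro continuous_on_diff \<rho>_cont) auto
    show "\<rho> (Suc n) 0 - \<rho> n 0 = 0" using n by (simp add: \<rho>_zero)
    fix z :: real assume z: "0 < z" "z < 1"
    show "((\<lambda>x. \<rho> (Suc n) x - \<rho> n x) has_real_derivative h * r (Suc n) z - h * r n z) (at z)"
      using n z by (intro DERIV_diff \<rho>_der) auto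
    have "\<bar>h * r (Suc n) z - h * r n z\<bar> = h * \<bar>r (Suc n) z - r n z\<bar>"
      using h_pos by (simp add: abs_mult flip: right_diff_distrib)
    also have "\<dots> \<le> h * (K * h ^ (m + 2))"
      using r_diff_le[OF n, of z] z h_pos by (intro mult_left_mono) auto
    finally show "\<bar>h * r (Suc n) z - h * r n z\<bar> \<le> h * (K * h ^ (m + 2))" .
  qed (use x K h_pos in auto)
  have in0: "real n * h \<in> {0..T}" if "n < N" for n using tn_in[OF that, of 0] by simp
  have dc: "((\<lambda>t. c * yd i t) has_real_derivative c * yd (Suc i) t) (at t within {0..T})" if "i \<le> m + 1" "t \<in> {0..T}" for i t
    by (intro DERIV_cmult yd_der that)
  have lip: "\<bar>c * yd (m + i) t' - c * yd (m + i) t\<bar> \<le> K * (t' - t)" if "i \<in> {0, 1}" "0 \<le> t" "t \<le> t'" "t' \<le> T" for i t t'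
    by (rule real_derivative_bound[where f = "\<lambda>t. c * yd (m + i) t" and x = t and y = t' and a = 0 and b = T, OF dc])
       (use that yd_le in auto)
  show "\<bar>a n (m + 1)\<bar> \<le> K * h ^ (m + 1)" if n: "n < N" for n
  proof -
    have "\<bar>a n (m + 1)\<bar> = \<bar>c * yd m (real n * h)\<bar> * h ^ (m + 1)"
      unfolding a_props(2)[OF n] using h_pos by (simp add: abs_mult)
    also have "\<dots> \<le> K * h ^ (m + 1)" using yd_le(3)[OF in0[OF n]] h_pos by (intro mult_right_mono) auto
    finally show ?thesis .
  qed
  have step: "real (Suc n) * h = real n * h + h" for n by (simp add: algebra_simps)
  show "\<bar>a (Suc n) (m + 1) - a n (m + 1)\<bar> \<le> K * h ^ (m + 2)" if n: "Suc n < N" for n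
  proof -
    have nN: "n < N" using n by simp
    have "a (Suc n) (m + 1) - a n (m + 1) = (c * yd m (real n * h + h) - c * yd m (real n * h)) * h ^ (m + 1)"
      unfolding a_props(2)[OF n] a_props(2)[OF nN] step by (simp add: algebra_simps)
    also have "\<bar>\<dots>\<bar> \<le> (K * (real n * h + h - real n * h)) * h ^ (m + 1)"
      unfolding abs_mult using lip[of 0 "real n * h" "real n * h + h"] in0[OF n] in0[OF nN] h_pos unfolding step
      by (intro mult_mono) auto
    also have "\<dots> = K * h ^ (m + 2)" by simp
    finally show ?thesis .
  qed
  show "\<bar>a (Suc (Suc n)) (m + 1) - 2 * a (Suc n) (m + 1) + a n (m + 1)\<bar> \<le> K * h ^ (m + 3)" if n: "Suc (Suc n) < N" for n
  proof -
    have nN: "Suc n < N" "n < N" using n by auto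
    have "\<bar>(c * yd m (real n * h + h + h) - c * yd m (real n * h + h)) - (c * yd m (real n * h + h) - c * yd m (real n * h))\<bar>
      \<le> K * (real n * h + h - real n * h) * h"
      by (rule second_difference_le[where f' = "\<lambda>t. c * yd (Suc m) t" and T = T])
         (use dc[of m] lip[of 1] in0[OF n] in0[OF nN(2)] h_pos in \<open>auto simp: step simp del: of_nat_Suc\<close>)
    moreover have "a (Suc (Suc n)) (m + 1) - 2 * a (Suc n) (m + 1) + a n (m + 1)
      = ((c * yd m (real n * h + h + h) - c * yd m (real n * h + h)) - (c * yd m (real n * h + h) - c * yd m (real n * h))) * h ^ (m + 1)"
      unfolding a_props(2)[OF n] a_props(2)[OF nN(1)] a_props(2)[OF nN(2)] step by (simp add: algebra_simps)
    ultimately have "\<bar>a (Suc (Suc n)) (m + 1) - 2 * a (Suc n) (m + 1) + a n (m + 1)\<bar> \<le> (K * (real n * h + h - real n * h) * h) * h ^ (m + 1)"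
      using h_pos by (simp add: abs_mult mult_right_mono)
    also have "\<dots> = K * h ^ (m + 3)" by (simp add: power_add power3_eq_cube)
    finally show ?thesis .
  qed
  show "\<bar>integral {0..1} (\<lambda>x. poly (P j) x *
          (k (real n * h + h * x) (real n * h + h * x) * E (real n * h + h * x)
            - integral {0..real n * h + h * x} (\<lambda>s. q (real n * h + h * x) s * E s)))\<bar> \<le> K * \<Delta>" if "n < N" "j < m" for n j
    using galerkin_R[OF that] by (simp add: R_def H_def)
qed

lemma error_rep:
  assumes n: "n < N" and x: "0 < x" "x < 1"
  shows "\<bar>h * e (tn n x) - (\<Sum>j\<le>m + 1. a n j * poly (pderiv (P j)) x)\<bar> \<le> K * h ^ (m + 2)"
proof -
  have "poly (pderiv (A n)) x = (\<Sum>j\<le>m + 1. a n j * poly (pderiv (P j)) x)"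
    by (subst a_props(1)[OF n]) (simp add: pderiv_sum pderiv_smult poly_sum pderiv_add)
  then have "h * e (tn n x) - (\<Sum>j\<le>m + 1. a n j * poly (pderiv (P j)) x) = h * r n x"
    unfolding A_props(1)[OF n] e_rep[OF n x(1) less_imp_le[OF x(2)]] by (simp add: algebra_simps)
  then show ?thesis using r_le[OF n, of x] x h_pos
    by (simp add: abs_mult mult_left_mono flip: h_mult_power(1))
qed

end

section \<open>Superconvergence\<close>

text \<open>\<open>coupled_gronwall\<close> with \<open>x = d\<close> and \<open>y = lam\<close>;
  the constant \<open>8 * K ^ 9\<close> of \<open>lam_le\<close> also dominates those of the other
  two recursions. The defect \<open>e\<close> is left free because it depends on the parity of
  \<open>m\<close>.\<close>

lemma (in dg_kernel) stability:
  assumes T: "0 \<le> T"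
  shows "\<exists>C h0. h0 > 0 \<and> (\<forall>N h E a \<rho> \<Delta> e. dg_error m T K q \<kappa> N h E a \<rho> \<Delta> \<longrightarrow> h \<le> h0 \<longrightarrow>
    h ^ (m + 2) \<le> e \<longrightarrow> \<Delta> \<le> e \<longrightarrow>
    (\<forall>n. Suc n < N \<longrightarrow> \<bar>a n (m + 1) + (- 1) ^ m * a (Suc n) (m + 1)\<bar> \<le> 2 * K * e) \<longrightarrow>
    (\<forall>n<N. h * \<bar>a n m\<bar> \<le> C * e \<and> (\<Sum>j<m. \<bar>a n j\<bar>) \<le> C * e))"
proof -
  have "0 \<le> 8 * K ^ 9" using K by simp
  from coupled_gronwall[OF this T] obtain C h0 where h0: "h0 > 0" and gr:
    "\<forall>N h e. \<forall>x y :: nat \<Rightarrow> real.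
     0 < h \<longrightarrow> h \<le> h0 \<longrightarrow> real N * h \<le> T \<longrightarrow> 0 \<le> e \<longrightarrow> (\<forall>n. 0 \<le> x n) \<longrightarrow> (\<forall>n. 0 \<le> y n) \<longrightarrow>
     (\<forall>n<N. y n \<le> 8 * K ^ 9 * (e + h * (y n + x n) + h * (\<Sum>l<n. y l + h * x l))) \<longrightarrow>
     (\<forall>n. Suc n < N \<longrightarrow> x (Suc n) \<le> x n + 8 * K ^ 9 * (e + y n + y (Suc n))) \<longrightarrow>
     h * x 0 \<le> 8 * K ^ 9 * (e + h * y 0) \<longrightarrow>
     (\<forall>n<N. h * x n \<le> C * e \<and> y n \<le> C * e)" by blast
  have K9: "1 \<le> K ^ 9" "K \<le> K ^ 9" using K one_le_power[of K] power_increasing[of 1 9 K] by auto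
  show ?thesis
  proof (rule exI[of _ C], rule exI[of _ h0], intro conjI allI impI)
    fix N h E a \<rho> \<Delta> e n
    assume "dg_error m T K q \<kappa> N h E a \<rho> \<Delta>"
    then interpret dg_error m T K q \<kappa> N h E a \<rho> \<Delta> .
    assume hh: "h \<le> h0" and e: "h ^ (m + 2) \<le> e" "\<Delta> \<le> e"
      and b: "\<forall>n. Suc n < N \<longrightarrow> \<bar>a n (m + 1) + (- 1) ^ m * a (Suc n) (m + 1)\<bar> \<le> 2 * K * e"
      and n: "n < N"
    have e0: "0 \<le> e" using \<Delta> e by linarith
    have "h * \<bar>a n m\<bar> \<le> C * e \<and> lam n \<le> C * e"
    proof (rule gr[rule_format, where x = "\<lambda>n. \<bar>a n m\<bar>" and y = lam])
      show "lam n \<le> 8 * K ^ 9 * (e + h * (lam n + \<bar>a n m\<bar>) + h * (\<Sum>l<n. lam l + h * \<bar>a l m\<bar>))" if "n < N" for n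
        by (rule lam_le[OF that e])
      show "\<bar>a (Suc n) m\<bar> \<le> \<bar>a n m\<bar> + 8 * K ^ 9 * (e + lam n + lam (Suc n))" if n: "Suc n < N" for n
      proof -
        have "\<bar>a (Suc n) m\<bar> \<le> \<bar>a n m\<bar> + 3 * K * (e + lam n + lam (Suc n))"
          using coefficient_step[OF n e(1)] b n by blast
        also have "\<dots> \<le> \<bar>a n m\<bar> + 8 * K ^ 9 * (e + lam n + lam (Suc n))"
          using K K9 e0 lam_nonneg[of n] lam_nonneg[of "Suc n"] by (intro add_left_mono mult_right_mono) auto
        finally show "\<bar>a (Suc n) m\<bar> \<le> \<bar>a n m\<bar> + 8 * K ^ 9 * (e + lam n + lam (Suc n))" .
      qed
      have N: "0 < N" using n by simp
      have "h * \<bar>a 0 m\<bar> \<le> h * (\<bar>a 0 (m + 1)\<bar> + lam 0)" using initial_coefficient_le[OF N] h by (intro mult_left_mono) auto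
      also have "\<dots> = h * \<bar>a 0 (m + 1)\<bar> + h * lam 0" by (rule distrib_left)
      also have "\<dots> \<le> K * e + h * lam 0"
      proof -
        have "K * h ^ (m + 2) \<le> K * e" using K e by (intro mult_left_mono) auto
        then show ?thesis using h_b_le[OF N] by linarith
      qed
      also have "\<dots> \<le> 8 * K ^ 9 * e + 8 * K ^ 9 * (h * lam 0)"
      proof (rule add_mono)
        show "K * e \<le> 8 * K ^ 9 * e" using K9 K e0 by (intro mult_right_mono) auto
        have "1 * (h * lam 0) \<le> 8 * K ^ 9 * (h * lam 0)" using K9 h lam_nonneg[of 0] by (intro mult_right_mono) auto
        then show "h * lam 0 \<le> 8 * K ^ 9 * (h * lam 0)" by simp
      qed
      also have "\<dots> = 8 * K ^ 9 * (e + h * lam 0)" by (simp only: distrib_left)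
      finally show "h * \<bar>a 0 m\<bar> \<le> 8 * K ^ 9 * (e + h * lam 0)" .
    qed (use h hh Nh e0 lam_nonneg n in auto)
    then show "h * \<bar>a n m\<bar> \<le> C * e" "(\<Sum>j<m. \<bar>a n j\<bar>) \<le> C * e" by (auto simp: lam_def)
  qed (rule h0)
qed

text \<open>\<open>stability\<close> supplies the a priori bound for
  \<open>coefficient_two_step\<close>, whose smaller defect \<open>e2\<close> goes into
  \<open>two_step_gronwall\<close>. The vanishing of \<open>a 0 (m + 1)\<close> provides the
  starting values.\<close>

lemma (in dg_kernel) odd_stability:
  assumes T: "0 \<le> T" and odd: "odd m"
  shows "\<exists>C h0. h0 > 0 \<and> (\<forall>N h E a \<rho> \<Delta>. dg_error m T K q \<kappa> N h E a \<rho> \<Delta> \<longrightarrow> h \<le> h0 \<longrightarrow> 2 \<le> N \<longrightarrow>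
    a 0 (m + 1) = 0 \<longrightarrow>
    (\<forall>n<N. h * \<bar>a n m\<bar> \<le> C * (\<Delta> + h ^ (m + 3)) \<and> (\<Sum>j<m. \<bar>a n j\<bar>) \<le> C * (\<Delta> + h ^ (m + 2))))"
proof -
  from stability[OF T] obtain C1 h1 where h1: "h1 > 0" and st: "\<forall>N h E a \<rho> \<Delta> e.
    dg_error m T K q \<kappa> N h E a \<rho> \<Delta> \<longrightarrow> h \<le> h1 \<longrightarrow> h ^ (m + 2) \<le> e \<longrightarrow> \<Delta> \<le> e \<longrightarrow>
    (\<forall>n. Suc n < N \<longrightarrow> \<bar>a n (m + 1) + (- 1) ^ m * a (Suc n) (m + 1)\<bar> \<le> 2 * K * e) \<longrightarrow>
    (\<forall>n<N. h * \<bar>a n m\<bar> \<le> C1 * e \<and> (\<Sum>j<m. \<bar>a n j\<bar>) \<le> C1 * e)" by blast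
  define Q where "Q = max K C1"
  have Q: "K \<le> Q" "C1 \<le> Q" "1 \<le> Q" using K by (auto simp: Q_def)
  then have "0 \<le> 72 * Q ^ 9" by simp
  from two_step_gronwall[OF this T] obtain C2 h2 where h2: "h2 > 0" and gr:
    "\<forall>N h e. \<forall>x :: nat \<Rightarrow> real.
     0 < h \<longrightarrow> h \<le> h2 \<longrightarrow> real N * h \<le> T \<longrightarrow> 0 \<le> e \<longrightarrow> (\<forall>n. 0 \<le> x n) \<longrightarrow>
     (\<forall>n. Suc (Suc n) < N \<longrightarrow>
        x (Suc (Suc n)) \<le> x n + 72 * Q ^ 9 * (e + h * (x n + x (Suc n) + x (Suc (Suc n))))) \<longrightarrow>
     (\<forall>n. Suc n < N \<longrightarrow> h * (x n + x (Suc n)) \<le> C2 * (e + h * (x 0 + x 1)))" by blast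
  define C where "C = max Q (\<bar>C2\<bar> * (1 + 11 * Q\<^sup>2))"
  show ?thesis
  proof (rule exI[of _ C], rule exI[of _ "min h1 h2"], intro conjI allI impI)
    show "min h1 h2 > 0" using h1 h2 by simp
    fix N h E a \<rho> \<Delta> n
    assume err: "dg_error m T K q \<kappa> N h E a \<rho> \<Delta>" and hh: "h \<le> min h1 h2" and N: "2 \<le> N"
      and b0: "a 0 (m + 1) = 0" and n: "n < N"
    interpret dg_error m T K q \<kappa> N h E a \<rho> \<Delta> by (rule err)
    define e where "e = \<Delta> + h ^ (m + 2)"
    define e2 where "e2 = \<Delta> + h ^ (m + 3)"
    have e: "h ^ (m + 2) \<le> e" "\<Delta> \<le> e" "0 \<le> e" using \<Delta> h by (auto simp: e_def)
    have e2: "\<Delta> \<le> e2" "0 \<le> e2" using \<Delta> h by (auto simp: e2_def)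
    have he: "h * e \<le> e2"
    proof -
      have "h * e = h * \<Delta> + h ^ (m + 3)" by (simp only: e_def h_power_3 distrib_left)
      moreover have "h * \<Delta> \<le> \<Delta>" using mult_left_le_one_le[OF \<Delta>, of h] h by simp
      ultimately show ?thesis unfolding e2_def by linarith
    qed
    have st': "h * \<bar>a n m\<bar> \<le> Q * e \<and> lam n \<le> Q * e" if "n < N" for n
    proof -
      have "h * \<bar>a n m\<bar> \<le> C1 * e \<and> (\<Sum>j<m. \<bar>a n j\<bar>) \<le> C1 * e"
      proof (rule st[rule_format, OF err _ e(1,2) _ that])
        show "h \<le> h1" using hh by simp
        fix n assume n: "Suc n < N"
        have "\<bar>a n (m + 1) + (- 1) ^ m * a (Suc n) (m + 1)\<bar> = \<bar>a (Suc n) (m + 1) - a n (m + 1)\<bar>"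
          using odd by simp
        also have "\<dots> \<le> K * h ^ (m + 2)" by (rule b_diff[OF n])
        also have "\<dots> \<le> (2 * K) * e" using K e h by (intro mult_mono) auto
        finally show "\<bar>a n (m + 1) + (- 1) ^ m * a (Suc n) (m + 1)\<bar> \<le> 2 * K * e" .
      qed
      moreover have "C1 * e \<le> Q * e" using Q e by (intro mult_right_mono) auto
      ultimately show ?thesis unfolding lam_def by linarith
    qed
    have two: "h * (\<bar>a n m\<bar> + \<bar>a (Suc n) m\<bar>) \<le> C2 * (e2 + h * (\<bar>a 0 m\<bar> + \<bar>a 1 m\<bar>))" if "Suc n < N" for n
    proof (rule gr[rule_format, where x = "\<lambda>n. \<bar>a n m\<bar>", OF h(1) _ _ e2(2) _ _ that])
      show "\<bar>a (Suc (Suc n)) m\<bar> \<le> \<bar>a n m\<bar>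
          + 72 * Q ^ 9 * (e2 + h * (\<bar>a n m\<bar> + \<bar>a (Suc n) m\<bar> + \<bar>a (Suc (Suc n)) m\<bar>))"
        if n: "Suc (Suc n) < N" for n
        by (rule coefficient_two_step[OF Q(1) e(1) he e2(1) _ _ n odd]) (simp_all add: st')
    qed (use hh Nh in auto)
    \<comment> \<open>Without a top coefficient on the first cell \<open>d 0 \<le> lam 0\<close>,
      and \<open>d 1\<close> costs one \<open>coefficient_step\<close>. The sum
      \<open>2 * (Q * e) + 9 * (Q^2 * e)\<close> gives the 11.\<close>
    have start: "h * (\<bar>a 0 m\<bar> + \<bar>a 1 m\<bar>) \<le> 11 * Q\<^sup>2 * e2"
    proof -
      have 0: "\<bar>a 0 m\<bar> \<le> Q * e" using initial_coefficient_le b0 st'[of 0] N by auto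
      have "\<bar>a (Suc 0) m\<bar> \<le> \<bar>a 0 m\<bar> + 3 * K * (e + lam 0 + lam (Suc 0))"
      proof (rule coefficient_step[OF _ e(1)])
        show "Suc 0 < N" using N by simp
        have "\<bar>a 0 (m + 1) + (- 1) ^ m * a (Suc 0) (m + 1)\<bar> = \<bar>a (Suc 0) (m + 1) - a 0 (m + 1)\<bar>"
          using odd by simp
        also have "\<dots> \<le> K * h ^ (m + 2)" using N by (intro b_diff) auto
        also have "\<dots> \<le> (2 * K) * e" using K e h by (intro mult_mono) auto
        finally show "\<bar>a 0 (m + 1) + (- 1) ^ m * a (Suc 0) (m + 1)\<bar> \<le> 2 * K * e" .
      qed
      also have "\<dots> \<le> Q * e + 3 * Q * (Q * e + Q * e + Q * e)"
      proof (intro add_mono mult_mono 0)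
        show "e \<le> Q * e" using mult_right_mono[OF Q(3) e(3)] by simp
        show "lam 0 \<le> Q * e" "lam (Suc 0) \<le> Q * e" using st'[of 0] st'[of "Suc 0"] N by auto
      qed (use Q K e lam_nonneg in auto)
      also have "\<dots> = Q * e + 9 * (Q\<^sup>2 * e)" by (simp add: power2_eq_square)
      finally have "\<bar>a 0 m\<bar> + \<bar>a 1 m\<bar> \<le> 2 * (Q * e) + 9 * (Q\<^sup>2 * e)" using 0 by simp
      moreover have "Q * e \<le> Q\<^sup>2 * e"
        using mult_right_mono[OF Q(3), of "Q * e"] Q e by (simp add: power2_eq_square)
      ultimately have "\<bar>a 0 m\<bar> + \<bar>a 1 m\<bar> \<le> 11 * (Q\<^sup>2 * e)" by linarith
      then have "h * (\<bar>a 0 m\<bar> + \<bar>a 1 m\<bar>) \<le> h * (11 * (Q\<^sup>2 * e))" using h by (intro mult_left_mono) auto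
      also have "\<dots> = 11 * Q\<^sup>2 * (h * e)" by simp
      also have "\<dots> \<le> 11 * Q\<^sup>2 * e2" using he by (intro mult_left_mono) auto
      finally show ?thesis .
    qed
    have pair: "h * (\<bar>a n m\<bar> + \<bar>a (Suc n) m\<bar>) \<le> C * e2" if "Suc n < N" for n
    proof -
      have "C2 * (e2 + h * (\<bar>a 0 m\<bar> + \<bar>a 1 m\<bar>)) \<le> \<bar>C2\<bar> * (e2 + 11 * Q\<^sup>2 * e2)"
        using start e2 h by (intro mult_mono) auto
      also have "\<dots> = (\<bar>C2\<bar> * (1 + 11 * Q\<^sup>2)) * e2" by (simp only: distrib_left distrib_right mult_1_left mult.assoc)
      also have "\<dots> \<le> C * e2" using e2 by (intro mult_right_mono) (auto simp: C_def)
      finally show ?thesis using two[OF that] by linarith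
    qed
    have "h * \<bar>a n m\<bar> \<le> C * e2"
    \<comment> \<open>The last cell starts no pair and is covered by the pair that ends in it, which
      exists because \<open>2 \<le> N\<close>.\<close>
    proof (cases "Suc n < N")
      case True
      have "h * \<bar>a n m\<bar> \<le> h * (\<bar>a n m\<bar> + \<bar>a (Suc n) m\<bar>)" using h by (intro mult_left_mono) auto
      with pair[OF True] show ?thesis by linarith
    next
      case False
      then obtain i where i: "n = Suc i" "Suc i < N" using n N by (cases n) auto
      have "h * \<bar>a n m\<bar> \<le> h * (\<bar>a i m\<bar> + \<bar>a (Suc i) m\<bar>)" unfolding i(1) using h by (intro mult_left_mono) auto
      with pair[OF i(2)] show ?thesis by linarith
    qed
    then show "h * \<bar>a n m\<bar> \<le> C * (\<Delta> + h ^ (m + 3))" by (simp add: e2_def)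
    have "Q * e \<le> C * e" using e by (intro mult_right_mono) (auto simp: C_def)
    then have "lam n \<le> C * e" using st'[OF n] by linarith
    then show "(\<Sum>j<m. \<bar>a n j\<bar>) \<le> C * (\<Delta> + h ^ (m + 2))" by (simp add: lam_def e_def)
  qed
qed

text \<open>The terms with \<open>P m\<close> and \<open>P (m + 1)\<close> are kept apart, because
  at the points of interest one of them vanishes.\<close>

lemma (in dg_mesh) nodal_error_le:
  assumes n: "n < N" and x: "0 < x" "x < 1"
    and P': "\<And>j. j \<le> m + 1 \<Longrightarrow> \<bar>poly (pderiv (P j)) x\<bar> \<le> K"
  shows "h * \<bar>y (tn n x) - yh (tn n x)\<bar> \<le> K * (\<Sum>j<m. \<bar>a n j\<bar>)
    + \<bar>a n m * poly (pderiv (P m)) x\<bar> + \<bar>a n (m + 1) * poly (pderiv (P (m + 1))) x\<bar> + K * h ^ (m + 2)"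
proof -
  have "\<bar>\<Sum>j<m. a n j * poly (pderiv (P j)) x\<bar> \<le> (\<Sum>j<m. \<bar>a n j\<bar> * K)"
    using P' by (intro order_trans[OF sum_abs] sum_mono) (auto simp: abs_mult intro!: mult_left_mono)
  also have "\<dots> = K * (\<Sum>j<m. \<bar>a n j\<bar>)" by (simp only: sum_distrib_left mult.commute)
  finally have "\<bar>\<Sum>j<m. a n j * poly (pderiv (P j)) x\<bar> \<le> K * (\<Sum>j<m. \<bar>a n j\<bar>)" .
  moreover have "(\<Sum>j\<le>m + 1. a n j * poly (pderiv (P j)) x) = (\<Sum>j<m. a n j * poly (pderiv (P j)) x)
      + a n m * poly (pderiv (P m)) x + a n (m + 1) * poly (pderiv (P (m + 1))) x"
    by (simp flip: lessThan_Suc_atMost)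
  moreover have "h * \<bar>y (tn n x) - yh (tn n x)\<bar> = \<bar>h * e (tn n x)\<bar>" using h_pos by (simp add: e_def abs_mult)
  ultimately show ?thesis using error_rep[OF n x] by linarith
qed

text \<open>Data of class \<open>m + 3\<close> give \<open>y\<close> of class \<open>m + 2\<close>.
  Each required bound holds for all large \<open>K\<close>, so they hold for a common
  \<open>K\<close>.\<close>

lemma dg_problem_exists:
  assumes m: "1 \<le> m" and T: "T > 0" and k0: "k0 > 0" "\<forall>t\<in>{0..T}. \<bar>k t t\<bar> \<ge> k0"
    and y: "exact_solution T k g y"
    and g: "Ck_on (m + 3) {0..T} g" and k: "Ck_on (m + 3) (volterra_domain T) (\<lambda>(t, s). k t s)"
  shows "\<exists>K q c. dg_problem m T K q k g y (\<lambda>i. deriv_within i {0..T} y) c \<and>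
    (\<forall>j\<le>m + 1. \<forall>x\<in>{0..1}. \<bar>poly (pderiv (P j)) x\<bar> \<le> K)"
proof -
  let ?yd = "\<lambda>i. deriv_within i {0..T} y" and ?\<kappa> = "\<lambda>t. k t t"
  let ?k1 = "deriv_within 1 {0..T} ?\<kappa>" and ?k2 = "deriv_within 2 {0..T} ?\<kappa>"
  define c where "c = 1 / (fact m * (real m + 1) * lead_coeff (P (m + 1)))"
  have "Suc (m + 2) = m + 3" by simp
  then have yC: "Ck_on (m + 2) {0..T} y"
    using g k by (intro exact_solution_Ck_on[OF T k0 y]) (simp_all only:)
  have "continuous_on {0..T} (?yd i)" if "i \<le> m + 2" for i
  proof -
    have "Ck_on (0 + i) {0..T} y" using Ck_on_mono[OF yC that] by simp
    from Ck_on_deriv_within[OF T this] show ?thesis by simp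
  qed
  then have yc: "continuous_on {0..T} (?yd m)" "continuous_on {0..T} (?yd (m + 1))" "continuous_on {0..T} (?yd (m + 2))"
    by simp_all
  have \<kappa>C: "Ck_on 2 {0..T} ?\<kappa>"
    using Ck_on_diagonal[of "{0..T}" "volterra_domain T" 2 "\<lambda>(t, s). k t s"] Ck_on_mono[OF k, of 2] by simp
  have "Ck_on (0 + 1) {0..T} ?\<kappa>" "Ck_on (0 + 2) {0..T} ?\<kappa>"
    by (rule Ck_on_mono[OF \<kappa>C], simp)+
  note this[THEN Ck_on_deriv_within[OF T]]
  then have \<kappa>c: "continuous_on {0..T} ?\<kappa>" "continuous_on {0..T} ?k1" "continuous_on {0..T} ?k2"
    using Ck_on_imp_continuous_on[OF \<kappa>C] by (simp_all only: Ck_on.simps(1))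
  have \<kappa>1: "(?\<kappa> has_real_derivative ?k1 t) (at t within {0..T})" if "t \<in> {0..T}" for t
    using deriv_within_has_derivative[OF T, of 0 ?\<kappa> t] Ck_on_mono[OF \<kappa>C, of 1] that by simp
  have \<kappa>2: "(?k1 has_real_derivative ?k2 t) (at t within {0..T})" if "t \<in> {0..T}" for t
    using deriv_within_has_derivative[OF T, of 1 ?\<kappa> t] \<kappa>C that by (simp add: numeral_2_eq_2)
  have "Ck_on 3 (volterra_domain T) (\<lambda>(t, s). k t s)" by (rule Ck_on_mono[OF k]) simp
  from kernel_bounds[OF this] obtain q where qc: "continuous_on (volterra_domain T) (\<lambda>(t, s). q t s)"
    and qd: "\<forall>t s. 0 \<le> s \<longrightarrow> s \<le> t \<longrightarrow> t \<le> T \<longrightarrow> ((\<lambda>s. k t s) has_real_derivative q t s) (at s within {0..t})"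
    and qb: "\<forall>\<^sub>F K in at_top.
      (\<forall>t s. 0 \<le> s \<longrightarrow> s \<le> t \<longrightarrow> t \<le> T \<longrightarrow> \<bar>q t s\<bar> \<le> K) \<and>
      (\<forall>t s s'. 0 \<le> s \<longrightarrow> s \<le> s' \<longrightarrow> s' \<le> t \<longrightarrow> t \<le> T \<longrightarrow> \<bar>q t s' - q t s\<bar> \<le> K * (s' - s)) \<and>
      (\<forall>t t' s. 0 \<le> s \<longrightarrow> s \<le> t \<longrightarrow> t \<le> t' \<longrightarrow> t' \<le> T \<longrightarrow> \<bar>q t' s - q t s\<bar> \<le> K * (t' - t)) \<and>
      (\<forall>t t' s s'. 0 \<le> s \<longrightarrow> s \<le> s' \<longrightarrow> s' \<le> t \<longrightarrow> t \<le> t' \<longrightarrow> t' \<le> T \<longrightarrow>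
         \<bar>(q t' s' - q t s') - (q t' s - q t s)\<bar> \<le> K * (t' - t) * (s' - s))" by blast
  note ev = eventually_abs_le[OF compact_Icc]
  have "\<forall>\<^sub>F K in at_top. 1 \<le> K \<and> real m \<le> K \<and> T \<le> K \<and> 1 \<le> K * k0" 
    using eventually_ge_at_top[of 1] eventually_ge_at_top[of "real m"] eventually_ge_at_top[of T] eventually_mult_ge_1[OF k0(1)]
    by eventually_elim blast
  then have "\<forall>\<^sub>F K in at_top. dg_problem m T K q k g y ?yd c \<and> (\<forall>j\<le>m + 1. \<forall>x\<in>{0..1}. \<bar>poly (pderiv (P j)) x\<bar> \<le> K)"
    using qb legendre_bounds[of "m + 1"] ev[OF \<kappa>c(1)] ev[OF \<kappa>c(2)] ev[OF \<kappa>c(3)] ev[OF yc(2)] ev[OF yc(3)]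
      ev[OF continuous_on_mult_left[OF yc(1), of c]] ev[OF continuous_on_mult_left[OF yc(2), of c]]
      ev[OF continuous_on_mult_left[OF yc(3), of c]]
  proof eventually_elim
    case (elim K)
    note q_facts = elim(2)
    have lip1: "\<bar>?k1 t' - ?k1 t\<bar> \<le> K * (t' - t)" if "0 \<le> t" "t \<le> t'" "t' \<le> T" for t t'
      by (rule real_derivative_bound[where f = "?k1" and x = t and y = t', OF \<kappa>2]) (use elim(6) that in auto)
    have "dg_problem m T K q k g y ?yd c"
    proof unfold_locales
      show "1 \<le> m" "T > 0" using m T by blast+
      show "1 \<le> K" "real m \<le> K" "T \<le> K" using elim(1) by blast+
      show "\<bar>poly (P j) x\<bar> \<le> K" if "j \<le> m + 1" "x \<in> {0..1}" for j x using elim(3) that by blast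
      show "1 \<le> K * legendre_weight j" "legendre_weight j \<le> K" if "j < m" for j using elim(3) that by auto
      show "continuous_on (volterra_domain T) (\<lambda>(t, s). q t s)" by (rule qc)
      show "\<bar>q t s\<bar> \<le> K" if "0 \<le> s" "s \<le> t" "t \<le> T" for t s using q_facts that by blast
      show "\<bar>q t s' - q t s\<bar> \<le> K * (s' - s)" if "0 \<le> s" "s \<le> s'" "s' \<le> t" "t \<le> T" for t s s'
        using q_facts that by blast
      show "\<bar>q t' s - q t s\<bar> \<le> K * (t' - t)" if "0 \<le> s" "s \<le> t" "t \<le> t'" "t' \<le> T" for t t' s
        using q_facts that by blast
      show "\<bar>(q t' s' - q t s') - (q t' s - q t s)\<bar> \<le> K * (t' - t) * (s' - s)"
        if "0 \<le> s" "s \<le> s'" "s' \<le> t" "t \<le> t'" "t' \<le> T" for t t' s s' using q_facts that by blast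
      show "continuous_on {0..T} ?\<kappa>" by (rule \<kappa>c)
      show "1 \<le> K * \<bar>k t t\<bar>" if "t \<in> {0..T}" for t
      proof -
        have "K * k0 \<le> K * \<bar>k t t\<bar>" using k0 that elim(1) by (intro mult_left_mono) auto
        then show ?thesis using elim(1) by linarith
      qed
      show "\<bar>k t t\<bar> \<le> K" if "t \<in> {0..T}" for t using elim(4) that by blast
      show "\<bar>k t' t' - k t t\<bar> \<le> K * (t' - t)" if "0 \<le> t" "t \<le> t'" "t' \<le> T" for t t'
        by (rule real_derivative_bound[where f = "?\<kappa>" and x = t and y = t', OF \<kappa>1]) (use elim(5) that in auto)
      show "\<bar>(k (t' + r) (t' + r) - k (t + r) (t + r)) - (k t' t' - k t t)\<bar> \<le> K * (t' - t) * r"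
        if "0 \<le> t" "t \<le> t'" "0 \<le> r" "t' + r \<le> T" for t t' r
        by (rule second_difference_le[where f = "?\<kappa>", OF \<kappa>1 lip1]) (use that in auto)
      show "continuous_on (volterra_domain T) (\<lambda>(t, s). k t s)" by (rule Ck_on_imp_continuous_on[OF k])
      show "((\<lambda>s. k t s) has_real_derivative q t s) (at s within {0..t})" if "0 \<le> s" "s \<le> t" "t \<le> T" for t s
        using qd that by blast
      show "exact_solution T k g y" by (rule y)
      show "continuous_on {0..T} g" by (rule Ck_on_imp_continuous_on[OF g])
      show "?yd 0 = y" by simp
      show "(?yd i has_real_derivative ?yd (Suc i) x) (at x within {0..T})" if "i \<le> m + 1" "x \<in> {0..T}" for i x
        by (rule deriv_within_has_derivative[OF T Ck_on_mono[OF yC] that(2)]) (use that in simp)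
      show "c = 1 / (fact m * (real m + 1) * lead_coeff (P (m + 1)))" by (rule c_def)
      fix x assume x: "x \<in> {0..T}"
      show "\<bar>?yd (m + 1) x\<bar> \<le> K" "\<bar>?yd (m + 2) x\<bar> \<le> K" "\<bar>c * ?yd m x\<bar> \<le> K"
        "\<bar>c * ?yd (m + 1) x\<bar> \<le> K" "\<bar>c * ?yd (m + 2) x\<bar> \<le> K"
        using elim(7-11)[rule_format, OF x] .
    qed
    moreover have "\<forall>j\<le>m + 1. \<forall>x\<in>{0..1}. \<bar>poly (pderiv (P j)) x\<bar> \<le> K" using elim(3) by blast
    ultimately show ?case by blast
  qed
  then have "\<exists>K. dg_problem m T K q k g y ?yd c \<and> (\<forall>j\<le>m + 1. \<forall>x\<in>{0..1}. \<bar>poly (pderiv (P j)) x\<bar> \<le> K)"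
    by (rule eventually_happens'[OF trivial_limit_at_top_linorder])
  then show ?thesis by blast
qed

text \<open>\<open>i\<close> counts the powers of \<open>h\<close> lost to differentiation and
  accumulation; the factor \<open>h ^ i\<close> postpones the division. The perturbation enters only
  through its bound \<open>\<Delta>\<close>, so \<open>C\<close> depends neither on it nor on the
  mesh.\<close>

definition nodal_estimate where
  "nodal_estimate m T k g y p i M \<longleftrightarrow> (\<exists>C h0. h0 > 0 \<and> 0 \<le> C \<and>
    (\<forall>N\<ge>2. \<forall>yh \<delta> \<Delta> n x. mesh_width T N \<le> h0 \<longrightarrow> perturbed_dg_solution m T N k g \<delta> yh \<longrightarrow>
      (\<forall>t\<in>{0..T}. \<bar>\<delta> t\<bar> \<le> \<Delta>) \<longrightarrow> n < N \<longrightarrow> 0 < x \<longrightarrow> x < 1 \<longrightarrow> poly p x = 0 \<longrightarrow>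
      mesh_width T N ^ i * \<bar>y (mesh_pt T N n + x * mesh_width T N) - yh (mesh_pt T N n + x * mesh_width T N)\<bar>
        \<le> C * (\<Delta> + mesh_width T N ^ (M + i))))"

text \<open>The top coefficients of neighbouring cells add, so the defect is
  \<open>\<Delta> + h ^ (m + 1)\<close>. As the factor of \<open>a n m\<close> is zero at these
  points, the bound on the lower coefficients suffices and one power of \<open>h\<close> is
  lost.\<close>

lemma even_error:
  assumes prob: "dg_problem m T K q k g y yd c" and P': "\<forall>j\<le>m + 1. \<forall>x\<in>{0..1}. \<bar>poly (pderiv (P j)) x\<bar> \<le> K"
    and even: "even m"
  shows "nodal_estimate m T k g y (pderiv (P m)) 1 m"
proof -
  interpret dg_problem m T K q k g y yd c by (rule prob)
  from stability[OF less_imp_le[OF T_pos]] obtain C h0 where h0: "h0 > 0" and st: "\<forall>N h E a \<rho> \<Delta> e.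
    dg_error m T K q (\<lambda>t. k t t) N h E a \<rho> \<Delta> \<longrightarrow> h \<le> h0 \<longrightarrow> h ^ (m + 2) \<le> e \<longrightarrow> \<Delta> \<le> e \<longrightarrow>
    (\<forall>n. Suc n < N \<longrightarrow> \<bar>a n (m + 1) + (- 1) ^ m * a (Suc n) (m + 1)\<bar> \<le> 2 * K * e) \<longrightarrow>
    (\<forall>n<N. h * \<bar>a n m\<bar> \<le> C * e \<and> (\<Sum>j<m. \<bar>a n j\<bar>) \<le> C * e)" by blast
  define C' where "C' = K * \<bar>C\<bar> + K * K + K"
  show ?thesis unfolding nodal_estimate_def
  proof (rule exI[of _ C'], rule exI[of _ "min 1 h0"], intro conjI allI impI)
    show "0 \<le> C'" using K by (simp add: C'_def)
    fix N yh \<delta> \<Delta> n x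
    assume N: "2 \<le> N" and hh: "mesh_width T N \<le> min 1 h0" and yh: "perturbed_dg_solution m T N k g \<delta> yh"
      and \<delta>: "\<forall>t\<in>{0..T}. \<bar>\<delta> t\<bar> \<le> \<Delta>" and n: "n < N" and x: "0 < x" "x < 1" and root: "poly (pderiv (P m)) x = 0"
    define h where "h = mesh_width T N"
    interpret dg_mesh m T K q k g y yd c N h yh \<delta> \<Delta>
      by unfold_locales (use h_def hh N yh \<delta> in auto)
    interpret err: dg_error m T K q "\<lambda>t. k t t" N h E a \<rho> \<Delta> by (rule is_dg_error)
    define e where "e = \<Delta> + h ^ (m + 1)"
    have hp: "h ^ (m + 2) \<le> h ^ (m + 1)" using h_pos h by (intro power_decreasing) auto
    have "0 \<le> h ^ (m + 1)" using h_pos by simp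
    then have e: "h ^ (m + 2) \<le> e" "\<Delta> \<le> e" "h ^ (m + 1) \<le> e" "0 \<le> e"
      using hp \<Delta>_nonneg unfolding e_def by linarith+
    have "(\<Sum>j<m. \<bar>a n j\<bar>) \<le> C * e"
    proof (rule st[rule_format, OF is_dg_error _ e(1,2) _ n, THEN conjunct2])
      show "h \<le> h0" using hh by (simp add: h_def)
      fix n assume n: "Suc n < N"
      have "\<bar>a n (m + 1) + (- 1) ^ m * a (Suc n) (m + 1)\<bar> \<le> \<bar>a n (m + 1)\<bar> + \<bar>a (Suc n) (m + 1)\<bar>"
        using even by simp
      also have "\<dots> \<le> K * h ^ (m + 1) + K * h ^ (m + 1)" using n by (intro add_mono err.b_le) auto
      also have "\<dots> \<le> K * e + K * e" using K e by (intro add_mono mult_left_mono) auto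
      finally show "\<bar>a n (m + 1) + (- 1) ^ m * a (Suc n) (m + 1)\<bar> \<le> 2 * K * e" by simp
    qed
    also have "\<dots> \<le> \<bar>C\<bar> * e" using e by (intro mult_right_mono) auto
    finally have lam: "K * (\<Sum>j<m. \<bar>a n j\<bar>) \<le> K * (\<bar>C\<bar> * e)" using K by (intro mult_left_mono) auto
    have b: "\<bar>a n (m + 1) * poly (pderiv (P (m + 1))) x\<bar> \<le> (K * e) * K"
      unfolding abs_mult
    proof (intro mult_mono)
      show "\<bar>a n (m + 1)\<bar> \<le> K * e" using err.b_le[OF n] mult_left_mono[OF e(3), of K] K by linarith
      show "\<bar>poly (pderiv (P (m + 1))) x\<bar> \<le> K" using P' x by auto
    qed (use K e in auto)
    have "h * \<bar>y (tn n x) - yh (tn n x)\<bar> \<le> K * (\<Sum>j<m. \<bar>a n j\<bar>)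
      + \<bar>a n m * poly (pderiv (P m)) x\<bar> + \<bar>a n (m + 1) * poly (pderiv (P (m + 1))) x\<bar> + K * h ^ (m + 2)"
      by (rule nodal_error_le[OF n x]) (use P' x in auto)
    also have "\<dots> \<le> K * (\<bar>C\<bar> * e) + 0 + (K * e) * K + K * e"
      using lam b root mult_left_mono[OF e(1), of K] K by (intro add_mono) auto
    also have "\<dots> = C' * e" by (simp add: C'_def algebra_simps)
    finally show "mesh_width T N ^ 1 * \<bar>y (mesh_pt T N n + x * mesh_width T N) - yh (mesh_pt T N n + x * mesh_width T N)\<bar>
      \<le> C' * (\<Delta> + mesh_width T N ^ (m + 1))"
      by (simp add: mesh_pt_def e_def h_def mult.commute)
  qed (use h0 in auto)
qed

text \<open>At these points the term with the top coefficient, of order \<open>h ^ (m + 1)\<close>,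
  disappears. The one with \<open>a n m\<close> survives and is bounded only after multiplication by
  \<open>h\<close>, hence the second lost power.\<close>

lemma odd_error:
  assumes prob: "dg_problem m T K q k g y yd c" and P': "\<forall>j\<le>m + 1. \<forall>x\<in>{0..1}. \<bar>poly (pderiv (P j)) x\<bar> \<le> K"
    and odd: "odd m" and y0: "yd m 0 = 0"
  shows "nodal_estimate m T k g y (pderiv (P (m + 1))) 2 (m + 1)"
proof -
  interpret dg_problem m T K q k g y yd c by (rule prob)
  from odd_stability[OF less_imp_le[OF T_pos] odd] obtain C h0 where h0: "h0 > 0" and st: "\<forall>N h E a \<rho> \<Delta>.
    dg_error m T K q (\<lambda>t. k t t) N h E a \<rho> \<Delta> \<longrightarrow> h \<le> h0 \<longrightarrow> 2 \<le> N \<longrightarrow> a 0 (m + 1) = 0 \<longrightarrow>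
    (\<forall>n<N. h * \<bar>a n m\<bar> \<le> C * (\<Delta> + h ^ (m + 3)) \<and> (\<Sum>j<m. \<bar>a n j\<bar>) \<le> C * (\<Delta> + h ^ (m + 2)))" by blast
  define C' where "C' = 2 * (K * \<bar>C\<bar>) + K"
  show ?thesis unfolding nodal_estimate_def
  proof (rule exI[of _ C'], rule exI[of _ "min 1 h0"], intro conjI allI impI)
    show "0 \<le> C'" using K by (simp add: C'_def)
    fix N yh \<delta> \<Delta> n x
    assume N: "2 \<le> N" and hh: "mesh_width T N \<le> min 1 h0" and yh: "perturbed_dg_solution m T N k g \<delta> yh"
      and \<delta>: "\<forall>t\<in>{0..T}. \<bar>\<delta> t\<bar> \<le> \<Delta>" and n: "n < N" and x: "0 < x" "x < 1"
      and root: "poly (pderiv (P (m + 1))) x = 0"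
    define h where "h = mesh_width T N"
    interpret dg_mesh m T K q k g y yd c N h yh \<delta> \<Delta>
      by unfold_locales (use h_def hh N yh \<delta> in auto)
    interpret err: dg_error m T K q "\<lambda>t. k t t" N h E a \<rho> \<Delta> by (rule is_dg_error)
    define e2 where "e2 = \<Delta> + h ^ (m + 3)"
    have e2: "0 \<le> e2" "h ^ (m + 3) \<le> e2" using \<Delta>_nonneg h_pos by (auto simp: e2_def)
    have b0: "a 0 (m + 1) = 0" using a_props(2)[of 0] y0 N by simp
    have "h \<le> h0" using hh by (simp add: h_def)
    from st[rule_format, OF is_dg_error this N b0 n] have d: "h * \<bar>a n m\<bar> \<le> C * e2"
      and lam: "(\<Sum>j<m. \<bar>a n j\<bar>) \<le> C * (\<Delta> + h ^ (m + 2))" by (auto simp: e2_def)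
    have Ce: "C * e2 \<le> \<bar>C\<bar> * e2" using e2 by (intro mult_right_mono) auto
    have lam': "h * (\<Sum>j<m. \<bar>a n j\<bar>) \<le> \<bar>C\<bar> * e2"
    proof -
      have "h * (\<Sum>j<m. \<bar>a n j\<bar>) \<le> h * (\<bar>C\<bar> * (\<Delta> + h ^ (m + 2)))"
      proof (rule mult_left_mono)
        have "C * (\<Delta> + h ^ (m + 2)) \<le> \<bar>C\<bar> * (\<Delta> + h ^ (m + 2))"
          using \<Delta>_nonneg h_pos by (intro mult_right_mono) auto
        then show "(\<Sum>j<m. \<bar>a n j\<bar>) \<le> \<bar>C\<bar> * (\<Delta> + h ^ (m + 2))" using lam by linarith
      qed (use h_pos in simp)
      also have "\<dots> = \<bar>C\<bar> * (h * \<Delta> + h * h ^ (m + 2))" by (simp only: distrib_left mult.left_commute)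
      also have "\<dots> \<le> \<bar>C\<bar> * (\<Delta> + h ^ (m + 3))"
      proof (intro mult_left_mono add_mono)
        show "h * \<Delta> \<le> \<Delta>" using mult_left_le_one_le[OF \<Delta>_nonneg, of h] h(2) h_pos by simp
        show "h * h ^ (m + 2) \<le> h ^ (m + 3)" by (simp only: err.h_power_3 order_refl)
      qed simp
      finally show ?thesis by (simp add: e2_def)
    qed
    have d': "h * \<bar>a n m * poly (pderiv (P m)) x\<bar> \<le> K * (\<bar>C\<bar> * e2)"
    proof -
      have "h * \<bar>a n m * poly (pderiv (P m)) x\<bar> = (h * \<bar>a n m\<bar>) * \<bar>poly (pderiv (P m)) x\<bar>" by (simp add: abs_mult)
      also have "\<dots> \<le> (\<bar>C\<bar> * e2) * K"
      proof (rule mult_mono)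
        show "h * \<bar>a n m\<bar> \<le> \<bar>C\<bar> * e2" using d Ce by linarith
        show "\<bar>poly (pderiv (P m)) x\<bar> \<le> K" using P' x by auto
      qed (use e2 in auto)
      finally show ?thesis by (simp add: mult.commute)
    qed
    have "h * (h * \<bar>y (tn n x) - yh (tn n x)\<bar>) \<le> h * (K * (\<Sum>j<m. \<bar>a n j\<bar>)
      + \<bar>a n m * poly (pderiv (P m)) x\<bar> + \<bar>a n (m + 1) * poly (pderiv (P (m + 1))) x\<bar> + K * h ^ (m + 2))"
      by (intro mult_left_mono nodal_error_le[OF n x]) (use P' x h_pos in auto)
    also have "\<dots> = K * (h * (\<Sum>j<m. \<bar>a n j\<bar>)) + h * \<bar>a n m * poly (pderiv (P m)) x\<bar> + K * h ^ (m + 3)"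
      unfolding root err.h_power_3 by (simp add: distrib_left)
    also have "\<dots> \<le> K * (\<bar>C\<bar> * e2) + K * (\<bar>C\<bar> * e2) + K * e2"
      using lam' d' e2 K by (intro add_mono mult_left_mono) auto
    also have "\<dots> = C' * e2" by (simp add: C'_def algebra_simps)
    finally have "h * (h * \<bar>y (tn n x) - yh (tn n x)\<bar>) \<le> C' * e2" .
    moreover have "m + 1 + 2 = m + 3" by simp
    ultimately show "mesh_width T N ^ 2 * \<bar>y (mesh_pt T N n + x * mesh_width T N) - yh (mesh_pt T N n + x * mesh_width T N)\<bar>
      \<le> C' * (\<Delta> + mesh_width T N ^ (m + 1 + 2))"
      by (simp only: mesh_pt_def e2_def h_def mult.commute[of x] power2_eq_square mult.assoc)
  qed (use h0 in auto)
qed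

text \<open>Division by \<open>h ^ i\<close> yields the rates \<open>h powr M\<close> and
  \<open>h powr (m1 - i)\<close>; for \<open>h \<le> 1\<close> and \<open>i \<le> 2\<close> both are
  at most \<open>h powr min M (m1 - 2)\<close>.\<close>

lemma powr_rate:
  fixes h v m1 :: real
  assumes h: "0 < h" "h \<le> 1" and C: "0 \<le> C" "0 \<le> C1" and i: "i \<le> 2"
    and v: "h ^ i * v \<le> C * (C1 * h powr m1 + h ^ (M + i))"
  shows "v \<le> (C * (C1 + 1)) * h powr min (real M) (m1 - 2)"
proof -
  have hi: "h ^ i = h powr real i" using h by (simp add: powr_realpow)
  have "h powr m1 = h ^ i * h powr (m1 - real i)" unfolding hi powr_add[symmetric] by simp
  moreover have "h ^ (M + i) = h ^ i * h powr real M" using h by (simp add: power_add powr_realpow)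
  ultimately have "h ^ i * v \<le> h ^ i * (C * (C1 * h powr (m1 - real i) + h powr real M))"
    using v by (simp add: algebra_simps)
  then have "v \<le> C * (C1 * h powr (m1 - real i) + h powr real M)" using h by simp
  also have "\<dots> \<le> C * (C1 * h powr min (real M) (m1 - 2) + h powr min (real M) (m1 - 2))"
    using h C i by (intro mult_left_mono add_mono powr_mono') auto
  also have "\<dots> = (C * (C1 + 1)) * h powr min (real M) (m1 - 2)" by (simp add: algebra_simps)
  finally show ?thesis .
qed

text \<open>The estimate is applied with \<open>\<Delta>\<close> equal to \<open>h powr m1\<close>
  times the absolute value of \<open>C1\<close>, which keeps the final constant nonnegative.\<close>

lemma nodal_rate:
  fixes s :: "nat \<Rightarrow> real" and \<delta> :: "nat \<Rightarrow> real \<Rightarrow> real"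
  assumes T: "T > 0" and est: "nodal_estimate m T k g y p i M" and i: "i \<le> 2"
    and \<delta>: "\<exists>C'. \<forall>N\<ge>2. \<forall>t\<in>{0..T}. \<bar>\<delta> N t\<bar> \<le> C' * mesh_width T N powr m1"
    and s: "\<And>r. r \<in> I \<Longrightarrow> poly p (s r) = 0" "\<And>r. r \<in> I \<Longrightarrow> 0 < s r" "\<And>r. r \<in> I \<Longrightarrow> s r < 1"
  shows "\<exists>C h0. h0 > 0 \<and>
    (\<forall>N\<ge>2. mesh_width T N \<le> h0 \<longrightarrow>
      (\<forall>yh. perturbed_dg_solution m T N k g (\<delta> N) yh \<longrightarrow>
        (\<forall>n\<in>{0..N - 1}. \<forall>r\<in>I.
          \<bar>y (mesh_pt T N n + s r * mesh_width T N) - yh (mesh_pt T N n + s r * mesh_width T N)\<bar>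
            \<le> C * mesh_width T N powr (min (real M) (m1 - 2)))))"
proof -
  obtain C1 where C1: "\<forall>N\<ge>2. \<forall>t\<in>{0..T}. \<bar>\<delta> N t\<bar> \<le> C1 * mesh_width T N powr m1" using \<delta> by blast
  have \<delta>_le: "\<bar>\<delta> N t\<bar> \<le> \<bar>C1\<bar> * mesh_width T N powr m1" if "2 \<le> N" "t \<in> {0..T}" for N t
  proof -
    have "C1 * mesh_width T N powr m1 \<le> \<bar>C1\<bar> * mesh_width T N powr m1" by (intro mult_right_mono) auto
    then show ?thesis using C1 that by fastforce
  qed
  obtain C h0 where h0: "h0 > 0" and C: "0 \<le> C" and err: "\<forall>N\<ge>2. \<forall>yh \<delta> \<Delta> n x.
      mesh_width T N \<le> h0 \<longrightarrow> perturbed_dg_solution m T N k g \<delta> yh \<longrightarrow>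
      (\<forall>t\<in>{0..T}. \<bar>\<delta> t\<bar> \<le> \<Delta>) \<longrightarrow> n < N \<longrightarrow> 0 < x \<longrightarrow> x < 1 \<longrightarrow> poly p x = 0 \<longrightarrow>
      mesh_width T N ^ i * \<bar>y (mesh_pt T N n + x * mesh_width T N) - yh (mesh_pt T N n + x * mesh_width T N)\<bar>
        \<le> C * (\<Delta> + mesh_width T N ^ (M + i))"
    using est unfolding nodal_estimate_def by blast
  show ?thesis
  proof (rule exI[of _ "C * (\<bar>C1\<bar> + 1)"], rule exI[of _ "min 1 h0"], intro conjI allI impI ballI)
    fix N yh n r
    assume N: "2 \<le> N" and hh: "mesh_width T N \<le> min 1 h0" and yh: "perturbed_dg_solution m T N k g (\<delta> N) yh"
      and n: "n \<in> {0..N - 1}" and r: "r \<in> I"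
    have "mesh_width T N ^ i * \<bar>y (mesh_pt T N n + s r * mesh_width T N) - yh (mesh_pt T N n + s r * mesh_width T N)\<bar>
      \<le> C * (\<bar>C1\<bar> * mesh_width T N powr m1 + mesh_width T N ^ (M + i))"
      using \<delta>_le[OF N] n N hh by (intro err[rule_format, OF N _ yh _ _ s(2,3,1)[OF r]]) auto
    moreover have "0 < mesh_width T N" using T N by (simp add: mesh_width_def)
    ultimately show "\<bar>y (mesh_pt T N n + s r * mesh_width T N) - yh (mesh_pt T N n + s r * mesh_width T N)\<bar>
      \<le> C * (\<bar>C1\<bar> + 1) * mesh_width T N powr (min (real M) (m1 - 2))"
      using hh C by (intro powr_rate[OF _ _ _ _ i]) auto
  qed (use h0 in simp)
qed

theorem theorem3p10:
  fixes m :: nat and T k0 m1 :: real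
    and k :: "real \<Rightarrow> real \<Rightarrow> real" and g y :: "real \<Rightarrow> real"
    and \<delta> :: "nat \<Rightarrow> real \<Rightarrow> real"
  assumes "m \<ge> 1" and "T > 0"
    and "g 0 = 0"
    and "k0 > 0" and "\<forall>t\<in>{0..T}. \<bar>k t t\<bar> \<ge> k0"
    and "exact_solution T k g y"
    and "\<forall>N\<ge>2. \<delta> N integrable_on {0..T}"
    and "\<exists>C'. \<forall>N\<ge>2. \<forall>t\<in>{0..T}. \<bar>\<delta> N t\<bar> \<le> C' * mesh_width T N powr m1"
  shows
    "(odd m \<and> Ck_on (m + 4) {0..T} g \<and> Ck_on (m + 4) (volterra_domain T) (\<lambda>(t, s). k t s) \<and>
        deriv_within m {0..T} y 0 = 0 \<longrightarrow>
      (\<forall>s :: nat \<Rightarrow> real.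
        (\<forall>r\<in>{0..m - 1}. poly (pderiv (shifted_legendre (m + 1))) (s r) = 0) \<longrightarrow>
        (\<exists>C h0. h0 > 0 \<and>
          (\<forall>N\<ge>2. mesh_width T N \<le> h0 \<longrightarrow>
            (\<forall>yh. perturbed_dg_solution m T N k g (\<delta> N) yh \<longrightarrow>
              (\<forall>n\<in>{0..N - 1}. \<forall>r\<in>{0..m - 1}.
                \<bar>y (mesh_pt T N n + s r * mesh_width T N)
                  - yh (mesh_pt T N n + s r * mesh_width T N)\<bar>
                \<le> C * mesh_width T N powr (min (real m + 1) (m1 - 2))))))))
     \<and>
     (even m \<and> Ck_on (m + 3) {0..T} g \<and> Ck_on (m + 3) (volterra_domain T) (\<lambda>(t, s). k t s) \<longrightarrow>
      (\<forall>s :: nat \<Rightarrow> real.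
        (\<forall>r\<in>{1..m - 1}. poly (pderiv (shifted_legendre m)) (s r) = 0) \<longrightarrow>
        (\<exists>C h0. h0 > 0 \<and>
          (\<forall>N\<ge>2. mesh_width T N \<le> h0 \<longrightarrow>
            (\<forall>yh. perturbed_dg_solution m T N k g (\<delta> N) yh \<longrightarrow>
              (\<forall>n\<in>{0..N - 1}. \<forall>r\<in>{1..m - 1}.
                \<bar>y (mesh_pt T N n + s r * mesh_width T N)
                  - yh (mesh_pt T N n + s r * mesh_width T N)\<bar>
                \<le> C * mesh_width T N powr (min (real m) (m1 - 2))))))))"
proof (intro conjI impI allI)
  fix s :: "nat \<Rightarrow> real"
  assume a: "odd m \<and> Ck_on (m + 4) {0..T} g \<and> Ck_on (m + 4) (volterra_domain T) (\<lambda>(t, s). k t s) \<and>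
      deriv_within m {0..T} y 0 = 0"
    and s: "\<forall>r\<in>{0..m - 1}. poly (pderiv (P (m + 1))) (s r) = 0"
  have gk: "Ck_on (m + 3) {0..T} g" "Ck_on (m + 3) (volterra_domain T) (\<lambda>(t, s). k t s)"
    using a by (auto elim!: Ck_on_mono)
  obtain K q c where prob: "dg_problem m T K q k g y (\<lambda>i. deriv_within i {0..T} y) c"
    and P': "\<forall>j\<le>m + 1. \<forall>x\<in>{0..1}. \<bar>poly (pderiv (P j)) x\<bar> \<le> K"
    using dg_problem_exists[OF assms(1,2,4,5,6) gk] by blast
  \<comment> \<open>Here the vanishing \<open>m\<close>-th derivative of \<open>y\<close> at
    \<open>0\<close> enters, in the form \<open>yd m 0 = 0\<close>.\<close>
  have est: "nodal_estimate m T k g y (pderiv (P (m + 1))) 2 (m + 1)" using odd_error[OF prob P'] a by blast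
  have "real m + 1 = real (m + 1)" by simp
  then show "\<exists>C h0. h0 > 0 \<and>
        (\<forall>N\<ge>2. mesh_width T N \<le> h0 \<longrightarrow>
          (\<forall>yh. perturbed_dg_solution m T N k g (\<delta> N) yh \<longrightarrow>
            (\<forall>n\<in>{0..N - 1}. \<forall>r\<in>{0..m - 1}.
              \<bar>y (mesh_pt T N n + s r * mesh_width T N)
                - yh (mesh_pt T N n + s r * mesh_width T N)\<bar>
              \<le> C * mesh_width T N powr (min (real m + 1) (m1 - 2)))))"
    by (simp only:, intro nodal_rate[OF assms(2) est _ assms(8)])
      (use s legendre_deriv_root[of "m + 1"] in auto)
next
  fix s :: "nat \<Rightarrow> real"
  assume a: "even m \<and> Ck_on (m + 3) {0..T} g \<and> Ck_on (m + 3) (volterra_domain T) (\<lambda>(t, s). k t s)"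
    and s: "\<forall>r\<in>{1..m - 1}. poly (pderiv (P m)) (s r) = 0"
  obtain K q c where prob: "dg_problem m T K q k g y (\<lambda>i. deriv_within i {0..T} y) c"
    and P': "\<forall>j\<le>m + 1. \<forall>x\<in>{0..1}. \<bar>poly (pderiv (P j)) x\<bar> \<le> K"
    using dg_problem_exists[OF assms(1,2,4,5,6)] a by blast
  have est: "nodal_estimate m T k g y (pderiv (P m)) 1 m" using even_error[OF prob P'] a by blast
  show "\<exists>C h0. h0 > 0 \<and>
        (\<forall>N\<ge>2. mesh_width T N \<le> h0 \<longrightarrow>
          (\<forall>yh. perturbed_dg_solution m T N k g (\<delta> N) yh \<longrightarrow>
            (\<forall>n\<in>{0..N - 1}. \<forall>r\<in>{1..m - 1}.
              \<bar>y (mesh_pt T N n + s r * mesh_width T N)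
                - yh (mesh_pt T N n + s r * mesh_width T N)\<bar>
              \<le> C * mesh_width T N powr (min (real m) (m1 - 2)))))"
    by (rule nodal_rate[OF assms(2) est _ assms(8)]) (use s legendre_deriv_root[OF assms(1)] in auto)
qed

end
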